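(* Let $\Pi$ be a finitely generated commutative monoid, let $S$ be a finitely generated $\Pi$-set, and let $\leq$ be a preorder on the $\Pi$-set $S$. Then there exists a monoid partree $\mu$ for $(\Pi,S)$ such that $\leq$ is the preorder on $S$ determined by $\mu$.
   Context: $\Pi$-sets and preorders. A $\Pi$-set is a set with an action of the monoid $\Pi$; it is finitely generated if $S=\Pi s_1\cup\cdots\cup\Pi s_k$ for some $s_i\in S$. A preorder on a set is a reflexive, transitive, total relation; a preorder on a $\Pi$-set $S$ must moreover satisfy $r\leq s\Rightarrow ur\leq us$ for all $r,s\in S$, $u\in\Pi$. Write $s\approx t$ if $s\leq t$ and $t\leq s$, and $s<t$ if $s\leq t$ and not $t\leq s$ (with the same subscripts as $\leq$). Partree. A partree on a set $S$ is a finite rooted tree in which each vertex $x$ is labelled by a subset $S_x\subseteq S$, a partial order $\preceq_x$ on the children of $x$, and a preorder $\leq_x$ on the set $S_x$, such that: (1) for the root $r$, $S_r=S$; (2) if $y_1,\ldots,y_k$ are the children of a non-leaf $x$, then $S_x$ is the disjoint union of $S_{y_1},\ldots,S_{y_k}$; (3) if $s,t\in S_x$ satisfy $s\approx_x t$, then either $x$ is a leaf, or any children $y,z$ of $x$ with $s\in S_y$ and $t\in S_z$ satisfy $y\preceq_x z$ or $z\preceq_x y$. The relation $\leq$ on $S$ determined by the partree is as follows: for $s,t\in S$ let $x_0=r,x_1,\ldots,x_k$ be the maximal path from the root with $s,t\in S_{x_k}$; then $s\leq t$ if and only if (i) either $s\approx_{x_i}t$ for all $i=0,\ldots,k$, and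 then either $x_k$ is a leaf or $s\in S_y$ and $t\in S_z$ for children $y,z$ of $x_k$ with $y\prec_{x_k}z$; (ii) or the minimal $i$ with $s\not\approx_{x_i}t$ satisfies $s<_{x_i}t$. (This relation is a preorder on the set $S$.) Groups from monoids. $\mathrm{Gr}(\Pi)$ is the group completion of the commutative monoid $\Pi$ (the abelian group generated by symbols $\underline{u}$, $u\in\Pi$, with relations $\underline{1}=1$, $\underline{u}\cdot\underline{v}=\underline{uv}$); $[\underline{u}]$ is the class of $\underline{u}$. For a $\Pi$-set $S$, $\mathrm{Gr}(S)$ is the quotient of $\mathrm{Gr}(\Pi)\times S$ by the relations $(a[\underline{u}],s)=(a,us)$ for $a\in\mathrm{Gr}(\Pi)$, $u\in\Pi$, $s\in S$; it is a $\mathrm{Gr}(\Pi)$-set via $b[a,s]=[ba,s]$, where $[a,s]$ is the class of $(a,s)$. There is a canonical map $S\to\mathrm{Gr}(S)$, $s\mapsto[1,s]$. The pull-back of a preorder along a map $\phi$ is given by $s\leq t:\Leftrightarrow\phi(s)\leq\phi(t)$. Monoid partree. An action of a commutative monoid $\Pi$ on a set $\mathcal{J}$ is good if whenever $u,v\in\Pi$, $x\in\mathcal{J}$ satisfy $uvx=x$, then also $ux=vx=x$. A monoid partree $\mu$ for $(\Pi,S)$ is a partree on $S$ such that each vertex $x$, in addition to $S_x,\preceq_x,\leq_x$, is equipped with a finitely generated submonoid $\Pi_x\subseteq\Pi$ with a good action $(u,y)\mapsto uy$ on the children of $x$, such that: (1) for the root $r$, $\Pi_r=\Pi$, and for any child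 $y$ of $x$, the stabiliser of $y$ in $\Pi_x$ is $\Pi_y$; (2) $S_x$ is a finitely generated $\Pi_x$-set, and if $y$ is a child of $x$, then $uS_y\subseteq S_{uy}$ for all $u\in\Pi_x$; (3) $\leq_x$ is the pull-back (along $S_x\to\mathrm{Gr}(S_x)$) of a preorder on the $\mathrm{Gr}(\Pi_x)$-set $\mathrm{Gr}(S_x)$; (4) for children $y,z$ of $x$ and $u\in\Pi_x$, $y\preceq_x z\Rightarrow uy\preceq_x uz$; (5) for any child $y$ of $x$ and $s,t\in S_y$, $s\leq_y t\Rightarrow s\leq_x t$. *)

theory Defs
  imports "HOL-Algebra.Free_Abelian_Groups" "HOL-Algebra.Group_Action" "HOL-Library.Disjoint_Sets"
begin

section \<open>Sets with an action of a commutative monoid\<close>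

definition fg_submonoid :: "'m set \<Rightarrow> ('m, 'b) monoid_scheme \<Rightarrow> bool" where
  "fg_submonoid H M \<longleftrightarrow> submonoid H M \<and>
     (\<exists>A. finite A \<and> A \<subseteq> carrier M \<and> H = \<Inter>{K. submonoid K M \<and> A \<subseteq> K})"

locale monoid_set = comm_monoid M for M (structure) +
  fixes act :: "'m \<Rightarrow> 's \<Rightarrow> 's" and S :: "'s set"
  assumes act_closed: "\<lbrakk>u \<in> carrier M; s \<in> S\<rbrakk> \<Longrightarrow> act u s \<in> S"
    and act_one: "s \<in> S \<Longrightarrow> act \<one> s = s"
    and act_mult: "\<lbrakk>u \<in> carrier M; v \<in> carrier M; s \<in> S\<rbrakk> \<Longrightarrow> act (u \<otimes> v) s = act u (act v s)"

locale fg_monoid_set = monoid_set +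
  assumes fin_gen: "\<exists>A. finite A \<and> A \<subseteq> S \<and> S = (\<Union>s\<in>A. orbit M act s)"

locale good_action = monoid_set +
  assumes good: "\<lbrakk>u \<in> carrier M; v \<in> carrier M; x \<in> S; act (u \<otimes> v) x = x\<rbrakk>
    \<Longrightarrow> act u x = x \<and> act v x = x"

text \<open>Preorders are total throughout. Relations are sets of pairs; \<open>(s, t) \<in> r\<close> means \<open>s \<le> t\<close>.\<close>

definition total_preorder_on :: "'s set \<Rightarrow> 's rel \<Rightarrow> bool" where
  "total_preorder_on S r \<longleftrightarrow> preorder_on S r \<and> total_on S r"

definition monoid_set_preorder ::
    "('m, 'b) monoid_scheme \<Rightarrow> ('m \<Rightarrow> 's \<Rightarrow> 's) \<Rightarrow> 's set \<Rightarrow> 's rel \<Rightarrow> bool" where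
  "monoid_set_preorder M act S r \<longleftrightarrow> total_preorder_on S r \<and>
     (\<forall>u\<in>carrier M. \<forall>s t. (s, t) \<in> r \<longrightarrow> (act u s, act u t) \<in> r)"

definition po_equiv :: "'s rel \<Rightarrow> 's \<Rightarrow> 's \<Rightarrow> bool" where
  "po_equiv r s t \<longleftrightarrow> (s, t) \<in> r \<and> (t, s) \<in> r"

definition po_less :: "'s rel \<Rightarrow> 's \<Rightarrow> 's \<Rightarrow> bool" where
  "po_less r s t \<longleftrightarrow> (s, t) \<in> r \<and> (t, s) \<notin> r"


section \<open>Group completion\<close>

text \<open>\<open>free_Abelian_group\<close> is written additively, so the first relator is the relation
  \<open>\<one> = 1\<close> and the others are the relations \<open>u \<cdot> v = u \<otimes> v\<close>.\<close>

definition gr_relators :: "('m, 'b) monoid_scheme \<Rightarrow> ('m \<Rightarrow>\<^sub>0 int) set" where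
  "gr_relators M = insert (frag_of \<one>\<^bsub>M\<^esub>)
     {frag_of u + frag_of v - frag_of (u \<otimes>\<^bsub>M\<^esub> v) |u v. u \<in> carrier M \<and> v \<in> carrier M}"

definition gr_kernel :: "('m, 'b) monoid_scheme \<Rightarrow> ('m \<Rightarrow>\<^sub>0 int) set" where
  "gr_kernel M = generate (free_Abelian_group (carrier M)) (gr_relators M)"

definition gr_monoid :: "('m, 'b) monoid_scheme \<Rightarrow> ('m \<Rightarrow>\<^sub>0 int) set monoid" where
  "gr_monoid M = free_Abelian_group (carrier M) Mod gr_kernel M"

definition gr_class :: "('m, 'b) monoid_scheme \<Rightarrow> 'm \<Rightarrow> ('m \<Rightarrow>\<^sub>0 int) set" where
  "gr_class M u = gr_kernel M #>\<^bsub>free_Abelian_group (carrier M)\<^esub> frag_of u"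

definition gr_set_rel :: "('m, 'b) monoid_scheme \<Rightarrow> ('m \<Rightarrow> 's \<Rightarrow> 's) \<Rightarrow> 's set
    \<Rightarrow> (('m \<Rightarrow>\<^sub>0 int) set \<times> 's) rel" where
  "gr_set_rel M act S =
     {((a \<otimes>\<^bsub>gr_monoid M\<^esub> gr_class M u, s), (a, act u s)) |a u s.
        a \<in> carrier (gr_monoid M) \<and> u \<in> carrier M \<and> s \<in> S}"

text \<open>The equivalence relation generated by \<open>gr_set_rel\<close>; outside \<open>Gr(M) \<times> S\<close> it is the identity.\<close>

definition gr_set_eq :: "('m, 'b) monoid_scheme \<Rightarrow> ('m \<Rightarrow> 's \<Rightarrow> 's) \<Rightarrow> 's set
    \<Rightarrow> (('m \<Rightarrow>\<^sub>0 int) set \<times> 's) rel" where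
  "gr_set_eq M act S = (gr_set_rel M act S \<union> (gr_set_rel M act S)\<inverse>)\<^sup>*"

definition gr_set :: "('m, 'b) monoid_scheme \<Rightarrow> ('m \<Rightarrow> 's \<Rightarrow> 's) \<Rightarrow> 's set
    \<Rightarrow> (('m \<Rightarrow>\<^sub>0 int) set \<times> 's) set set" where
  "gr_set M act S = (carrier (gr_monoid M) \<times> S) // gr_set_eq M act S"

text \<open>\<open>b[a, s] = [ba, s]\<close>; the union is over equal classes, one for each representative of \<open>X\<close>.\<close>

definition gr_act :: "('m, 'b) monoid_scheme \<Rightarrow> ('m \<Rightarrow> 's \<Rightarrow> 's) \<Rightarrow> 's set
    \<Rightarrow> ('m \<Rightarrow>\<^sub>0 int) set \<Rightarrow> (('m \<Rightarrow>\<^sub>0 int) set \<times> 's) set \<Rightarrow> (('m \<Rightarrow>\<^sub>0 int) set \<times> 's) set" where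
  "gr_act M act S b X = (\<Union>(a, s)\<in>X. gr_set_eq M act S `` {(b \<otimes>\<^bsub>gr_monoid M\<^esub> a, s)})"

definition gr_map :: "('m, 'b) monoid_scheme \<Rightarrow> ('m \<Rightarrow> 's \<Rightarrow> 's) \<Rightarrow> 's set
    \<Rightarrow> 's \<Rightarrow> (('m \<Rightarrow>\<^sub>0 int) set \<times> 's) set" where
  "gr_map M act S s = gr_set_eq M act S `` {(\<one>\<^bsub>gr_monoid M\<^esub>, s)}"

definition pullback_rel :: "'s set \<Rightarrow> ('s \<Rightarrow> 't) \<Rightarrow> 't rel \<Rightarrow> 's rel" where
  "pullback_rel S f q = {(s, t). s \<in> S \<and> t \<in> S \<and> (f s, f t) \<in> q}"


section \<open>Partrees\<close>

text \<open>An edge \<open>(x, y)\<close> says that \<open>y\<close> is a child of \<open>x\<close>.\<close>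

record ('v, 's) partree =
  verts :: "'v set"
  edges :: "'v rel"
  root :: 'v
  lab :: "'v \<Rightarrow> 's set"
  child_le :: "'v \<Rightarrow> 'v rel"
  le_at :: "'v \<Rightarrow> 's rel"

locale rooted_tree =
  fixes V :: "'v set" and E :: "'v rel" and r :: 'v
  assumes fin: "finite V"
    and edges_in: "E \<subseteq> V \<times> V"
    and root_in: "r \<in> V"
    and root_no_parent: "(x, r) \<notin> E"
    and unique_parent: "x \<in> V - {r} \<Longrightarrow> \<exists>!p. (p, x) \<in> E"
    and reachable: "x \<in> V \<Longrightarrow> (r, x) \<in> E\<^sup>*"

definition children :: "('v, 's, 'z) partree_scheme \<Rightarrow> 'v \<Rightarrow> 'v set" where
  "children T x = {y. (x, y) \<in> edges T}"

definition is_leaf :: "('v, 's, 'z) partree_scheme \<Rightarrow> 'v \<Rightarrow> bool" where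
  "is_leaf T x \<longleftrightarrow> children T x = {}"

locale partree_on =
  fixes S :: "'s set" and T :: "('v, 's, 'z) partree_scheme"
  assumes tree: "rooted_tree (verts T) (edges T) (root T)"
    and lab_subset: "x \<in> verts T \<Longrightarrow> lab T x \<subseteq> S"
    and child_order: "x \<in> verts T \<Longrightarrow> partial_order_on (children T x) (child_le T x)"
    and lab_preorder: "x \<in> verts T \<Longrightarrow> total_preorder_on (lab T x) (le_at T x)"
    and lab_root: "lab T (root T) = S"
    and lab_union: "\<lbrakk>x \<in> verts T; \<not> is_leaf T x\<rbrakk> \<Longrightarrow> lab T x = (\<Union>y\<in>children T x. lab T y)"
    and lab_disjoint: "x \<in> verts T \<Longrightarrow> disjoint_family_on (lab T) (children T x)"
    and equiv_comparable:
      "\<lbrakk>x \<in> verts T; s \<in> lab T x; t \<in> lab T x; po_equiv (le_at T x) s t;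
        y \<in> children T x; z \<in> children T x; s \<in> lab T y; t \<in> lab T z\<rbrakk>
       \<Longrightarrow> (y, z) \<in> child_le T x \<or> (z, y) \<in> child_le T x"

definition root_path :: "('v, 's, 'z) partree_scheme \<Rightarrow> 'v list \<Rightarrow> bool" where
  "root_path T xs \<longleftrightarrow> xs \<noteq> [] \<and> hd xs = root T \<and>
     (\<forall>i. Suc i < length xs \<longrightarrow> (xs ! i, xs ! Suc i) \<in> edges T)"

text \<open>In a partree labels of siblings are disjoint, so the path is unique for given \<open>s, t \<in> S\<close>.\<close>

definition max_path :: "('v, 's, 'z) partree_scheme \<Rightarrow> 's \<Rightarrow> 's \<Rightarrow> 'v list \<Rightarrow> bool" where
  "max_path T s t xs \<longleftrightarrow>
     root_path T xs \<and> s \<in> lab T (last xs) \<and> t \<in> lab T (last xs) \<and>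
     (\<forall>ys. root_path T (xs @ ys) \<and> s \<in> lab T (last (xs @ ys)) \<and> t \<in> lab T (last (xs @ ys))
        \<longrightarrow> ys = [])"

definition determined_rel :: "'s set \<Rightarrow> ('v, 's, 'z) partree_scheme \<Rightarrow> 's rel" where
  "determined_rel S T = {(s, t). s \<in> S \<and> t \<in> S \<and> (\<exists>xs. max_path T s t xs \<and>
     ((\<forall>i<length xs. po_equiv (le_at T (xs ! i)) s t) \<and>
        (is_leaf T (last xs) \<or>
         (\<exists>y\<in>children T (last xs). \<exists>z\<in>children T (last xs).
            s \<in> lab T y \<and> t \<in> lab T z \<and> (y, z) \<in> child_le T (last xs) \<and> y \<noteq> z))
      \<or> (\<exists>i<length xs. (\<forall>j<i. po_equiv (le_at T (xs ! j)) s t) \<and>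
           \<not> po_equiv (le_at T (xs ! i)) s t \<and> po_less (le_at T (xs ! i)) s t)))}"


section \<open>Monoid partrees\<close>

text \<open>\<open>child_act x\<close> is the action of \<open>mon x\<close> on the children of \<open>x\<close>.\<close>

record ('v, 's, 'm) monoid_partree = "('v, 's) partree" +
  mon :: "'v \<Rightarrow> 'm set"
  child_act :: "'v \<Rightarrow> 'm \<Rightarrow> 'v \<Rightarrow> 'v"

locale monoid_partree_on = partree_on S T
  for M :: "('m, 'b) monoid_scheme" and act :: "'m \<Rightarrow> 's \<Rightarrow> 's" and S :: "'s set"
    and T :: "('v, 's, 'm) monoid_partree" +
  assumes mon_fg: "x \<in> verts T \<Longrightarrow> fg_submonoid (mon T x) M"
    and child_action:
      "x \<in> verts T \<Longrightarrow> good_action (M\<lparr>carrier := mon T x\<rparr>) (child_act T x) (children T x)"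
    and mon_root: "mon T (root T) = carrier M"
    and mon_child:
      "\<lbrakk>x \<in> verts T; y \<in> children T x\<rbrakk>
       \<Longrightarrow> stabilizer (M\<lparr>carrier := mon T x\<rparr>) (child_act T x) y = mon T y"
    and lab_fg: "x \<in> verts T \<Longrightarrow> fg_monoid_set (M\<lparr>carrier := mon T x\<rparr>) act (lab T x)"
    and lab_act:
      "\<lbrakk>x \<in> verts T; y \<in> children T x; u \<in> mon T x\<rbrakk>
       \<Longrightarrow> act u ` lab T y \<subseteq> lab T (child_act T x u y)"
    and le_at_pullback:
      "x \<in> verts T \<Longrightarrow> \<exists>q.
         monoid_set_preorder (gr_monoid (M\<lparr>carrier := mon T x\<rparr>))
           (gr_act (M\<lparr>carrier := mon T x\<rparr>) act (lab T x))
           (gr_set (M\<lparr>carrier := mon T x\<rparr>) act (lab T x)) q \<and>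
         le_at T x = pullback_rel (lab T x) (gr_map (M\<lparr>carrier := mon T x\<rparr>) act (lab T x)) q"
    and child_le_act:
      "\<lbrakk>x \<in> verts T; (y, z) \<in> child_le T x; u \<in> mon T x\<rbrakk>
       \<Longrightarrow> (child_act T x u y, child_act T x u z) \<in> child_le T x"
    and le_at_child:
      "\<lbrakk>x \<in> verts T; y \<in> children T x; (s, t) \<in> le_at T y\<rbrakk> \<Longrightarrow> (s, t) \<in> le_at T x"

end

theory Submission
  imports Defs "HOL.Topological_Spaces" "HOL-Algebra.Divisibility" "HOL-Library.Nat_Bijection"
begin

text \<open>For a submonoid \<open>P\<close> let \<open>loc P\<close> be the preorder obtained from
  \<open>R\<close> by inverting \<open>P\<close>: s lies below t if us \<le> ut in \<open>R\<close>
  for some u in \<open>P\<close>. It is total, contains \<open>R\<close>, and elements of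
  \<open>P\<close> cancel in it, so it is a pull-back from a group completion
  (\<open>cancellative_preorder_pullback\<close>). Every vertex carries a finitely generated monoid
  \<open>P\<close>, a finitely generated \<open>P\<close>-set \<open>X\<close>, and
  \<open>loc P\<close> as its preorder. A strict comparison in \<open>loc P\<close> agrees with
  \<open>R\<close>, so only pairs equivalent under \<open>loc P\<close> must be separated further
  down. If these are already equivalent in \<open>R\<close>, the vertex is a leaf.

  Otherwise some face \<open>F\<close> of \<open>P\<close> (a submonoid containing the divisors of
  its elements) is bad: localising at \<open>F\<close> identifies fewer elements of \<open>X\<close>
  than localising at \<open>P\<close>. There are finitely many faces, so take \<open>F\<close>
  maximal among the bad ones. Then choose \<open>D\<close> in \<open>X\<close> maximal among the
  \<open>P\<close>-stable, \<open>F\<close>-saturated subsets on which the two equivalences agree;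
  it exists by Dickson's lemma. The key fact is \<open>power_into_D\<close>: for g in
  \<open>P\<close> outside \<open>F\<close> and any s in \<open>X\<close>, some g^k s lies in
  \<open>D\<close>. Indeed \<open>F\<close> and g generate a larger face, which is not bad, so
  \<open>P\<close>-equivalent elements become \<open>F\<close>-equivalent after multiplication by a
  power of g. The congruences on \<open>P\<close> that record \<open>F\<close>-equivalence along the
  orbits of g^k s increase with k, hence become constant by Redei's theorem. For such k the orbit of
  g^k s can be added to \<open>D\<close>, so by maximality it lies there.

  Consequently finitely many \<open>F\<close>-orbits cover \<open>X\<close> outside \<open>D\<close>
  (\<open>finite_representatives\<close>). Collapse \<open>D\<close> to one point, identify elements
  with their \<open>F\<close>-multiples, and compare \<open>P\<close>-equivalent elements by
  \<open>R\<close>: the classes of this relation \<open>child_leq\<close> are the children. The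
  class \<open>D\<close> has stabiliser \<open>P\<close>, all others have stabiliser
  \<open>F\<close>, and the action is good because \<open>F\<close> is a face. Between
  \<open>P\<close>-equivalent elements of different classes the order of the children is
  \<open>R\<close> itself (\<open>child_leq_iff_R\<close>). The child \<open>(P, D)\<close> has
  fewer bad faces, as \<open>F\<close> is cured there; a child with monoid \<open>F\<close> has
  fewer faces at all. So splitting terminates, and \<open>determined_rel_tree\<close> reads
  \<open>R\<close> off the resulting finite tree.\<close>

section \<open>Fractions in the group completion, and preorders pulled back from it\<close>

section \<open>Group completion\<close>

text \<open>Each relator has this shape; inversion swaps the two lists and addition concatenates
  them. This turns an equality in the group completion into an equation between products in the
  monoid.\<close>

lemma (in comm_monoid) gr_kernel_relation:
  assumes "x \<in> gr_kernel G"
  shows "\<exists>us vs. set us \<subseteq> carrier G \<and> set vs \<subseteq> carrier G \<and>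
    x = sum_list (map frag_of us) - sum_list (map frag_of vs) \<and> foldr (\<otimes>) us \<one> = foldr (\<otimes>) vs \<one>"
    (is "\<exists>us vs. ?P x us vs")
proof -
  let ?F = "free_Abelian_group (carrier G)"
  have rel: "\<exists>us vs. ?P x us vs" if "x \<in> gr_relators G" for x
  proof -
    consider "x = frag_of \<one>" | u v where "x = frag_of u + frag_of v - frag_of (u \<otimes> v)"
      "u \<in> carrier G" "v \<in> carrier G"
      using \<open>x \<in> gr_relators G\<close> unfolding gr_relators_def by blast
    then show ?thesis
    proof cases
      case 1
      then have "?P x [\<one>] []" by simp
      then show ?thesis by blast
    next
      case (2 u v)
      then have "?P x [u, v] [u \<otimes> v]" by simp
      then show ?thesis by blast
    qed
  qed
  show ?thesis
    using assms unfolding gr_kernel_def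
  proof (induction rule: generate.induct)
    case one
    have "?P (\<one>\<^bsub>?F\<^esub>) [] []" by simp
    then show ?case by blast
  next
    case (incl h)
    then show ?case by (rule rel)
  next
    case (inv h)
    then obtain us vs where *: "?P h us vs" using rel by blast
    have cl: "sum_list (map frag_of us) \<in> carrier ?F" if "set us \<subseteq> carrier G" for us
      using that by (induction us) (auto dest!: subsetD[OF keys_add])
    have "h \<in> carrier ?F"
      using * cl[of us] cl[of vs] by (simp add: keys_diff[THEN order_trans])
    then have "?P (inv\<^bsub>?F\<^esub> h) vs us" using * by simp
    then show ?case by blast
  next
    case (eng h1 h2)
    then obtain us vs us' vs' where *: "?P h1 us vs" and **: "?P h2 us' vs'" by blast
    have f: "foldr (\<otimes>) (as @ bs) \<one> = foldr (\<otimes>) as \<one> \<otimes> foldr (\<otimes>) bs \<one>"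
      if "set as \<subseteq> carrier G" "set bs \<subseteq> carrier G" for as bs
      using that by (induction as) (auto simp: m_assoc)
    have "?P (h1 \<otimes>\<^bsub>?F\<^esub> h2) (us @ us') (vs @ vs')" using * ** by (simp add: f del: foldr_append)
    then show ?case by blast
  qed
qed

lemma lookup_sum_list_frag_of:
  "poly_mapping.lookup (sum_list (map frag_of us)) x = int (count (mset us) x)"
  by (induction us) (auto simp: lookup_add)

context comm_monoid
begin

lemma gr_relators_in: "gr_relators G \<subseteq> carrier (free_Abelian_group (carrier G))"
proof -
  have "frag_of u + frag_of v - frag_of (u \<otimes> v) \<in> carrier (free_Abelian_group (carrier G))"
    if "u \<in> carrier G" "v \<in> carrier G" for u v
    using that by (auto dest!: subsetD[OF keys_add] subsetD[OF keys_diff])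
  then show ?thesis unfolding gr_relators_def by auto
qed

lemma gr_kernel_normal: "gr_kernel G \<lhd> free_Abelian_group (carrier G)"
proof -
  interpret F: comm_group "free_Abelian_group (carrier G)" by (rule abelian_free_Abelian_group)
  show ?thesis
    unfolding gr_kernel_def using F.generate_is_subgroup[OF gr_relators_in] F.normal_iff_subgroup
    by blast
qed

lemma gr_monoid_comm_group: "comm_group (gr_monoid G)"
proof -
  interpret F: comm_group "free_Abelian_group (carrier G)" by (rule abelian_free_Abelian_group)
  show ?thesis
    unfolding gr_monoid_def using F.abelian_FactGroup gr_kernel_normal normal_imp_subgroup by blast
qed

lemma gr_coset_mult:
  assumes "x \<in> carrier (free_Abelian_group (carrier G))" "y \<in> carrier (free_Abelian_group (carrier G))"
  shows "(gr_kernel G #>\<^bsub>free_Abelian_group (carrier G)\<^esub> x) \<otimes>\<^bsub>gr_monoid G\<^esub>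
      (gr_kernel G #>\<^bsub>free_Abelian_group (carrier G)\<^esub> y)
    = gr_kernel G #>\<^bsub>free_Abelian_group (carrier G)\<^esub> (x + y)"
  using normal.rcos_sum[OF gr_kernel_normal assms] by (simp add: gr_monoid_def FactGroup_def)

lemma gr_coset_eq:
  assumes "x \<in> carrier (free_Abelian_group (carrier G))" "y \<in> carrier (free_Abelian_group (carrier G))"
  shows "(gr_kernel G #>\<^bsub>free_Abelian_group (carrier G)\<^esub> x)
      = (gr_kernel G #>\<^bsub>free_Abelian_group (carrier G)\<^esub> y) \<longleftrightarrow> x - y \<in> gr_kernel G"
    (is "?l x = ?l y \<longleftrightarrow> _")
proof -
  let ?F = "free_Abelian_group (carrier G)"
  interpret F: comm_group ?F by (rule abelian_free_Abelian_group)
  interpret K: normal "gr_kernel G" ?F by (rule gr_kernel_normal)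
  have "?l x = ?l y \<longleftrightarrow> x \<in> ?l y"
    using F.repr_independence[of x "gr_kernel G" y] F.rcos_self[of x "gr_kernel G"]
      K.is_subgroup assms by metis
  also have "\<dots> \<longleftrightarrow> x - y \<in> gr_kernel G"
    unfolding r_coset_def by (auto intro: bexI[of _ "x - y"])
  finally show ?thesis .
qed

lemma gr_class_closed: "u \<in> carrier G \<Longrightarrow> gr_class G u \<in> carrier (gr_monoid G)"
  unfolding gr_class_def gr_monoid_def FactGroup_def RCOSETS_def by auto

lemma gr_class_mult:
  assumes "u \<in> carrier G" "v \<in> carrier G"
  shows "gr_class G (u \<otimes> v) = gr_class G u \<otimes>\<^bsub>gr_monoid G\<^esub> gr_class G v"
proof -
  have "frag_of u + frag_of v - frag_of (u \<otimes> v) \<in> gr_relators G"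
    using assms unfolding gr_relators_def by blast
  then have "frag_of u + frag_of v - frag_of (u \<otimes> v) \<in> gr_kernel G"
    unfolding gr_kernel_def by (rule generate.incl)
  moreover have "frag_of u + frag_of v \<in> carrier (free_Abelian_group (carrier G))"
    using assms by (auto dest!: subsetD[OF keys_add])
  ultimately have "gr_class G u \<otimes>\<^bsub>gr_monoid G\<^esub> gr_class G v = gr_class G (u \<otimes> v)"
    unfolding gr_class_def using assms by (simp add: gr_coset_mult gr_coset_eq)
  then show ?thesis by simp
qed

lemma gr_class_one: "gr_class G \<one> = \<one>\<^bsub>gr_monoid G\<^esub>"
proof -
  interpret Gr: comm_group "gr_monoid G" by (rule gr_monoid_comm_group)
  show ?thesis
    using gr_class_mult[of \<one> \<one>] gr_class_closed[of \<one>] by (simp add: Gr.l_cancel_one)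
qed

text \<open>Equality of the classes makes \<open>u\<close> with \<open>vs\<close> and
  \<open>v\<close> with \<open>us\<close> the same formal sum, hence the same multiset. Multiplying
  out, and using that \<open>us\<close> and \<open>vs\<close> have the same product, shows that this
  product is the required \<open>z\<close>.\<close>

lemma gr_class_eqD:
  assumes u: "u \<in> carrier G" "v \<in> carrier G" and eq: "gr_class G u = gr_class G v"
  obtains z where "z \<in> carrier G" "z \<otimes> u = z \<otimes> v"
proof -
  have "frag_of u - frag_of v \<in> gr_kernel G"
    using eq u unfolding gr_class_def by (simp add: gr_coset_eq)
  then obtain us vs where us: "set us \<subseteq> carrier G" "set vs \<subseteq> carrier G"
    and d: "frag_of u - frag_of v = sum_list (map frag_of us) - sum_list (map frag_of vs)"
    and p: "foldr (\<otimes>) us \<one> = foldr (\<otimes>) vs \<one>"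
    using gr_kernel_relation by blast
  have "sum_list (map frag_of (u # vs)) = sum_list (map frag_of (v # us))"
    using d by (simp add: algebra_simps)
  then have "int (count (mset (u # vs)) x) = int (count (mset (v # us)) x)" for x
    unfolding lookup_sum_list_frag_of[symmetric] by (simp only:)
  then have "mset (u # vs) = mset (v # us)"
    by (intro multiset_eqI) (simp only: of_nat_eq_iff)
  then have "foldr (\<otimes>) (u # vs) \<one> = foldr (\<otimes>) (v # us) \<one>"
    using us u by (intro multlist_perm_cong) auto
  then have "u \<otimes> foldr (\<otimes>) vs \<one> = v \<otimes> foldr (\<otimes>) vs \<one>" using p by simp
  then show thesis
    using us u that[of "foldr (\<otimes>) vs \<one>"] by (simp add: m_comm)
qed

text \<open>Every element of the group completion is a fraction u/w. Formal sums are built from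
  generators by subtraction, and fractions are closed under division.\<close>

lemma gr_fraction:
  assumes "a \<in> carrier (gr_monoid G)"
  obtains u w where "u \<in> carrier G" "w \<in> carrier G" "a \<otimes>\<^bsub>gr_monoid G\<^esub> gr_class G w = gr_class G u"
proof -
  interpret Gr: comm_group "gr_monoid G" by (rule gr_monoid_comm_group)
  let ?F = "free_Abelian_group (carrier G)"
  obtain x where x: "x \<in> carrier ?F" "a = gr_kernel G #>\<^bsub>?F\<^esub> x"
    using assms unfolding gr_monoid_def FactGroup_def RCOSETS_def by auto
  have "x \<in> carrier ?F \<and> (\<exists>u\<in>carrier G. \<exists>w\<in>carrier G.
      (gr_kernel G #>\<^bsub>?F\<^esub> x) \<otimes>\<^bsub>gr_monoid G\<^esub> gr_class G w = gr_class G u)" (is "?P x")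
  proof -
    have "Poly_Mapping.keys x \<subseteq> carrier G" using x by simp
    then show ?thesis
    proof (induction x rule: frag_induction)
      case zero
      interpret F: comm_group ?F by (rule abelian_free_Abelian_group)
      have "gr_kernel G \<subseteq> carrier ?F"
        using gr_kernel_normal normal_imp_subgroup subgroup.subset by blast
      then have "gr_kernel G #>\<^bsub>?F\<^esub> 0 = \<one>\<^bsub>gr_monoid G\<^esub>"
        using F.coset_mult_one[of "gr_kernel G"] by (simp add: gr_monoid_def FactGroup_def)
      then have "(gr_kernel G #>\<^bsub>?F\<^esub> 0) \<otimes>\<^bsub>gr_monoid G\<^esub> gr_class G \<one> = gr_class G \<one>"
        using gr_class_closed[of \<one>] by simp
      then show ?case by auto
    next
      case (one x)
      have "(gr_kernel G #>\<^bsub>?F\<^esub> frag_of x) \<otimes>\<^bsub>gr_monoid G\<^esub> gr_class G \<one> = gr_class G x"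
        using gr_class_closed[OF one] by (simp add: gr_class_one gr_class_def[symmetric])
      then show ?case using one by auto
    next
      case (diff x y)
      then obtain u w u' w' where c: "u \<in> carrier G" "w \<in> carrier G" "u' \<in> carrier G" "w' \<in> carrier G"
        and e: "(gr_kernel G #>\<^bsub>?F\<^esub> x) \<otimes>\<^bsub>gr_monoid G\<^esub> gr_class G w = gr_class G u"
          "(gr_kernel G #>\<^bsub>?F\<^esub> y) \<otimes>\<^bsub>gr_monoid G\<^esub> gr_class G w' = gr_class G u'" by blast
      have k: "Poly_Mapping.keys x \<subseteq> carrier G" "Poly_Mapping.keys y \<subseteq> carrier G"
        using diff by simp_all
      then have d: "Poly_Mapping.keys (x - y) \<subseteq> carrier G"
        using keys_diff[of x y] by blast
      define X Y D where "X = gr_kernel G #>\<^bsub>?F\<^esub> x" and "Y = gr_kernel G #>\<^bsub>?F\<^esub> y"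
        and "D = gr_kernel G #>\<^bsub>?F\<^esub> (x - y)"
      have cl: "X \<in> carrier (gr_monoid G)" "Y \<in> carrier (gr_monoid G)" "D \<in> carrier (gr_monoid G)"
        using k d unfolding X_def Y_def D_def gr_monoid_def FactGroup_def RCOSETS_def by auto
      have DY: "D \<otimes>\<^bsub>gr_monoid G\<^esub> Y = X"
        unfolding D_def Y_def X_def using gr_coset_mult[of "x - y" y] k d by simp
      note cc = gr_class_closed[OF c(1)] gr_class_closed[OF c(2)] gr_class_closed[OF c(3)]
        gr_class_closed[OF c(4)]
      \<comment> \<open>Dividing u/w by u'/w' gives uw' over wu'.\<close>
      have "D \<otimes>\<^bsub>gr_monoid G\<^esub> gr_class G (w \<otimes> u')
        = D \<otimes>\<^bsub>gr_monoid G\<^esub> (gr_class G w \<otimes>\<^bsub>gr_monoid G\<^esub> (Y \<otimes>\<^bsub>gr_monoid G\<^esub> gr_class G w'))"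
        using c e by (simp add: gr_class_mult Y_def)
      also have "\<dots> = (D \<otimes>\<^bsub>gr_monoid G\<^esub> Y) \<otimes>\<^bsub>gr_monoid G\<^esub> gr_class G w \<otimes>\<^bsub>gr_monoid G\<^esub> gr_class G w'"
        using cl cc by (simp add: Gr.m_ac)
      also have "\<dots> = gr_class G (u \<otimes> w')"
        using c e by (simp add: DY gr_class_mult X_def)
      finally show ?case using c d unfolding D_def carrier_free_Abelian_group_iff by blast
    qed
  qed
  then show thesis using x that by blast
qed

end

context monoid_set
begin

text \<open>Compare two classes by clearing denominators: (u/w, s) lies below (v/w, t) when us \<le>
  vt. Cancellation is exactly what makes this independent of the common denominator chosen.\<close>

lemma cancellative_preorder_pullback:
  assumes r: "monoid_set_preorder M act S r"
    and cancel: "\<And>u s t. \<lbrakk>u \<in> carrier M; s \<in> S; t \<in> S; (act u s, act u t) \<in> r\<rbrakk> \<Longrightarrow> (s, t) \<in> r"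
  shows "\<exists>q. monoid_set_preorder (gr_monoid M) (gr_act M act S) (gr_set M act S) q \<and>
    r = pullback_rel S (gr_map M act S) q"
proof -
  interpret Gr: comm_group "gr_monoid M" by (rule gr_monoid_comm_group)
  let ?C = "carrier M" and ?D = "carrier (gr_monoid M)" and ?c = "gr_class M"
  let ?eq = "gr_set_eq M act S"
  have r_sub: "r \<subseteq> S \<times> S" and r_trans: "trans r" and "refl_on S r" "total_on S r"
    and r_act: "\<And>u s t. \<lbrakk>u \<in> ?C; (s, t) \<in> r\<rbrakk> \<Longrightarrow> (act u s, act u t) \<in> r"
    using r unfolding monoid_set_preorder_def total_preorder_on_def preorder_on_def by simp_all
  from \<open>refl_on S r\<close> \<open>total_on S r\<close> have r_refl: "\<And>s. s \<in> S \<Longrightarrow> (s, s) \<in> r" and r_total: "\<And>s t. \<lbrakk>s \<in> S; t \<in> S\<rbrakk> \<Longrightarrow> (s, t) \<in> r \<or> (t, s) \<in> r"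
    unfolding refl_on_def total_on_def by metis+
  define le where "le p p' \<longleftrightarrow> (\<exists>u\<in>?C. \<exists>v\<in>?C. \<exists>w\<in>?C. fst p \<otimes>\<^bsub>gr_monoid M\<^esub> ?c w = ?c u \<and>
    fst p' \<otimes>\<^bsub>gr_monoid M\<^esub> ?c w = ?c v \<and> (act u (snd p), act v (snd p')) \<in> r)" for p p'
  \<comment> \<open>Independence of the common denominator: if one common denominator witnesses
    \<open>le\<close>, then every other one does.\<close>
  have le_iff: "le (a, s) (b, t) \<longleftrightarrow> (act u s, act v t) \<in> r"
    if C: "u \<in> ?C" "v \<in> ?C" "w \<in> ?C" and D: "a \<in> ?D" "b \<in> ?D" and S: "s \<in> S" "t \<in> S"
      and eq: "a \<otimes>\<^bsub>gr_monoid M\<^esub> ?c w = ?c u" "b \<otimes>\<^bsub>gr_monoid M\<^esub> ?c w = ?c v" for u v w a b s t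
  proof
    assume "le (a, s) (b, t)"
    then obtain u' v' w' where C': "u' \<in> ?C" "v' \<in> ?C" "w' \<in> ?C"
      and eq': "a \<otimes>\<^bsub>gr_monoid M\<^esub> ?c w' = ?c u'" "b \<otimes>\<^bsub>gr_monoid M\<^esub> ?c w' = ?c v'"
      and le: "(act u' s, act v' t) \<in> r" unfolding le_def by auto
    \<comment> \<open>Two fractions for the same element \<open>d\<close> agree after
      cross-multiplication, up to a factor \<open>z\<close> in the monoid.\<close>
    have *: "\<exists>z\<in>?C. z \<otimes> (w' \<otimes> x) = z \<otimes> (w \<otimes> x')"
      if "d \<in> ?D" "x \<in> ?C" "x' \<in> ?C" "d \<otimes>\<^bsub>gr_monoid M\<^esub> ?c w = ?c x" "d \<otimes>\<^bsub>gr_monoid M\<^esub> ?c w' = ?c x'" for d x x'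
    proof -
      have "?c (w' \<otimes> x) = ?c w' \<otimes>\<^bsub>gr_monoid M\<^esub> (d \<otimes>\<^bsub>gr_monoid M\<^esub> ?c w)" using that C' by (simp add: gr_class_mult)
      also have "\<dots> = ?c w \<otimes>\<^bsub>gr_monoid M\<^esub> (d \<otimes>\<^bsub>gr_monoid M\<^esub> ?c w')"
        using that(1) C C' by (simp add: Gr.m_ac gr_class_closed)
      also have "\<dots> = ?c (w \<otimes> x')" using that C by (simp add: gr_class_mult)
      finally show ?thesis using gr_class_eqD[of "w' \<otimes> x" "w \<otimes> x'"] that C C' by blast
    qed
    obtain z where z: "z \<in> ?C" "z \<otimes> (w' \<otimes> u) = z \<otimes> (w \<otimes> u')"
      using *[OF D(1) C(1) C'(1) eq(1) eq'(1)] by blast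
    obtain y where y: "y \<in> ?C" "y \<otimes> (w' \<otimes> v) = y \<otimes> (w \<otimes> v')"
      using *[OF D(2) C(2) C'(2) eq(2) eq'(2)] by blast
    \<comment> \<open>The factor y z serves both cross-multiplied equations at once; it turns u', v'
      with w into u, v with w', and then y z w' is cancelled.\<close>
    have "(act (y \<otimes> z \<otimes> w) (act u' s), act (y \<otimes> z \<otimes> w) (act v' t)) \<in> r"
      by (rule r_act[OF _ le]) (use z(1) y(1) C in simp)
    moreover have "act (y \<otimes> z \<otimes> w) (act u' s) = act (y \<otimes> z \<otimes> w') (act u s)"
    proof -
      have "y \<otimes> z \<otimes> w \<otimes> u' = y \<otimes> (z \<otimes> (w \<otimes> u'))" using y(1) z(1) C C' by (simp add: m_assoc)
      also have "\<dots> = y \<otimes> (z \<otimes> (w' \<otimes> u))" by (simp only: z(2))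
      also have "\<dots> = y \<otimes> z \<otimes> w' \<otimes> u" using y(1) z(1) C C' by (simp add: m_assoc)
      finally show ?thesis using y(1) z(1) C C' S by (simp add: act_mult[symmetric])
    qed
    moreover have "act (y \<otimes> z \<otimes> w) (act v' t) = act (y \<otimes> z \<otimes> w') (act v t)"
    proof -
      have "y \<otimes> z \<otimes> w \<otimes> v' = z \<otimes> (y \<otimes> (w \<otimes> v'))" using y(1) z(1) C C' by (simp add: m_ac)
      also have "\<dots> = z \<otimes> (y \<otimes> (w' \<otimes> v))" by (simp only: y(2))
      also have "\<dots> = y \<otimes> z \<otimes> w' \<otimes> v" using y(1) z(1) C C' by (simp add: m_ac)
      finally show ?thesis using y(1) z(1) C C' S by (simp add: act_mult[symmetric])
    qed
    ultimately have "(act (y \<otimes> z \<otimes> w') (act u s), act (y \<otimes> z \<otimes> w') (act v t)) \<in> r" by simp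
    then show "(act u s, act v t) \<in> r"
      by (rule cancel[rotated 3]) (use y(1) z(1) C C' S act_closed in auto)
  next
    assume "(act u s, act v t) \<in> r"
    then show "le (a, s) (b, t)" unfolding le_def using C eq by auto
  qed
  have common: "\<exists>u\<in>?C. \<exists>v\<in>?C. \<exists>w\<in>?C. a \<otimes>\<^bsub>gr_monoid M\<^esub> ?c w = ?c u \<and> b \<otimes>\<^bsub>gr_monoid M\<^esub> ?c w = ?c v"
    if D: "a \<in> ?D" "b \<in> ?D" for a b
  proof -
    obtain u w where 1: "u \<in> ?C" "w \<in> ?C" "a \<otimes>\<^bsub>gr_monoid M\<^esub> ?c w = ?c u" using gr_fraction[OF D(1)] .
    obtain v w' where 2: "v \<in> ?C" "w' \<in> ?C" "b \<otimes>\<^bsub>gr_monoid M\<^esub> ?c w' = ?c v" using gr_fraction[OF D(2)] .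
    have "a \<otimes>\<^bsub>gr_monoid M\<^esub> ?c (w \<otimes> w') = (a \<otimes>\<^bsub>gr_monoid M\<^esub> ?c w) \<otimes>\<^bsub>gr_monoid M\<^esub> ?c w'"
      using D 1(1,2) 2(1,2) by (simp add: gr_class_mult gr_class_closed Gr.m_assoc)
    then have a: "a \<otimes>\<^bsub>gr_monoid M\<^esub> ?c (w \<otimes> w') = ?c (u \<otimes> w')" using 1 2 by (simp add: gr_class_mult)
    have "b \<otimes>\<^bsub>gr_monoid M\<^esub> ?c (w \<otimes> w') = (b \<otimes>\<^bsub>gr_monoid M\<^esub> ?c w') \<otimes>\<^bsub>gr_monoid M\<^esub> ?c w"
      using D 1(1,2) 2(1,2) by (simp add: gr_class_mult gr_class_closed Gr.m_ac)
    then have "b \<otimes>\<^bsub>gr_monoid M\<^esub> ?c (w \<otimes> w') = ?c (v \<otimes> w)" using 1 2 by (simp add: gr_class_mult)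
    with a 1 2 show ?thesis by blast
  qed
  have le_trans: "le p p''" if "le p p'" "le p' p''"
    and P: "p \<in> ?D \<times> S" "p' \<in> ?D \<times> S" "p'' \<in> ?D \<times> S" for p p' p''
  proof -
    obtain a s b t c x where [simp]: "p = (a, s)" "p' = (b, t)" "p'' = (c, x)"
      by (metis surj_pair)
    have D: "a \<in> ?D" "b \<in> ?D" "c \<in> ?D" "s \<in> S" "t \<in> S" "x \<in> S" using P by auto
    obtain u v w where 1: "u \<in> ?C" "v \<in> ?C" "w \<in> ?C" "a \<otimes>\<^bsub>gr_monoid M\<^esub> ?c w = ?c u"
      "b \<otimes>\<^bsub>gr_monoid M\<^esub> ?c w = ?c v" using common[OF D(1,2)] by blast
    obtain y w' where 2: "y \<in> ?C" "w' \<in> ?C" "c \<otimes>\<^bsub>gr_monoid M\<^esub> ?c w' = ?c y"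
      using gr_fraction[OF D(3)] .
    have m: "d \<otimes>\<^bsub>gr_monoid M\<^esub> ?c (w \<otimes> w') = ?c (u \<otimes> w')"
      if "d \<in> ?D" "u \<in> ?C" "d \<otimes>\<^bsub>gr_monoid M\<^esub> ?c w = ?c u" for d u
    proof -
      have "d \<otimes>\<^bsub>gr_monoid M\<^esub> ?c (w \<otimes> w') = (d \<otimes>\<^bsub>gr_monoid M\<^esub> ?c w) \<otimes>\<^bsub>gr_monoid M\<^esub> ?c w'"
        using that(1,2) 1(1-3) 2(1,2) by (simp add: gr_class_mult gr_class_closed Gr.m_assoc)
      then show ?thesis using that 2 by (simp add: gr_class_mult)
    qed
    have "c \<otimes>\<^bsub>gr_monoid M\<^esub> ?c (w \<otimes> w') = (c \<otimes>\<^bsub>gr_monoid M\<^esub> ?c w') \<otimes>\<^bsub>gr_monoid M\<^esub> ?c w"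
      using D 1(1-3) 2(1,2) by (simp add: gr_class_mult gr_class_closed Gr.m_ac)
    then have mc: "c \<otimes>\<^bsub>gr_monoid M\<^esub> ?c (w \<otimes> w') = ?c (y \<otimes> w)" using 1 2 by (simp add: gr_class_mult)
    have cl: "u \<otimes> w' \<in> ?C" "v \<otimes> w' \<in> ?C" "y \<otimes> w \<in> ?C" "w \<otimes> w' \<in> ?C" using 1 2 by auto
    note ma = m[OF D(1) 1(1,4)] and mb = m[OF D(2) 1(2,5)]
    from that(1,2) have "(act (u \<otimes> w') s, act (v \<otimes> w') t) \<in> r" "(act (v \<otimes> w') t, act (y \<otimes> w) x) \<in> r"
      by (simp_all add: le_iff[OF cl(1,2,4) D(1,2,4,5) ma mb] le_iff[OF cl(2,3,4) D(2,3,5,6) mb mc])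
    then have "(act (u \<otimes> w') s, act (y \<otimes> w) x) \<in> r" by (rule transD[OF r_trans])
    then show ?thesis by (simp add: le_iff[OF cl(1,3,4) D(1,3,4,6) ma mc])
  qed
  have le_total: "le p p' \<or> le p' p" if P: "p \<in> ?D \<times> S" "p' \<in> ?D \<times> S" for p p'
  proof -
    obtain a s b t where [simp]: "p = (a, s)" "p' = (b, t)" by (metis surj_pair)
    have D: "a \<in> ?D" "b \<in> ?D" "s \<in> S" "t \<in> S" using P by auto
    obtain u v w where 1: "u \<in> ?C" "v \<in> ?C" "w \<in> ?C" "a \<otimes>\<^bsub>gr_monoid M\<^esub> ?c w = ?c u"
      "b \<otimes>\<^bsub>gr_monoid M\<^esub> ?c w = ?c v" using common[OF D(1,2)] by blast
    show ?thesis using r_total[of "act u s" "act v t"] 1 D act_closed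
      by (simp add: le_iff[OF 1(1,2,3) D 1(4,5)] le_iff[OF 1(2,1,3) D(2,1,4,3) 1(5,4)])
  qed
  \<comment> \<open>A generating pair consists of (a[u], s) and (a, us). If a has numerator x, then
    both sides contribute the same element xus, so \<open>le\<close> does not separate them.\<close>
  have rel_le: "le p p' \<and> le p' p" and rel_in: "p \<in> ?D \<times> S" "p' \<in> ?D \<times> S"
    if pp: "(p, p') \<in> gr_set_rel M act S" for p p'
  proof -
    obtain a u s where p: "p = (a \<otimes>\<^bsub>gr_monoid M\<^esub> ?c u, s)" "p' = (a, act u s)"
      "a \<in> ?D" "u \<in> ?C" "s \<in> S" using pp unfolding gr_set_rel_def by auto
    then show in1: "p \<in> ?D \<times> S" "p' \<in> ?D \<times> S" using gr_class_closed act_closed by auto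
    obtain x w where x: "x \<in> ?C" "w \<in> ?C" "a \<otimes>\<^bsub>gr_monoid M\<^esub> ?c w = ?c x" using gr_fraction[OF p(3)] .
    have "(a \<otimes>\<^bsub>gr_monoid M\<^esub> ?c u) \<otimes>\<^bsub>gr_monoid M\<^esub> ?c w = (a \<otimes>\<^bsub>gr_monoid M\<^esub> ?c w) \<otimes>\<^bsub>gr_monoid M\<^esub> ?c u"
      using p x(1,2) by (simp add: gr_class_closed Gr.m_ac)
    then have y: "(a \<otimes>\<^bsub>gr_monoid M\<^esub> ?c u) \<otimes>\<^bsub>gr_monoid M\<^esub> ?c w = ?c (x \<otimes> u)"
      using x p by (simp add: gr_class_mult)
    have "act (x \<otimes> u) s = act x (act u s)" using x p act_mult by simp
    moreover have "(act (x \<otimes> u) s, act (x \<otimes> u) s) \<in> r" using r_refl x p act_closed by simp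
    moreover have "x \<otimes> u \<in> ?C" using x p by simp
    ultimately show "le p p' \<and> le p' p"
      unfolding le_def using x y p by fastforce
  qed
  have eq_le: "p \<in> ?D \<times> S \<longrightarrow> p' \<in> ?D \<times> S \<and> le p p' \<and> le p' p" if "(p, p') \<in> ?eq" for p p'
    using that unfolding gr_set_eq_def
  proof (induction rule: rtrancl_induct)
    case base
    show ?case using le_total by blast
  next
    case (step y z)
    then show ?case using rel_le[of y z] rel_le[of z y] rel_in[of y z] rel_in[of z y] le_trans
      by (meson UnE converseD)
  qed
  have eq_refl: "(p, p) \<in> ?eq" for p unfolding gr_set_eq_def by simp
  have eq_sym: "(p', p) \<in> ?eq" if "(p, p') \<in> ?eq" for p p'
    using that sym_rtrancl[of "gr_set_rel M act S \<union> (gr_set_rel M act S)\<inverse>"]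
    unfolding gr_set_eq_def by (simp add: sym_Un_converse symD)
  have eq_trans: "(p, p'') \<in> ?eq" if "(p, p') \<in> ?eq" "(p', p'') \<in> ?eq" for p p' p''
    using that unfolding gr_set_eq_def by (rule rtrancl_trans)
  have cls_eq: "?eq `` {p} = ?eq `` {p'} \<longleftrightarrow> (p, p') \<in> ?eq" for p p'
    using eq_refl eq_sym eq_trans by blast
  \<comment> \<open>By \<open>eq_le\<close> the choice of representatives in the two classes does
    not matter.\<close>
  define q where "q = {(A, B). A \<in> gr_set M act S \<and> B \<in> gr_set M act S \<and> (\<exists>p\<in>A. \<exists>p'\<in>B. le p p')}"
  have q_iff: "(?eq `` {p}, ?eq `` {p'}) \<in> q \<longleftrightarrow> le p p'"
    if P: "p \<in> ?D \<times> S" "p' \<in> ?D \<times> S" for p p'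
  proof
    assume "(?eq `` {p}, ?eq `` {p'}) \<in> q"
    then obtain o1 o2 where o: "(p, o1) \<in> ?eq" "(p', o2) \<in> ?eq" "le o1 o2" unfolding q_def by blast
    then show "le p p'" using eq_le[OF o(1)] eq_le[OF o(2)] P le_trans by meson
  next
    assume "le p p'"
    then show "(?eq `` {p}, ?eq `` {p'}) \<in> q"
      unfolding q_def gr_set_def using P eq_refl by (auto intro: quotientI)
  qed
  have in_gr: "\<exists>p\<in>?D \<times> S. A = ?eq `` {p}" if "A \<in> gr_set M act S" for A
    using that unfolding gr_set_def by (rule quotientE) blast
  have cls_in: "?eq `` {p} \<in> gr_set M act S" if "p \<in> ?D \<times> S" for p
    using that unfolding gr_set_def by (rule quotientI)
  \<comment> \<open>Translation by \<open>b\<close> respects the equivalence, so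
    \<open>gr_act\<close> can be computed on any representative of a class.\<close>
  have shift: "((b \<otimes>\<^bsub>gr_monoid M\<^esub> fst p, snd p), (b \<otimes>\<^bsub>gr_monoid M\<^esub> fst p', snd p')) \<in> ?eq"
    if b: "b \<in> ?D" and "(p, p') \<in> ?eq" for b p p'
    using that(2) unfolding gr_set_eq_def
  proof (induction rule: rtrancl_induct)
    case base
    show ?case by simp
  next
    case (step y z)
    have *: "((b \<otimes>\<^bsub>gr_monoid M\<^esub> fst y, snd y), (b \<otimes>\<^bsub>gr_monoid M\<^esub> fst z, snd z)) \<in> gr_set_rel M act S"
      if yz: "(y, z) \<in> gr_set_rel M act S" for y z
    proof -
      obtain a u s where p: "y = (a \<otimes>\<^bsub>gr_monoid M\<^esub> ?c u, s)" "z = (a, act u s)"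
        "a \<in> ?D" "u \<in> ?C" "s \<in> S" using yz unfolding gr_set_rel_def by auto
      have "b \<otimes>\<^bsub>gr_monoid M\<^esub> fst y = (b \<otimes>\<^bsub>gr_monoid M\<^esub> a) \<otimes>\<^bsub>gr_monoid M\<^esub> ?c u"
        using p b gr_class_closed by (simp add: Gr.m_assoc)
      then show ?thesis unfolding gr_set_rel_def using p b Gr.m_closed[of b a] by auto
    qed
    have "((b \<otimes>\<^bsub>gr_monoid M\<^esub> fst y, snd y), (b \<otimes>\<^bsub>gr_monoid M\<^esub> fst z, snd z))
      \<in> gr_set_rel M act S \<union> (gr_set_rel M act S)\<inverse>" using step(2) * by blast
    with step(3) show ?case by (rule rtrancl_into_rtrancl)
  qed
  have act_cls: "gr_act M act S b (?eq `` {(a, s)}) = ?eq `` {(b \<otimes>\<^bsub>gr_monoid M\<^esub> a, s)}"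
    if "b \<in> ?D" for a b s
  proof -
    have "?eq `` {(b \<otimes>\<^bsub>gr_monoid M\<^esub> fst p, snd p)} = ?eq `` {(b \<otimes>\<^bsub>gr_monoid M\<^esub> a, s)}"
      if "p \<in> ?eq `` {(a, s)}" for p
      unfolding cls_eq using shift[OF \<open>b \<in> ?D\<close>, of "(a, s)" p] that by (simp add: eq_sym)
    moreover have "(a, s) \<in> ?eq `` {(a, s)}" using eq_refl by simp
    ultimately show ?thesis unfolding gr_act_def case_prod_beta by (intro SUP_eq_const) auto
  qed
  have le_shift: "le (b \<otimes>\<^bsub>gr_monoid M\<^esub> a, s) (b \<otimes>\<^bsub>gr_monoid M\<^esub> a', s')"
    if b: "b \<in> ?D" and D: "a \<in> ?D" "a' \<in> ?D" "s \<in> S" "s' \<in> S" and le: "le (a, s) (a', s')" for a b s a' s'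
  proof -
    obtain u v w where 1: "u \<in> ?C" "v \<in> ?C" "w \<in> ?C" "a \<otimes>\<^bsub>gr_monoid M\<^esub> ?c w = ?c u"
      "a' \<otimes>\<^bsub>gr_monoid M\<^esub> ?c w = ?c v" and r1: "(act u s, act v s') \<in> r" using le unfolding le_def by auto
    obtain x y where x: "x \<in> ?C" "y \<in> ?C" "b \<otimes>\<^bsub>gr_monoid M\<^esub> ?c y = ?c x" using gr_fraction[OF b] .
    have m: "(b \<otimes>\<^bsub>gr_monoid M\<^esub> d) \<otimes>\<^bsub>gr_monoid M\<^esub> ?c (y \<otimes> w) = ?c (x \<otimes> u)"
      if "d \<in> ?D" "u \<in> ?C" "d \<otimes>\<^bsub>gr_monoid M\<^esub> ?c w = ?c u" for d u
    proof -
      have "(b \<otimes>\<^bsub>gr_monoid M\<^esub> d) \<otimes>\<^bsub>gr_monoid M\<^esub> ?c (y \<otimes> w)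
        = (b \<otimes>\<^bsub>gr_monoid M\<^esub> ?c y) \<otimes>\<^bsub>gr_monoid M\<^esub> (d \<otimes>\<^bsub>gr_monoid M\<^esub> ?c w)"
        using that(1,2) b 1(1-3) x(1,2) by (simp add: gr_class_mult gr_class_closed Gr.m_ac)
      then show ?thesis using that x by (simp add: gr_class_mult)
    qed
    have "(act (x \<otimes> u) s, act (x \<otimes> v) s') \<in> r"
      using r_act[OF x(1) r1] x 1 D by (simp add: act_mult)
    then show ?thesis
      unfolding le_def using m[OF D(1) 1(1,4)] m[OF D(2) 1(2,5)] x 1
      by (intro bexI[of _ "x \<otimes> u"] bexI[of _ "x \<otimes> v"] bexI[of _ "y \<otimes> w"]) auto
  qed
  have "monoid_set_preorder (gr_monoid M) (gr_act M act S) (gr_set M act S) q"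
    unfolding monoid_set_preorder_def total_preorder_on_def preorder_on_def
  proof (intro conjI ballI allI impI)
    show "q \<subseteq> gr_set M act S \<times> gr_set M act S" unfolding q_def by auto
    show "refl_on (gr_set M act S) q"
      by (rule refl_onI) (metis in_gr q_iff le_total)
    show "trans q"
    proof (rule transI)
      fix A B C assume *: "(A, B) \<in> q" "(B, C) \<in> q"
      then have "A \<in> gr_set M act S" "B \<in> gr_set M act S" "C \<in> gr_set M act S"
        unfolding q_def by auto
      then obtain p1 p2 p3 where "p1 \<in> ?D \<times> S" "p2 \<in> ?D \<times> S" "p3 \<in> ?D \<times> S"
        "A = ?eq `` {p1}" "B = ?eq `` {p2}" "C = ?eq `` {p3}" using in_gr by meson
      with * show "(A, C) \<in> q" using q_iff le_trans by metis
    qed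
    show "total_on (gr_set M act S) q"
      by (rule total_onI) (metis in_gr q_iff le_total)
    fix b A B assume b: "b \<in> ?D" and *: "(A, B) \<in> q"
    then have "A \<in> gr_set M act S" "B \<in> gr_set M act S" unfolding q_def by auto
    then obtain p p' where pp: "p \<in> ?D \<times> S" "p' \<in> ?D \<times> S" and AB': "A = ?eq `` {p}" "B = ?eq `` {p'}"
      using in_gr by meson
    obtain a s a' s' where "p = (a, s)" "p' = (a', s')" by (metis surj_pair)
    with pp AB' have D: "a \<in> ?D" "s \<in> S" "a' \<in> ?D" "s' \<in> S" and
      AB: "A = ?eq `` {(a, s)}" "B = ?eq `` {(a', s')}" by simp_all
    have "le (a, s) (a', s')" using * q_iff[of "(a, s)" "(a', s')"] D AB by auto
    then have "le (b \<otimes>\<^bsub>gr_monoid M\<^esub> a, s) (b \<otimes>\<^bsub>gr_monoid M\<^esub> a', s')"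
      using le_shift b D by blast
    then show "(gr_act M act S b A, gr_act M act S b B) \<in> q"
      unfolding AB act_cls[OF b] using q_iff b D by simp
  qed
  moreover have "r = pullback_rel S (gr_map M act S) q"
  proof -
    have "(s, t) \<in> r \<longleftrightarrow> (gr_map M act S s, gr_map M act S t) \<in> q" if st: "s \<in> S" "t \<in> S" for s t
    proof -
      have 1: "\<one>\<^bsub>gr_monoid M\<^esub> \<otimes>\<^bsub>gr_monoid M\<^esub> ?c \<one> = ?c \<one>" by (simp add: gr_class_one)
      show ?thesis
        unfolding gr_map_def using st
        by (simp add: q_iff le_iff[OF one_closed one_closed one_closed _ _ st 1 1] act_one)
    qed
    then show ?thesis unfolding pullback_rel_def using r_sub by auto
  qed
  ultimately show ?thesis by blast
qed

end

section \<open>Well-quasi-orders and Dickson's lemma\<close>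

section \<open>Chain conditions\<close>

definition wqo_on :: "('a \<Rightarrow> 'a \<Rightarrow> bool) \<Rightarrow> 'a set \<Rightarrow> bool" where
  "wqo_on leq A \<longleftrightarrow> (\<forall>f :: nat \<Rightarrow> 'a. range f \<subseteq> A \<longrightarrow> (\<exists>i j. i < j \<and> leq (f i) (f j)))"

text \<open>If an increasing chain of upward closed sets kept growing, each stage would be missed by
  an element that enters later. A pair s, t among such elements, with s below t and s already
  present at the stage that t misses, contradicts upward closure.\<close>

lemma wqo_on_chain_stabilises:
  fixes D :: "nat \<Rightarrow> 'a set"
  assumes wqo: "wqo_on leq A" and sub: "\<And>k. D k \<subseteq> A" and mono: "\<And>j k. j \<le> k \<Longrightarrow> D j \<subseteq> D k"
    and up: "\<And>k s t. \<lbrakk>s \<in> D k; t \<in> A; leq s t\<rbrakk> \<Longrightarrow> t \<in> D k"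
  shows "\<exists>k. \<forall>j\<ge>k. D j = D k"
proof (rule ccontr)
  assume "\<nexists>k. \<forall>j\<ge>k. D j = D k"
  then have "\<forall>k. \<exists>j s. s \<in> D j \<and> s \<notin> D k" using mono by blast
  then obtain n s where ns: "\<And>k. s k \<in> D (n k)" "\<And>k. s k \<notin> D k" by metis
  \<comment> \<open>The stages leap so far that \<open>s (K i)\<close> has entered by stage
    \<open>K (Suc i)\<close>, while \<open>s (K j)\<close> is still missing at stage
    \<open>K j\<close>.\<close>
  define K where "K i = (n ^^ i) 0" for i
  have K_less: "K i < n (K i)" for i
    using ns[of "K i"] mono[of "n (K i)" "K i"] by (meson linorder_not_less subsetD)
  then have "strict_mono K" by (simp add: strict_mono_Suc_iff K_def)
  have "range (\<lambda>i. s (K i)) \<subseteq> A" using ns(1) sub by blast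
  then obtain i j where ij: "i < j" "leq (s (K i)) (s (K j))"
    using wqo unfolding wqo_on_def by blast
  then have "n (K i) \<le> K j"
    using \<open>strict_mono K\<close> strict_mono_less_eq[of K "Suc i" j] by (simp add: K_def Suc_leI)
  then have "s (K i) \<in> D (K j)" using ns(1) mono by blast
  moreover have "s (K j) \<in> A" using ns(1) sub by blast
  ultimately have "s (K j) \<in> D (K j)" using up ij(2) by blast
  then show False using ns(2) by blast
qed

text \<open>Without a maximal member, repeatedly choosing a larger one gives a strictly increasing
  chain of upward closed sets.\<close>

lemma wqo_on_maximal:
  assumes wqo: "wqo_on leq A" and ne: "F \<noteq> {}" and sub: "\<And>D. D \<in> F \<Longrightarrow> D \<subseteq> A"
    and up: "\<And>D s t. \<lbrakk>D \<in> F; s \<in> D; t \<in> A; leq s t\<rbrakk> \<Longrightarrow> t \<in> D"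
  shows "\<exists>D\<in>F. \<forall>E\<in>F. D \<subseteq> E \<longrightarrow> E = D"
proof (rule ccontr)
  assume "\<not> ?thesis"
  then have *: "\<forall>D. \<exists>E. D \<in> F \<longrightarrow> E \<in> F \<and> D \<subset> E" by blast
  then obtain e where e: "\<And>D. D \<in> F \<Longrightarrow> e D \<in> F \<and> D \<subset> e D" by metis
  obtain D0 where D0: "D0 \<in> F" using ne by blast
  define D where "D k = (e ^^ k) D0" for k :: nat
  have DF: "D k \<in> F" for k by (induction k) (auto simp: D_def D0 e)
  have str: "D k \<subset> D (Suc k)" for k using e[OF DF[of k]] by (simp add: D_def)
  then have m: "D j \<subseteq> D k" if "j \<le> k" for j k
    using str by (intro lift_Suc_mono_le[OF _ that, of D] psubset_imp_subset)
  have "\<exists>k. \<forall>j\<ge>k. D j = D k"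
  proof (rule wqo_on_chain_stabilises[OF wqo, of D])
    show "D k \<subseteq> A" for k using sub DF by blast
    show "D j \<subseteq> D k" if "j \<le> k" for j k using m that .
    show "t \<in> D k" if "s \<in> D k" "t \<in> A" "leq s t" for k s t using up[OF DF that] .
  qed
  then obtain k where "\<forall>j\<ge>k. D j = D k" ..
  then have "D (Suc k) = D k" by (meson le_SucI order_refl)
  then show False using str[of k] by simp
qed

lemma nat_mono_subseq:
  fixes f :: "nat \<Rightarrow> nat"
  obtains r :: "nat \<Rightarrow> nat" where "strict_mono r" "\<And>i j. i \<le> j \<Longrightarrow> f (r i) \<le> f (r j)"
proof -
  obtain g :: "nat \<Rightarrow> nat" where g: "strict_mono g" "monoseq (\<lambda>n. f (g n))"
    using seq_monosub by blast
  then consider "\<And>i j. i \<le> j \<Longrightarrow> f (g i) \<le> f (g j)" | "\<And>i j. i \<le> j \<Longrightarrow> f (g j) \<le> f (g i)"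
    unfolding monoseq_def by blast
  then show thesis
  proof cases
    case 1
    then show thesis using that g by blast
  next
    case 2
    \<comment> \<open>A weakly decreasing sequence of naturals is constant from the place where it
      reaches its minimum.\<close>
    define m where "m = (LEAST x. x \<in> range (\<lambda>n. f (g n)))"
    have "m \<in> range (\<lambda>n. f (g n))" unfolding m_def by (rule LeastI_ex) blast
    then obtain N where N: "f (g N) = m" by auto
    have leq: "m \<le> f (g n)" for n unfolding m_def by (rule Least_le) blast
    have "f (g (N + n)) = m" for n using 2[of N "N + n"] N leq[of "N + n"] by simp
    moreover have "strict_mono (\<lambda>n. g (N + n))" using g(1) by (simp add: strict_mono_def)
    ultimately show thesis using that[of "\<lambda>n. g (N + n)"] by simp
  qed
qed

text \<open>Dickson's lemma in subsequence form: make the heads monotone on a subsequence, then the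
  tails on a subsequence of that.\<close>

lemma dickson_subseq:
  fixes f :: "nat \<Rightarrow> nat list"
  assumes "\<And>i. length (f i) = n"
  shows "\<exists>r :: nat \<Rightarrow> nat. strict_mono r \<and> (\<forall>i j. i \<le> j \<longrightarrow> list_all2 (\<le>) (f (r i)) (f (r j)))"
  using assms
proof (induction n arbitrary: f)
  case 0
  then show ?case by (intro exI[of _ id]) (simp add: strict_mono_def)
next
  case (Suc n)
  obtain r :: "nat \<Rightarrow> nat" where r: "strict_mono r" "\<And>i j. i \<le> j \<Longrightarrow> hd (f (r i)) \<le> hd (f (r j))"
    using nat_mono_subseq[of "\<lambda>i. hd (f i)"] by blast
  obtain q :: "nat \<Rightarrow> nat" where q: "strict_mono q"
    "\<And>i j. i \<le> j \<Longrightarrow> list_all2 (\<le>) (tl (f (r (q i)))) (tl (f (r (q j))))"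
    using Suc.IH[of "\<lambda>i. tl (f (r i))"] Suc.prems by fastforce
  have cons: "f i = hd (f i) # tl (f i)" for i
    using Suc.prems[of i] by (cases "f i") auto
  have "list_all2 (\<le>) (f (r (q i))) (f (r (q j)))" if "i \<le> j" for i j
    using r(2)[of "q i" "q j"] q(2)[OF that] that q(1)
    by (subst (1 2) cons) (simp add: strict_mono_less_eq)
  moreover have "strict_mono (\<lambda>i. r (q i))" using r(1) q(1) by (simp add: strict_mono_def)
  ultimately show ?case by blast
qed

lemma wqo_on_exponents: "wqo_on (list_all2 (\<le>)) {es :: nat list. length es = n}"
  unfolding wqo_on_def
proof (intro allI impI)
  fix f :: "nat \<Rightarrow> nat list" assume "range f \<subseteq> {es. length es = n}"
  then obtain r :: "nat \<Rightarrow> nat" where r: "strict_mono r"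
    "\<And>i j. i \<le> j \<Longrightarrow> list_all2 (\<le>) (f (r i)) (f (r j))" using dickson_subseq[of f n] by blast
  then have "r 0 < r 1" "list_all2 (\<le>) (f (r 0)) (f (r 1))" by (auto simp: strict_mono_less)
  then show "\<exists>i j. i < j \<and> list_all2 (\<le>) (f i) (f j)" by blast
qed

lemma list_all2_le_diff:
  fixes es fs :: "nat list"
  assumes "list_all2 (\<le>) es fs"
  obtains ds where "length ds = length es" "fs = map2 (+) es ds"
proof -
  have "length (map2 (-) fs es) = length es" "fs = map2 (+) es (map2 (-) fs es)"
    using assms by (induction rule: list_all2_induct) auto
  then show thesis using that by blast
qed

section \<open>Exponent vectors and faces of a finitely generated monoid\<close>

section \<open>Monomials in finitely generated commutative monoids\<close>

context comm_monoid
begin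

text \<open>Exponents are read by \<open>hd\<close> and \<open>tl\<close>, so the recursion follows
  the generators alone and puts no length condition on \<open>es\<close>.\<close>

primrec monomial :: "'a list \<Rightarrow> nat list \<Rightarrow> 'a" where
  "monomial [] es = \<one>"
| "monomial (g # gs) es = g [^] hd es \<otimes> monomial gs (tl es)"

lemma submonoid_pow_closed: "submonoid H G \<Longrightarrow> g \<in> H \<Longrightarrow> g [^] (n :: nat) \<in> H"
  by (induction n) (auto intro: submonoid.m_closed submonoid.one_closed)

lemma monomial_in: "submonoid H G \<Longrightarrow> set gs \<subseteq> H \<Longrightarrow> monomial gs es \<in> H"
  by (induction gs arbitrary: es)
    (auto intro: submonoid.m_closed submonoid.one_closed submonoid_pow_closed)

lemma monomial_closed [simp]: "set gs \<subseteq> carrier G \<Longrightarrow> monomial gs es \<in> carrier G"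
  by (induction gs arbitrary: es) auto

lemma monomial_add:
  assumes "length es = length gs" "length fs = length gs" "set gs \<subseteq> carrier G"
  shows "monomial gs (map2 (+) es fs) = monomial gs es \<otimes> monomial gs fs"
  using assms
proof (induction gs arbitrary: es fs)
  case (Cons g gs)
  then obtain e es' f fs' where [simp]: "es = e # es'" "fs = f # fs'"
    by (metis length_Suc_conv length_Cons)
  show ?case using Cons by (simp add: nat_pow_mult[symmetric] m_ac)
qed simp

lemma monomial_zero: "set gs \<subseteq> carrier G \<Longrightarrow> monomial gs (replicate (length gs) 0) = \<one>"
  by (induction gs) auto

lemma monomial_generator:
  assumes "set gs \<subseteq> carrier G" "g \<in> set gs"
  shows "\<exists>es. length es = length gs \<and> monomial gs es = g"
  using assms
proof (induction gs)
  case (Cons h gs)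
  show ?case
  proof (cases "g = h")
    case True
    then show ?thesis
      using Cons.prems by (intro exI[of _ "1 # replicate (length gs) 0"]) (simp add: monomial_zero)
  next
    case False
    then obtain es where "length es = length gs" "monomial gs es = g" using Cons by auto
    then show ?thesis using Cons.prems by (intro exI[of _ "0 # es"]) auto
  qed
qed simp

lemma hull_eq_monomials:
  assumes "set gs \<subseteq> carrier G"
  shows "\<Inter>{K. submonoid K G \<and> set gs \<subseteq> K} = monomial gs ` {es. length es = length gs}"
    (is "_ = ?P")
proof
  have "submonoid ?P G"
  proof
    show "?P \<subseteq> carrier G" using assms by auto
    show "\<one> \<in> ?P" using monomial_zero[OF assms] by (metis (mono_tags) imageI length_replicate mem_Collect_eq)
    fix x y assume "x \<in> ?P" "y \<in> ?P"
    then obtain es fs where "length es = length gs" "x = monomial gs es" "length fs = length gs"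
      "y = monomial gs fs" by blast
    then show "x \<otimes> y \<in> ?P" using monomial_add[of es gs fs] assms
      by (intro image_eqI[of _ _ "map2 (+) es fs"]) auto
  qed
  moreover have "set gs \<subseteq> ?P" using monomial_generator[OF assms] by blast
  ultimately show "\<Inter>{K. submonoid K G \<and> set gs \<subseteq> K} \<subseteq> ?P" by blast
  show "?P \<subseteq> \<Inter>{K. submonoid K G \<and> set gs \<subseteq> K}" using monomial_in by blast
qed

lemma fg_submonoidE:
  assumes "fg_submonoid P G"
  obtains gs where "submonoid P G" "set gs \<subseteq> P" "set gs \<subseteq> carrier G"
    "P = monomial gs ` {es. length es = length gs}"
proof -
  obtain A where A: "submonoid P G" "finite A" "A \<subseteq> carrier G" "P = \<Inter>{K. submonoid K G \<and> A \<subseteq> K}"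
    using assms unfolding fg_submonoid_def by blast
  moreover obtain gs where "set gs = A" using A(2) finite_list by blast
  ultimately show thesis using that[of gs] hull_eq_monomials[of gs] by blast
qed

text \<open>For a submonoid \<open>P\<close> these are the complements of its prime ideals. They
  enter because the stabilisers of a good action are faces.\<close>

definition face :: "'a set \<Rightarrow> 'a set \<Rightarrow> bool" where
  "face F P \<longleftrightarrow> submonoid F G \<and> F \<subseteq> P \<and> (\<forall>u\<in>P. \<forall>v\<in>P. u \<otimes> v \<in> F \<longrightarrow> u \<in> F \<and> v \<in> F)"

text \<open>A face contains the divisors of its elements, so a monomial in \<open>F\<close> involves
  with positive exponent only generators from \<open>F\<close>.\<close>

lemma monomial_in_face:
  assumes "submonoid P G" "face F P" "submonoid K G" "set gs \<inter> F \<subseteq> K" "set gs \<subseteq> P" "monomial gs es \<in> F"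
  shows "monomial gs es \<in> K"
  using assms(4-6)
proof (induction gs arbitrary: es)
  case Nil
  then show ?case using assms(3) by (simp add: submonoid.one_closed)
next
  case (Cons g gs)
  have cl: "P \<subseteq> carrier G" using assms(1) by (rule submonoid.subset)
  have "g [^] hd es \<in> P" "monomial gs (tl es) \<in> P"
    using Cons.prems assms(1) by (auto intro: submonoid_pow_closed monomial_in)
  then have *: "g [^] hd es \<in> F" "monomial gs (tl es) \<in> F"
    using Cons.prems assms(2) unfolding face_def by auto
  then have "monomial gs (tl es) \<in> K" using Cons by auto
  moreover have "g [^] hd es \<in> K"
  \<comment> \<open>Exponent 0 gives no information about \<open>g\<close>; a positive exponent
    forces \<open>g\<close> into the face.\<close>
  proof (cases "hd es")
    case 0
    then show ?thesis using assms(3) by (simp add: submonoid.one_closed)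
  next
    case (Suc n)
    then have "g [^] n \<otimes> g \<in> F" using *(1) by simp
    moreover have "g [^] n \<in> P" "g \<in> P"
      using Cons.prems assms(1) by (auto intro: submonoid_pow_closed)
    ultimately have "g \<in> F" using assms(2) unfolding face_def by blast
    then show ?thesis using Cons.prems assms(3) by (auto intro!: submonoid_pow_closed)
  qed
  ultimately show ?case using assms(3) by (simp add: submonoid.m_closed)
qed

lemma face_eq_hull:
  assumes P: "submonoid P G" "set gs \<subseteq> P" "P = monomial gs ` {es. length es = length gs}"
    and F: "face F P"
  shows "F = \<Inter>{K. submonoid K G \<and> set gs \<inter> F \<subseteq> K}"
proof
  show "F \<subseteq> \<Inter>{K. submonoid K G \<and> set gs \<inter> F \<subseteq> K}"
  proof (intro subsetI InterI, clarify)
    fix u K assume u: "u \<in> F" and K: "submonoid K G" "set gs \<inter> F \<subseteq> K"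
    then obtain es where "u = monomial gs es" using F P(3) unfolding face_def by blast
    then show "u \<in> K" using monomial_in_face[OF P(1) F K P(2)] u by blast
  qed
  show "\<Inter>{K. submonoid K G \<and> set gs \<inter> F \<subseteq> K} \<subseteq> F" using F unfolding face_def by blast
qed

lemma fg_submonoid_face:
  assumes "fg_submonoid P G" "face F P"
  shows "fg_submonoid F G"
proof -
  obtain gs where gs: "submonoid P G" "set gs \<subseteq> P" "set gs \<subseteq> carrier G"
    "P = monomial gs ` {es. length es = length gs}" using fg_submonoidE[OF assms(1)] .
  show ?thesis
    unfolding fg_submonoid_def using face_eq_hull[OF gs(1,2,4) assms(2)] assms(2) gs(3)
    by (auto simp: face_def intro!: exI[of _ "set gs \<inter> F"])
qed

text \<open>A face is generated by the generators of \<open>P\<close> that it contains, so it is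
  determined by a subset of a finite set.\<close>

lemma finite_faces:
  assumes "fg_submonoid P G"
  shows "finite {F. face F P}"
proof -
  obtain gs where gs: "submonoid P G" "set gs \<subseteq> P" "set gs \<subseteq> carrier G"
    "P = monomial gs ` {es. length es = length gs}" using fg_submonoidE[OF assms(1)] .
  have "inj_on (\<lambda>F. set gs \<inter> F) {F. face F P}"
    using face_eq_hull[OF gs(1,2,4)] by (intro inj_onI) (metis mem_Collect_eq)
  moreover have "(\<lambda>F. set gs \<inter> F) ` {F. face F P} \<subseteq> Pow (set gs)" by auto
  ultimately show ?thesis by (meson finite_Pow_iff finite_set inj_on_finite)
qed

lemma face_trans: "face F P \<Longrightarrow> face F' F \<Longrightarrow> face F' P"
  unfolding face_def by blast

lemma wqo_on_divides:
  assumes "fg_submonoid P G"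
  shows "wqo_on (\<lambda>u v. \<exists>w\<in>P. v = w \<otimes> u) P"
  unfolding wqo_on_def
proof (intro allI impI)
  fix f :: "nat \<Rightarrow> 'a" assume f: "range f \<subseteq> P"
  obtain gs where gs: "set gs \<subseteq> carrier G"
    "P = monomial gs ` {es. length es = length gs}" using fg_submonoidE[OF assms] .
  then have "\<forall>i. \<exists>es. length es = length gs \<and> f i = monomial gs es" using f by blast
  then obtain e where e: "\<And>i. length (e i) = length gs" "\<And>i. f i = monomial gs (e i)" by metis
  obtain i j where ij: "i < j" "list_all2 (\<le>) (e i) (e j)"
    using wqo_on_exponents[of "length gs"] e(1) unfolding wqo_on_def by blast
  obtain ds where "length ds = length (e i)" "e j = map2 (+) (e i) ds"
    using list_all2_le_diff[OF ij(2)] .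
  then have "f j = monomial gs ds \<otimes> f i" "monomial gs ds \<in> P"
    using e gs by (auto simp: monomial_add m_comm)
  then show "\<exists>i j. i < j \<and> (\<exists>w\<in>P. f j = w \<otimes> f i)" using ij(1) by blast
qed

end

section \<open>Ascending chains of congruences\<close>

text \<open>Translation invariance of the lexicographic order; it makes the exponents that are not
  minimal in their congruence class an upward closed set.\<close>

lemma lex_less_than_map2_add:
  assumes "(xs, ys) \<in> lex less_than" "length zs = length xs"
  shows "(map2 (+) xs zs, map2 (+) ys zs) \<in> lex less_than"
proof -
  have "length xs = length ys" "length ys = length zs" using assms by (simp_all add: lex_conv)
  then show ?thesis using assms(1)
    by (induction xs ys zs rule: list_induct3) auto
qed

text \<open>Redei's theorem. A congruence is determined by the set of exponents that are not minimal in
  their class for the lexicographic order, and this set is closed upwards.\<close>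

lemma (in comm_monoid) congruence_chain_stabilises:
  fixes C :: "nat \<Rightarrow> 'a rel"
  assumes fg: "fg_submonoid P G" and equiv: "\<And>k. equiv P (C k)"
    and cong: "\<And>k u v w. \<lbrakk>(u, v) \<in> C k; w \<in> P\<rbrakk> \<Longrightarrow> (u \<otimes> w, v \<otimes> w) \<in> C k"
    and mono: "\<And>j k. j \<le> k \<Longrightarrow> C j \<subseteq> C k"
  shows "\<exists>k. \<forall>j\<ge>k. C j = C k"
proof -
  obtain gs where gs: "set gs \<subseteq> carrier G"
    "P = monomial gs ` {es. length es = length gs}" using fg_submonoidE[OF fg] .
  let ?E = "{es :: nat list. length es = length gs}"
  define L where "L k = {es \<in> ?E. \<exists>fs\<in>?E. (fs, es) \<in> lex less_than \<and> (monomial gs fs, monomial gs es) \<in> C k}" for k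
  have "\<exists>k. \<forall>j\<ge>k. L j = L k"
  proof (rule wqo_on_chain_stabilises[OF wqo_on_exponents[of "length gs"], of L])
    show "L k \<subseteq> ?E" for k unfolding L_def by blast
    show "L j \<subseteq> L k" if "j \<le> k" for j k using mono[OF that] unfolding L_def by blast
    fix k es es' assume es: "es \<in> L k" and es': "es' \<in> ?E" and leq: "list_all2 (\<le>) es es'"
    obtain fs where fs: "length es = length gs" "length fs = length gs" "(fs, es) \<in> lex less_than"
      "(monomial gs fs, monomial gs es) \<in> C k" using es unfolding L_def by blast
    obtain ds where ds: "length ds = length es" "es' = map2 (+) es ds" using list_all2_le_diff[OF leq] .
    have "monomial gs ds \<in> P" using gs(2) ds(1) fs(1) by simp
    then have "(monomial gs (map2 (+) fs ds), monomial gs es') \<in> C k"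
      using cong[OF fs(4)] fs gs(1) ds by (simp add: monomial_add)
    moreover have "(map2 (+) fs ds, es') \<in> lex less_than"
      using lex_less_than_map2_add[OF fs(3), of ds] fs ds by simp
    ultimately show "es' \<in> L k"
      unfolding L_def using es' fs ds by (intro CollectI conjI bexI[of _ "map2 (+) fs ds"]) auto
  qed
  then obtain k where k: "\<And>j. k \<le> j \<Longrightarrow> L j = L k" by blast
  \<comment> \<open>Normal forms: the lexicographic order is well founded, so descending within a
    class ends at a vector outside \<open>L k\<close>.\<close>
  have nf: "\<exists>fs\<in>?E - L k. (monomial gs es, monomial gs fs) \<in> C k" if "es \<in> ?E" for es
    using that
  proof (induction es rule: wf_induct_rule[OF wf_lex[OF wf_less_than]])
    case (1 es)
    show ?case
    proof (cases "es \<in> L k")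
      case True
      then obtain fs where fs: "fs \<in> ?E" "(fs, es) \<in> lex less_than" "(monomial gs fs, monomial gs es) \<in> C k"
        unfolding L_def by blast
      then obtain fs' where "fs' \<in> ?E - L k" "(monomial gs fs, monomial gs fs') \<in> C k" using 1 by blast
      with fs(3) show ?thesis using equiv[of k] unfolding equiv_def by (meson symD transD)
    next
      case False
      then show ?thesis using 1 gs(2) equiv[of k] unfolding equiv_def refl_on_def by blast
    qed
  qed
  have "C j \<subseteq> C k" if "k \<le> j" for j
  proof (rule subrelI)
    fix u v assume uv: "(u, v) \<in> C j"
    then have "u \<in> P" "v \<in> P" using equiv[of j] unfolding equiv_def by auto
    then obtain es fs where e: "es \<in> ?E" "fs \<in> ?E" "u = monomial gs es" "v = monomial gs fs" using gs(2) by blast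
    obtain es' where e1: "es' \<in> ?E" "es' \<notin> L k" "(u, monomial gs es') \<in> C k" using nf[OF e(1)] e by blast
    obtain fs' where e2: "fs' \<in> ?E" "fs' \<notin> L k" "(v, monomial gs fs') \<in> C k" using nf[OF e(2)] e by blast
    have sy: "sym (C i)" and tr: "trans (C i)" for i using equiv[of i] unfolding equiv_def by auto
    have "(u, monomial gs es') \<in> C j" "(v, monomial gs fs') \<in> C j" using e1 e2 mono[OF that] by auto
    then have j: "(monomial gs es', monomial gs fs') \<in> C j" "(monomial gs fs', monomial gs es') \<in> C j"
      using uv symD[OF sy] transD[OF tr] by meson+
    \<comment> \<open>Distinct normal forms congruent modulo \<open>C j\<close> would put the
      lexicographically larger one into \<open>L j\<close>, which equals \<open>L k\<close>.\<close>
    have "es' = fs'"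
    proof (rule ccontr)
      assume "es' \<noteq> fs'"
      \<comment> \<open>Totality comes from \<open>lenlex\<close>, which coincides with
        \<open>lex\<close> on lists of equal length.\<close>
      then have "(es', fs') \<in> lenlex less_than \<or> (fs', es') \<in> lenlex less_than"
        using total_lenlex[of less_than] by (meson UNIV_I total_on_def total_less_than)
      then have "(es', fs') \<in> lex less_than \<or> (fs', es') \<in> lex less_than"
        using e1 e2 by (auto simp: lenlex_conv)
      then have "es' \<in> L j \<or> fs' \<in> L j" unfolding L_def using j e1(1) e2(1) by blast
      then show False using k[OF that] e1 e2 by blast
    qed
    then show "(u, v) \<in> C k" using e1 e2 symD[OF sy] transD[OF tr] by meson
  qed
  then have "\<forall>j\<ge>k. C j = C k" using mono by blast
  then show ?thesis ..
qed

section \<open>The preorder after inverting a submonoid\<close>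

section \<open>Localised preorders\<close>

locale preordered_monoid_set = monoid_set M act S
  for M :: "('m, 'b) monoid_scheme" (structure) and act :: "'m \<Rightarrow> 's \<Rightarrow> 's" and S :: "'s set" +
  fixes R :: "'s rel"
  assumes preorder: "monoid_set_preorder M act S R"
begin

lemma R_sub: "(s, t) \<in> R \<Longrightarrow> s \<in> S \<and> t \<in> S"
  and R_refl: "s \<in> S \<Longrightarrow> (s, s) \<in> R"
  and R_trans: "(s, t) \<in> R \<Longrightarrow> (t, x) \<in> R \<Longrightarrow> (s, x) \<in> R"
  and R_total: "s \<in> S \<Longrightarrow> t \<in> S \<Longrightarrow> (s, t) \<in> R \<or> (t, s) \<in> R"
  and R_act: "(s, t) \<in> R \<Longrightarrow> u \<in> carrier M \<Longrightarrow> (act u s, act u t) \<in> R"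
proof -
  have *: "R \<subseteq> S \<times> S" "refl_on S R" "trans R" "total_on S R"
    "\<forall>u\<in>carrier M. \<forall>s t. (s, t) \<in> R \<longrightarrow> (act u s, act u t) \<in> R"
    using preorder unfolding monoid_set_preorder_def total_preorder_on_def preorder_on_def by auto
  show "(s, t) \<in> R \<Longrightarrow> s \<in> S \<and> t \<in> S" using *(1) by blast
  show refl: "s \<in> S \<Longrightarrow> (s, s) \<in> R" for s using *(2) by (simp add: refl_on_def)
  show "(s, t) \<in> R \<Longrightarrow> (t, x) \<in> R \<Longrightarrow> (s, x) \<in> R" using *(3) by (rule transD)
  show "s \<in> S \<Longrightarrow> t \<in> S \<Longrightarrow> (s, t) \<in> R \<or> (t, s) \<in> R"
    using *(4) refl unfolding total_on_def by metis
  show "(s, t) \<in> R \<Longrightarrow> u \<in> carrier M \<Longrightarrow> (act u s, act u t) \<in> R" using *(5) by simp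
qed

lemma act_comm:
  "u \<in> carrier M \<Longrightarrow> v \<in> carrier M \<Longrightarrow> s \<in> S \<Longrightarrow> act u (act v s) = act v (act u s)"
  using act_mult[of u v s] act_mult[of v u s] m_comm[of u v] by simp

text \<open>For a submonoid \<open>P\<close> this is the least relation on \<open>S\<close> that
  contains \<open>R\<close> and from which elements of \<open>P\<close> can be cancelled: the trace
  on \<open>S\<close> of \<open>R\<close> extended to the localisation at \<open>P\<close>.\<close>

definition loc :: "'m set \<Rightarrow> 's \<Rightarrow> 's \<Rightarrow> bool" where
  "loc P s t \<longleftrightarrow> (\<exists>u\<in>P. (act u s, act u t) \<in> R)"

definition eqv :: "'m set \<Rightarrow> 's \<Rightarrow> 's \<Rightarrow> bool" where
  "eqv P s t \<longleftrightarrow> loc P s t \<and> loc P t s"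

lemma loc_mono: "loc P s t \<Longrightarrow> P \<subseteq> Q \<Longrightarrow> loc Q s t"
  unfolding loc_def by blast

lemma eqv_mono: "eqv P s t \<Longrightarrow> P \<subseteq> Q \<Longrightarrow> eqv Q s t"
  unfolding eqv_def using loc_mono by blast

lemma eqv_sym: "eqv P s t \<Longrightarrow> eqv P t s"
  unfolding eqv_def by blast

context
  fixes P assumes P: "submonoid P M"
begin

lemma in_carrier: "u \<in> P \<Longrightarrow> u \<in> carrier M"
  using P submonoid.subset by blast

lemma R_loc: "(s, t) \<in> R \<Longrightarrow> loc P s t"
  unfolding loc_def using R_sub[of s t] submonoid.one_closed[OF P]
  by (intro bexI[of _ \<one>]) (auto simp: act_one)

lemma loc_refl: "s \<in> S \<Longrightarrow> loc P s s"
  using R_loc R_refl by blast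

lemma loc_total: "s \<in> S \<Longrightarrow> t \<in> S \<Longrightarrow> loc P s t \<or> loc P t s"
  using R_loc R_total by blast

lemma loc_trans:
  assumes "loc P s t" "loc P t x" "s \<in> S" "t \<in> S" "x \<in> S"
  shows "loc P s x"
proof -
  obtain u v where uv: "u \<in> P" "v \<in> P" "(act u s, act u t) \<in> R" "(act v t, act v x) \<in> R"
    using assms unfolding loc_def by blast
  note c = in_carrier[OF uv(1)] in_carrier[OF uv(2)]
  have "(act v (act u s), act v (act u t)) \<in> R" using R_act[OF uv(3) c(2)] .
  moreover have "(act v (act u t), act v (act u x)) \<in> R"
    using R_act[OF uv(4) c(1)] c assms by (simp add: act_comm[of v u])
  ultimately have "(act (v \<otimes> u) s, act (v \<otimes> u) x) \<in> R"
    using R_trans c assms by (simp add: act_mult)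
  then show ?thesis unfolding loc_def using submonoid.m_closed[OF P uv(2,1)] by blast
qed

lemma loc_act:
  assumes "loc P s t" "u \<in> carrier M" "s \<in> S" "t \<in> S"
  shows "loc P (act u s) (act u t)"
proof -
  obtain v where v: "v \<in> P" "(act v s, act v t) \<in> R" using assms unfolding loc_def by blast
  then have "(act v (act u s), act v (act u t)) \<in> R"
    using R_act[OF v(2) assms(2)] assms in_carrier[OF v(1)] by (simp add: act_comm[of v u])
  then show ?thesis unfolding loc_def using v(1) by blast
qed

lemma loc_cancel:
  assumes "loc P (act u s) (act u t)" "u \<in> P" "s \<in> S" "t \<in> S"
  shows "loc P s t"
proof -
  obtain v where v: "v \<in> P" "(act v (act u s), act v (act u t)) \<in> R"
    using assms unfolding loc_def by blast
  then have "(act (v \<otimes> u) s, act (v \<otimes> u) t) \<in> R" using assms in_carrier by (simp add: act_mult)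
  then show ?thesis unfolding loc_def using submonoid.m_closed[OF P v(1) assms(2)] by blast
qed

text \<open>The multipliers for the two inequalities can be replaced by their product, so one
  element of \<open>P\<close> serves both.\<close>

lemma eqv_iff:
  assumes "s \<in> S" "t \<in> S"
  shows "eqv P s t \<longleftrightarrow> (\<exists>u\<in>P. (act u s, act u t) \<in> R \<and> (act u t, act u s) \<in> R)"
proof
  assume "eqv P s t"
  then obtain u v where uv: "u \<in> P" "v \<in> P" "(act u s, act u t) \<in> R" "(act v t, act v s) \<in> R"
    unfolding eqv_def loc_def by blast
  note c = in_carrier[OF uv(1)] in_carrier[OF uv(2)]
  have "(act (u \<otimes> v) s, act (u \<otimes> v) t) \<in> R"
    using R_act[OF uv(3) c(2)] c assms by (simp add: act_mult act_comm[of v u])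
  moreover have "(act (u \<otimes> v) t, act (u \<otimes> v) s) \<in> R"
    using R_act[OF uv(4) c(1)] c assms by (simp add: act_mult)
  ultimately show "\<exists>u\<in>P. (act u s, act u t) \<in> R \<and> (act u t, act u s) \<in> R"
    using submonoid.m_closed[OF P uv(1,2)] by blast
qed (auto simp: eqv_def loc_def)

lemma eqv_refl: "s \<in> S \<Longrightarrow> eqv P s s"
  unfolding eqv_def using loc_refl by blast

lemma eqv_trans: "eqv P s t \<Longrightarrow> eqv P t x \<Longrightarrow> s \<in> S \<Longrightarrow> t \<in> S \<Longrightarrow> x \<in> S \<Longrightarrow> eqv P s x"
  unfolding eqv_def using loc_trans by blast

lemma eqv_act: "eqv P s t \<Longrightarrow> u \<in> carrier M \<Longrightarrow> s \<in> S \<Longrightarrow> t \<in> S \<Longrightarrow> eqv P (act u s) (act u t)"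
  unfolding eqv_def using loc_act by blast

lemma eqv_cancel: "eqv P (act u s) (act u t) \<Longrightarrow> u \<in> P \<Longrightarrow> s \<in> S \<Longrightarrow> t \<in> S \<Longrightarrow> eqv P s t"
  unfolding eqv_def using loc_cancel by blast

end

section \<open>Noetherian property of finitely generated sets with action\<close>

section \<open>Stable subsets\<close>

definition stable :: "'m set \<Rightarrow> 's set \<Rightarrow> bool" where
  "stable P D \<longleftrightarrow> (\<forall>u\<in>P. \<forall>s\<in>D. act u s \<in> D)"

definition fg_set :: "'m set \<Rightarrow> 's set \<Rightarrow> bool" where
  "fg_set P X \<longleftrightarrow> X \<subseteq> S \<and> (\<exists>A. finite A \<and> A \<subseteq> X \<and> X = (\<Union>a\<in>A. (\<lambda>u. act u a) ` P))"

lemma fg_setE: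
  assumes "fg_set P X"
  obtains A where "X \<subseteq> S" "finite A" "A \<subseteq> X" "X = (\<Union>a\<in>A. (\<lambda>u. act u a) ` P)"
  using assms unfolding fg_set_def by (elim conjE exE)

lemma stable_orbits:
  assumes "submonoid P M" "A \<subseteq> S"
  shows "stable P (\<Union>a\<in>A. (\<lambda>u. act u a) ` P)"
  unfolding stable_def
proof (clarify)
  fix u a v assume *: "u \<in> P" "a \<in> A" "v \<in> P"
  then have "act u (act v a) = act (u \<otimes> v) a" using assms in_carrier by (simp add: act_mult subsetD)
  then show "act u (act v a) \<in> (\<Union>a\<in>A. (\<lambda>u. act u a) ` P)"
    using * submonoid.m_closed[OF assms(1)] by blast
qed

lemma fg_set_stable: "submonoid P M \<Longrightarrow> fg_set P X \<Longrightarrow> stable P X"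
  unfolding fg_set_def using stable_orbits by (metis subset_trans)

lemma orbit_self: "submonoid P M \<Longrightarrow> a \<in> S \<Longrightarrow> a \<in> (\<lambda>u. act u a) ` P"
  using act_one submonoid.one_closed by (metis image_eqI)

text \<open>Write each element as a monomial applied to one of finitely many generators. Dickson's
  lemma makes the exponents increase along a subsequence, and the pigeonhole principle finds two
  terms on it with the same generator.\<close>

lemma wqo_on_orbits:
  assumes P: "fg_submonoid P M" and X: "fg_set P X"
  shows "wqo_on (\<lambda>s t. \<exists>u\<in>P. t = act u s) X"
  unfolding wqo_on_def
proof (intro allI impI)
  fix f :: "nat \<Rightarrow> 's" assume f: "range f \<subseteq> X"
  obtain gs where gs: "set gs \<subseteq> carrier M" "P = monomial gs ` {es. length es = length gs}"
    using fg_submonoidE[OF P] .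
  obtain A where "X \<subseteq> S" "finite A" "A \<subseteq> X" and XA: "X = (\<Union>a\<in>A. (\<lambda>u. act u a) ` P)"
    using fg_setE[OF X] .
  then have A: "finite A" "A \<subseteq> S" by simp_all
  have "\<exists>a es. a \<in> A \<and> length es = length gs \<and> f i = act (monomial gs es) a" for i
  proof -
    have "f i \<in> (\<Union>a\<in>A. (\<lambda>u. act u a) ` P)" using f XA by blast
    then show ?thesis unfolding gs(2) by blast
  qed
  then obtain a e where ae: "\<And>i. a i \<in> A" "\<And>i. length (e i) = length gs"
    "\<And>i. f i = act (monomial gs (e i)) (a i)" by metis
  obtain r :: "nat \<Rightarrow> nat" where r: "strict_mono r"
    "\<And>i j. i \<le> j \<Longrightarrow> list_all2 (\<le>) (e (r i)) (e (r j))"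
    using dickson_subseq[of e "length gs"] ae(2) by blast
  have "\<not> inj (\<lambda>i. a (r i))"
  proof
    assume "inj (\<lambda>i. a (r i))"
    moreover have "range (\<lambda>i. a (r i)) \<subseteq> A" using ae(1) by blast
    ultimately show False using A(1) by (metis finite_subset finite_imageD infinite_UNIV_nat)
  qed
  then obtain i j where ij: "i < j" "a (r i) = a (r j)"
    unfolding inj_def by (metis linorder_neqE_nat)
  obtain ds where ds: "length ds = length (e (r i))" "e (r j) = map2 (+) (e (r i)) ds"
    using list_all2_le_diff[OF r(2)] ij(1) less_imp_le by metis
  have "f (r j) = act (monomial gs ds \<otimes> monomial gs (e (r i))) (a (r i))"
    using ds ae gs(1) ij(2) by (simp add: monomial_add m_comm)
  also have "\<dots> = act (monomial gs ds) (f (r i))"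
    using ae gs(1) A(2) act_mult by (simp add: subsetD)
  finally have "\<exists>u\<in>P. f (r j) = act u (f (r i))" using ds(1) ae(2) gs(2) by auto
  moreover have "r i < r j" using r(1) ij(1) by (simp add: strict_mono_less)
  ultimately show "\<exists>i j. i < j \<and> (\<exists>u\<in>P. f j = act u (f i))" by blast
qed

text \<open>The analogue of Hilbert's basis theorem: among the subsets of \<open>D\<close> generated
  by finitely many elements of \<open>D\<close> there is a maximal one, and adjoining any further
  element of \<open>D\<close> to the generators cannot enlarge it.\<close>

lemma fg_set_stable_subset:
  assumes P: "fg_submonoid P M" and X: "fg_set P X" and D: "D \<subseteq> X" "stable P D"
  shows "fg_set P D"
proof -
  have sub: "submonoid P M" using P unfolding fg_submonoid_def by blast
  have XS: "X \<subseteq> S" and st: "stable P X" using X fg_set_stable[OF sub X] unfolding fg_set_def by auto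
  let ?O = "\<lambda>B. \<Union>a\<in>B. (\<lambda>u. act u a) ` P"
  have sO: "B \<subseteq> D \<Longrightarrow> ?O B \<subseteq> D" for B using D(2) unfolding stable_def by blast
  let ?F = "?O ` {B. finite B \<and> B \<subseteq> D}"
  have "\<exists>E\<in>?F. \<forall>E'\<in>?F. E \<subseteq> E' \<longrightarrow> E' = E"
  proof (rule wqo_on_maximal[OF wqo_on_orbits[OF P X]])
    show "?F \<noteq> {}" by blast
    show "E \<subseteq> X" if "E \<in> ?F" for E using that sO D(1) by blast
    fix E s t assume E: "E \<in> ?F" and s: "s \<in> E" "\<exists>u\<in>P. t = act u s"
    obtain B where B: "B \<subseteq> D" "E = ?O B" using E by blast
    have "stable P E" unfolding B(2) by (rule stable_orbits[OF sub]) (use B D(1) XS in blast)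
    then show "t \<in> E" using s unfolding stable_def by blast
  qed
  then obtain E where E: "E \<in> ?F" and E': "\<forall>E'\<in>?F. E \<subseteq> E' \<longrightarrow> E' = E" by (rule bexE)
  from E obtain B where EB: "E = ?O B" and "B \<in> {B. finite B \<and> B \<subseteq> D}" by (rule imageE)
  then have B: "finite B" "B \<subseteq> D" by simp_all
  have "a \<in> ?O B" if a: "a \<in> D" for a
  proof -
    have "?O (insert a B) \<in> ?F" by (rule imageI) (use B a in simp)
    from bspec[OF E' this] have "?O (insert a B) = ?O B" unfolding EB
      by (rule mp) (rule UN_mono, rule subset_insertI, rule subset_refl)
    moreover have "a \<in> ?O (insert a B)"
      by (rule UN_I[OF insertI1], rule orbit_self[OF sub]) (use a D(1) XS in blast)
    ultimately show ?thesis by simp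
  qed
  then have "D = ?O B" using sO[OF B(2)] by blast
  then show ?thesis unfolding fg_set_def using B D(1) XS by blast
qed

section \<open>Bad faces as the obstruction to being a leaf\<close>

section \<open>Faces and localised equivalence\<close>

text \<open>\<open>G\<close> is the face generated by \<open>F\<close> and \<open>g\<close>: close
  the products of an element of \<open>F\<close> and a power of \<open>g\<close> under divisors in
  \<open>P\<close>.\<close>

lemma face_extend:
  assumes P: "submonoid P M" and F: "face F P" and g: "g \<in> P"
  defines "G \<equiv> {u \<in> P. \<exists>v\<in>P. \<exists>f\<in>F. \<exists>n::nat. u \<otimes> v = f \<otimes> g [^] n}"
  shows "face G P" "F \<subseteq> G" "g \<in> G"
proof -
  have Fs: "submonoid F M" "F \<subseteq> P" using F unfolding face_def by auto
  note c = in_carrier[OF P]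
  have c1: "\<one> \<in> P" "\<one> \<in> F" using P Fs by (auto simp: submonoid.one_closed)
  have FG: "u \<in> G" if "u \<in> F" for u
  proof -
    have "u \<otimes> \<one> = u \<otimes> g [^] (0::nat)" using that Fs c by simp
    then show ?thesis unfolding G_def using that Fs c1 by blast
  qed
  then show "F \<subseteq> G" by blast
  have "g \<otimes> \<one> = \<one> \<otimes> g [^] (1::nat)" using g c by simp
  then show "g \<in> G" unfolding G_def using g c1 by blast
  show "face G P"
    unfolding face_def
  proof (intro conjI ballI impI)
    show "G \<subseteq> P" unfolding G_def by blast
    show "submonoid G M"
    proof
      show "G \<subseteq> carrier M" unfolding G_def using c by blast
      show "\<one> \<in> G" using FG c1 by blast
      fix u u' assume "u \<in> G" "u' \<in> G"
      then obtain v f n v' f' n' where *: "u \<in> P" "v \<in> P" "f \<in> F" "u \<otimes> v = f \<otimes> g [^] (n::nat)"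
        "u' \<in> P" "v' \<in> P" "f' \<in> F" "u' \<otimes> v' = f' \<otimes> g [^] (n'::nat)" unfolding G_def by blast
      have cc: "u \<in> carrier M" "v \<in> carrier M" "f \<in> carrier M" "u' \<in> carrier M" "v' \<in> carrier M"
        "f' \<in> carrier M" "g \<in> carrier M" using * Fs c g by auto
      have "(u \<otimes> u') \<otimes> (v \<otimes> v') = (u \<otimes> v) \<otimes> (u' \<otimes> v')" using cc by (simp add: m_ac)
      also have "\<dots> = (f \<otimes> f') \<otimes> g [^] (n + n')"
        unfolding *(4,8) using cc by (simp add: nat_pow_mult[symmetric] m_ac)
      finally have "(u \<otimes> u') \<otimes> (v \<otimes> v') = (f \<otimes> f') \<otimes> g [^] (n + n')" .
      moreover have "u \<otimes> u' \<in> P" "v \<otimes> v' \<in> P" "f \<otimes> f' \<in> F"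
        using * P Fs by (auto simp: submonoid.m_closed)
      ultimately show "u \<otimes> u' \<in> G" unfolding G_def by blast
    qed
    have *: "u \<in> G" if uv: "u \<in> P" "v \<in> P" "u \<otimes> v \<in> G" for u v
    proof -
      obtain w f n where w: "w \<in> P" "f \<in> F" "(u \<otimes> v) \<otimes> w = f \<otimes> g [^] (n::nat)"
        using uv(3) unfolding G_def by blast
      then have "u \<otimes> (v \<otimes> w) = f \<otimes> g [^] n" using uv c by (simp add: m_assoc[symmetric])
      then show ?thesis unfolding G_def using uv w submonoid.m_closed[OF P] by blast
    qed
    fix u v assume uv: "u \<in> P" "v \<in> P" "u \<otimes> v \<in> G"
    then show "u \<in> G" by (rule *)
    have "v \<otimes> u \<in> G" using uv c by (simp add: m_comm)
    then show "v \<in> G" by (rule *[OF uv(2,1)])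
  qed
qed

lemma face_self: "submonoid P M \<Longrightarrow> face P P"
  unfolding face_def by blast

text \<open>Badness of \<open>F\<close> means that localising at \<open>F\<close> loses an
  identification made by \<open>P\<close>. The face \<open>P\<close> itself is never bad, so bad
  faces are proper; counting them gives the second component of the termination measure.\<close>

definition bad_face :: "'m set \<Rightarrow> 's set \<Rightarrow> 'm set \<Rightarrow> bool" where
  "bad_face P X F \<longleftrightarrow> face F P \<and> (\<exists>s\<in>X. \<exists>t\<in>X. eqv P s t \<and> \<not> eqv F s t)"

text \<open>Units do not change the localised equivalence, so a node at which no proper face is bad is
  a legitimate leaf.\<close>

lemma ex_bad_face:
  assumes P: "submonoid P M" and X: "X \<subseteq> S" and st: "s \<in> X" "t \<in> X" "eqv P s t" "(s, t) \<notin> R"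
  shows "\<exists>F. bad_face P X F"
proof -
  \<comment> \<open>The units of \<open>P\<close> form its least face. A multiplier from
    \<open>U\<close> can be inverted, so equivalence under \<open>U\<close> already implies
    \<open>R\<close>.\<close>
  define U where "U = {u \<in> P. \<exists>v\<in>P. u \<otimes> v = \<one>}"
  note c = in_carrier[OF P]
  have 1: "\<one> \<in> P" using P by (rule submonoid.one_closed)
  have *: "u \<in> U" if uv: "u \<in> P" "v \<in> P" "u \<otimes> v \<in> U" for u v
  proof -
    obtain w where w: "w \<in> P" "(u \<otimes> v) \<otimes> w = \<one>" using uv(3) unfolding U_def by blast
    then have "u \<otimes> (v \<otimes> w) = \<one>" using uv c by (simp add: m_assoc[symmetric])
    then show ?thesis unfolding U_def using uv w submonoid.m_closed[OF P] by blast
  qed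
  have "submonoid U M"
  proof
    show "U \<subseteq> carrier M" unfolding U_def using c by blast
    have "\<one> \<otimes> \<one> = \<one>" by simp
    then show "\<one> \<in> U" unfolding U_def using 1 by blast
    fix u u' assume "u \<in> U" "u' \<in> U"
    then obtain v v' where *: "u \<in> P" "v \<in> P" "u \<otimes> v = \<one>" "u' \<in> P" "v' \<in> P" "u' \<otimes> v' = \<one>"
      unfolding U_def by blast
    have "(u \<otimes> u') \<otimes> (v \<otimes> v') = (u \<otimes> v) \<otimes> (u' \<otimes> v')"
      using *(1,2,4,5)[THEN c] by (simp add: m_ac)
    then have "(u \<otimes> u') \<otimes> (v \<otimes> v') = \<one>" using * by simp
    then show "u \<otimes> u' \<in> U" unfolding U_def using * submonoid.m_closed[OF P] by blast
  qed
  moreover have "u \<in> U \<and> v \<in> U" if "u \<in> P" "v \<in> P" "u \<otimes> v \<in> U" for u v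
    using *[OF that] *[OF that(2,1)] that c by (simp add: m_comm)
  ultimately have face: "face U P" unfolding face_def U_def by blast
  moreover have "\<not> eqv U s t"
  proof
    assume "eqv U s t"
    then obtain u where u: "u \<in> U" "(act u s, act u t) \<in> R" unfolding eqv_def loc_def by blast
    then obtain v where v: "u \<in> P" "v \<in> P" "u \<otimes> v = \<one>" unfolding U_def by blast
    have "act v (act u x) = x" if "x \<in> S" for x
      using v c that by (simp add: act_mult[symmetric] m_comm[of v u] act_one)
    moreover have "s \<in> S" "t \<in> S" using st X by auto
    ultimately have "(s, t) \<in> R" using R_act[OF u(2) c[OF v(2)]] by simp
    then show False using st by blast
  qed
  ultimately show ?thesis unfolding bad_face_def using st by blast
qed

lemma bad_face_subset: "bad_face P D F \<Longrightarrow> D \<subseteq> X \<Longrightarrow> bad_face P X F"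
  unfolding bad_face_def by blast

end

section \<open>The part of a node on which a maximal bad face is cured\<close>

section \<open>Splitting a node\<close>

context preordered_monoid_set
begin

text \<open>The candidates for the child that keeps the whole monoid: on \<open>D\<close> the face
  \<open>F\<close> is no longer bad. The last condition closes \<open>D\<close> under
  \<open>F\<close>-equivalence and under division by \<open>F\<close>, so that \<open>D\<close> can
  become a single class of the relation defining the children.\<close>

definition admissible :: "'m set \<Rightarrow> 's set \<Rightarrow> 'm set \<Rightarrow> 's set \<Rightarrow> bool" where
  "admissible P X F D \<longleftrightarrow> D \<subseteq> X \<and> stable P D \<and> (\<forall>s\<in>D. \<forall>t\<in>D. eqv P s t \<longrightarrow> eqv F s t) \<and>
     (\<forall>f\<in>F. \<forall>s\<in>X. \<forall>d\<in>D. eqv F (act f s) d \<longrightarrow> s \<in> D)"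

text \<open>Admissible sets are \<open>P\<close>-stable, hence upward closed for the orbit order,
  and the empty set is one of them.\<close>

lemma ex_maximal_admissible:
  assumes "fg_submonoid P M" "fg_set P X"
  shows "\<exists>D. admissible P X F D \<and> (\<forall>E. admissible P X F E \<longrightarrow> D \<subseteq> E \<longrightarrow> E = D)"
proof -
  have "\<exists>D\<in>{D. admissible P X F D}. \<forall>E\<in>{D. admissible P X F D}. D \<subseteq> E \<longrightarrow> E = D"
  proof (rule wqo_on_maximal[OF wqo_on_orbits[OF assms]])
    have "admissible P X F {}" unfolding admissible_def stable_def by simp
    then show "{D. admissible P X F D} \<noteq> {}" by blast
    show "D \<subseteq> X" if "D \<in> {D. admissible P X F D}" for D using that unfolding admissible_def by simp
    show "t \<in> D" if "D \<in> {D. admissible P X F D}" "s \<in> D" "\<exists>u\<in>P. t = act u s" for D s t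
      using that unfolding admissible_def stable_def by auto
  qed
  then show ?thesis by simp
qed

end

text \<open>A node with the two choices that cut it: a face \<open>F\<close> beyond which no larger
  face is bad, and a maximal admissible set \<open>D\<close>.\<close>

locale splitting = preordered_monoid_set M act S R
  for M :: "('m, 'b) monoid_scheme" (structure) and act :: "'m \<Rightarrow> 's \<Rightarrow> 's" and S :: "'s set"
    and R :: "'s rel" +
  fixes P :: "'m set" and X :: "'s set" and F :: "'m set" and D :: "'s set"
  assumes fgP: "fg_submonoid P M" and fgX: "fg_set P X" and face: "face F P"
    and no_bad: "\<And>G. face G P \<Longrightarrow> F \<subset> G \<Longrightarrow> \<not> bad_face P X G"
    and adm: "admissible P X F D"
    and adm_max: "\<And>E. admissible P X F E \<Longrightarrow> D \<subseteq> E \<Longrightarrow> E = D"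
begin

lemma P: "submonoid P M"
  using fgP unfolding fg_submonoid_def by blast

lemma F: "submonoid F M" "F \<subseteq> P"
  using face unfolding face_def by auto

lemma Pc: "u \<in> P \<Longrightarrow> u \<in> carrier M"
  using in_carrier[OF P] .

lemma FP: "u \<in> F \<Longrightarrow> u \<in> P"
  using F by blast

lemma XS: "s \<in> X \<Longrightarrow> s \<in> S"
  using fgX unfolding fg_set_def by blast

lemma DX: "s \<in> D \<Longrightarrow> s \<in> X"
  using adm unfolding admissible_def by blast

lemma PX: "u \<in> P \<Longrightarrow> s \<in> X \<Longrightarrow> act u s \<in> X"
  using fg_set_stable[OF P fgX] unfolding stable_def by blast

lemma PD: "u \<in> P \<Longrightarrow> s \<in> D \<Longrightarrow> act u s \<in> D"
  using adm unfolding admissible_def stable_def by blast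

lemma Deq: "s \<in> D \<Longrightarrow> t \<in> D \<Longrightarrow> eqv P s t \<Longrightarrow> eqv F s t"
  using adm unfolding admissible_def by blast

lemma Dsat: "f \<in> F \<Longrightarrow> s \<in> X \<Longrightarrow> d \<in> D \<Longrightarrow> eqv F (act f s) d \<Longrightarrow> s \<in> D"
  using adm unfolding admissible_def by blast

lemma PXS: "u \<in> P \<Longrightarrow> s \<in> X \<Longrightarrow> act u s \<in> S"
  using PX XS by blast

lemma P_mult: "u \<in> P \<Longrightarrow> v \<in> P \<Longrightarrow> u \<otimes> v \<in> P"
  using P by (rule submonoid.m_closed)

lemma F_mult: "u \<in> F \<Longrightarrow> v \<in> F \<Longrightarrow> u \<otimes> v \<in> F"
  using F(1) by (rule submonoid.m_closed)

lemma P_pow: "u \<in> P \<Longrightarrow> u [^] (n::nat) \<in> P"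
  using submonoid_pow_closed[OF P] .

lemma PP: "u \<in> P \<Longrightarrow> v \<in> P \<Longrightarrow> s \<in> X \<Longrightarrow> act (u \<otimes> v) s = act u (act v s)"
  using act_mult Pc XS by blast

lemma P_comm: "u \<in> P \<Longrightarrow> v \<in> P \<Longrightarrow> s \<in> X \<Longrightarrow> act u (act v s) = act v (act u s)"
  using act_comm Pc XS by blast

lemma eqvF_P: "eqv F s t \<Longrightarrow> eqv P s t"
  using eqv_mono F(2) by blast

lemma eqv_trans_P: "eqv P s t \<Longrightarrow> eqv P t x \<Longrightarrow> s \<in> X \<Longrightarrow> t \<in> X \<Longrightarrow> x \<in> X \<Longrightarrow> eqv P s x"
  using eqv_trans[OF P] XS by blast

lemma eqv_trans_F: "eqv F s t \<Longrightarrow> eqv F t x \<Longrightarrow> s \<in> X \<Longrightarrow> t \<in> X \<Longrightarrow> x \<in> X \<Longrightarrow> eqv F s x"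
  using eqv_trans[OF F(1)] XS by blast

lemma eqv_act_P: "eqv P s t \<Longrightarrow> u \<in> P \<Longrightarrow> s \<in> X \<Longrightarrow> t \<in> X \<Longrightarrow> eqv P (act u s) (act u t)"
  using eqv_act[OF P] XS Pc by blast

lemma eqv_act_F: "eqv F s t \<Longrightarrow> u \<in> P \<Longrightarrow> s \<in> X \<Longrightarrow> t \<in> X \<Longrightarrow> eqv F (act u s) (act u t)"
  using eqv_act[OF F(1)] XS Pc by blast

text \<open>By maximality of the face \<open>F\<close>, the localised equivalence of \<open>P\<close> is already that of the face
  generated by \<open>F\<close> and \<open>g\<close>, whose elements divide products of an element of \<open>F\<close> and a power of
  \<open>g\<close>.\<close>

lemma eqv_power:
  assumes g: "g \<in> P" "g \<notin> F" and st: "s \<in> X" "t \<in> X" "eqv P s t"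
  obtains n :: nat where "eqv F (act (g [^] n) s) (act (g [^] n) t)"
proof -
  define G where "G = {u \<in> P. \<exists>v\<in>P. \<exists>f\<in>F. \<exists>n::nat. u \<otimes> v = f \<otimes> g [^] n}"
  have "face G P" "F \<subseteq> G" "g \<in> G" unfolding G_def by (rule face_extend[OF P face g(1)])+
  with g(2) have G: "face G P" "F \<subset> G" by auto
  then have "eqv G s t" using no_bad[OF G] st unfolding bad_face_def by blast
  moreover have "submonoid G M" using G(1) unfolding face_def by blast
  ultimately obtain u where u: "u \<in> G" "(act u s, act u t) \<in> R" "(act u t, act u s) \<in> R"
    using eqv_iff st XS by blast
  then obtain v f n where v: "u \<in> P" "v \<in> P" "f \<in> F" "u \<otimes> v = f \<otimes> g [^] (n::nat)"
    unfolding G_def by blast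
  \<comment> \<open>The cofactor \<open>v\<close> completes the multiplier \<open>u\<close> to f
    g^n, leaving \<open>f\<close> as an admissible multiplier for \<open>F\<close> once g^n has been
    applied.\<close>
  have *: "act v (act u x) = act f (act (g [^] n) x)" if "x \<in> X" for x
    using that v Pc XS FP g P_pow by (simp add: PP[symmetric] m_comm[of v u])
  have "(act f (act (g [^] n) s), act f (act (g [^] n) t)) \<in> R"
    "(act f (act (g [^] n) t), act f (act (g [^] n) s)) \<in> R"
    using R_act[OF u(2) Pc[OF v(2)]] R_act[OF u(3) Pc[OF v(2)]] st by (simp_all add: *)
  then have "eqv F (act (g [^] n) s) (act (g [^] n) t)" unfolding eqv_def loc_def using v(3) by blast
  then show thesis using that by blast
qed

text \<open>Put x_k = g^k s. The u in \<open>P\<close> with u x_k in \<open>D\<close> form an ideal,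
  and the pairs u, v with u x_k and v x_k \<open>F\<close>-equivalent form a congruence. Both grow
  with k, so by Dickson and Redei they are constant from some k on, and further factors g may be
  dropped.\<close>

lemma power_stable:
  assumes g: "g \<in> P" and s: "s \<in> X"
  shows "\<exists>k::nat. (\<forall>n::nat. \<forall>u\<in>P. act u (act (g [^] n) (act (g [^] k) s)) \<in> D \<longrightarrow> act u (act (g [^] k) s) \<in> D) \<and>
    (\<forall>n::nat. \<forall>u\<in>P. \<forall>v\<in>P.
      eqv F (act u (act (g [^] n) (act (g [^] k) s))) (act v (act (g [^] n) (act (g [^] k) s))) \<longrightarrow>
      eqv F (act u (act (g [^] k) s)) (act v (act (g [^] k) s)))"
proof -
  define x where "x k = act (g [^] (k::nat)) s" for k
  have xX: "x k \<in> X" for k unfolding x_def using PX P_pow g s by blast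
  have x_add: "x (k + n) = act (g [^] n) (x k)" for k n
    unfolding x_def using g s P_pow Pc by (simp add: PP[symmetric] nat_pow_mult add.commute)
  define I where "I k = {u \<in> P. act u (x k) \<in> D}" for k
  define C where "C k = {(u, v). u \<in> P \<and> v \<in> P \<and> eqv F (act u (x k)) (act v (x k))}" for k
  have shift: "act u (x (j + n)) = act (g [^] n) (act u (x j))" if "u \<in> P" for u j n
    using that xX g P_pow by (simp add: x_add P_comm)
  have "\<exists>k. \<forall>j\<ge>k. I j = I k"
  proof (rule wqo_on_chain_stabilises[OF wqo_on_divides[OF fgP]])
    show "I k \<subseteq> P" for k unfolding I_def by blast
    show "I j \<subseteq> I k" if "j \<le> k" for j k
      using that PD P_pow[OF g] shift[of _ j "k - j"] unfolding I_def by auto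
    show "t \<in> I k" if "u \<in> I k" "t \<in> P" "\<exists>w\<in>P. t = w \<otimes> u" for k u t
      using that PD xX unfolding I_def by (auto simp: PP)
  qed
  then obtain k1 where k1: "\<And>j. k1 \<le> j \<Longrightarrow> I j = I k1" by blast
  have "\<exists>k. \<forall>j\<ge>k. C j = C k"
  proof (rule congruence_chain_stabilises[OF fgP])
    show "equiv P (C k)" for k
    proof (rule equivI)
      show "C k \<subseteq> P \<times> P" unfolding C_def by blast
      show "refl_on P (C k)"
        unfolding C_def using eqv_refl[OF F(1)] PXS xX by (auto intro!: refl_onI)
      show "sym (C k)" unfolding C_def using eqv_sym by (auto intro!: symI)
      show "trans (C k)" unfolding C_def using eqv_trans_F PX xX by (auto intro!: transI)
    qed
    show "(u \<otimes> w, v \<otimes> w) \<in> C k" if "(u, v) \<in> C k" "w \<in> P" for k u v w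
    proof -
      have uv: "u \<in> P" "v \<in> P" "eqv F (act u (x k)) (act v (x k))" using that unfolding C_def by auto
      then have "eqv F (act w (act u (x k))) (act w (act v (x k)))" using eqv_act_F that(2) PX xX by blast
      then show ?thesis
        unfolding C_def using uv that(2) xX P_mult by (simp add: PP P_comm[of w])
    qed
    show "C j \<subseteq> C k" if "j \<le> k" for j k
    proof -
      have "eqv F (act u (x k)) (act v (x k))"
        if "u \<in> P" "v \<in> P" "eqv F (act u (x j)) (act v (x j))" for u v
        using eqv_act_F[OF that(3) P_pow[OF g, of "k - j"]] that(1,2) PX xX \<open>j \<le> k\<close>
          shift[of u j "k - j"] shift[of v j "k - j"] by simp
      then show ?thesis unfolding C_def by blast
    qed
  qed
  then obtain k2 where k2: "\<And>j. k2 \<le> j \<Longrightarrow> C j = C k2" by blast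
  define k where "k = max k1 k2"
  have Ik: "I (k + n) = I k" and Ck: "C (k + n) = C k" for n
    using k1[of k] k1[of "k + n"] k2[of k] k2[of "k + n"] unfolding k_def by simp_all
  show ?thesis
  proof (intro exI[of _ k] conjI allI ballI impI)
    show "act u (act (g [^] k) s) \<in> D" if "u \<in> P" "act u (act (g [^] n) (act (g [^] k) s)) \<in> D" for n :: nat and u
      using that Ik[of n] unfolding x_def[symmetric] x_add[symmetric] I_def by blast
    show "eqv F (act u (act (g [^] k) s)) (act v (act (g [^] k) s))"
      if "u \<in> P" "v \<in> P"
        "eqv F (act u (act (g [^] n) (act (g [^] k) s))) (act v (act (g [^] n) (act (g [^] k) s)))" for n :: nat and u v
      using that Ck[of n] unfolding x_def[symmetric] x_add[symmetric] C_def by blast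
  qed
qed

text \<open>For a k as in \<open>power_stable\<close> and x = g^k s, adjoining to \<open>D\<close>
  everything that becomes \<open>F\<close>-equivalent to the orbit of x after multiplication by
  \<open>F\<close> keeps it admissible. Maximality of \<open>D\<close> then gives x in
  \<open>D\<close>.\<close>

lemma power_into_D:
  assumes g: "g \<in> P" "g \<notin> F" and s: "s \<in> X"
  shows "\<exists>k::nat. act (g [^] k) s \<in> D"
proof -
  obtain k :: nat where stDE: "(\<forall>n::nat. \<forall>u\<in>P. act u (act (g [^] n) (act (g [^] k) s)) \<in> D \<longrightarrow> act u (act (g [^] k) s) \<in> D) \<and>
    (\<forall>n::nat. \<forall>u\<in>P. \<forall>v\<in>P.
      eqv F (act u (act (g [^] n) (act (g [^] k) s))) (act v (act (g [^] n) (act (g [^] k) s))) \<longrightarrow>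
      eqv F (act u (act (g [^] k) s)) (act v (act (g [^] k) s)))"
    using power_stable[OF g(1) s] ..
  define x where "x = act (g [^] k) s"
  have stD: "act u x \<in> D" if "u \<in> P" "act u (act (g [^] n) x) \<in> D" for n :: nat and u
    using stDE that unfolding x_def by blast
  have stE: "eqv F (act u x) (act v x)"
    if "u \<in> P" "v \<in> P" "eqv F (act u (act (g [^] n) x)) (act v (act (g [^] n) x))" for n :: nat and u v
    using stDE that unfolding x_def by blast
  have x: "x \<in> X" unfolding x_def using PX P_pow g s by blast
  have comm: "act (g [^] (n::nat)) (act u x) = act u (act (g [^] n) x)" if "u \<in> P" for u n
    using P_comm P_pow g that x by blast
  \<comment> \<open>On the orbit of x the two equivalences agree: a power of g makes
    \<open>P\<close>-equivalent elements \<open>F\<close>-equivalent, and stability removes that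
    power again.\<close>
  have px: "eqv F (act p x) (act q x)" if p: "p \<in> P" "q \<in> P" "eqv P (act p x) (act q x)" for p q
  proof -
    obtain n :: nat where "eqv F (act (g [^] n) (act p x)) (act (g [^] n) (act q x))"
      using eqv_power[OF g PX[OF p(1) x] PX[OF p(2) x] p(3)] .
    then show ?thesis using stE[of p q n] p by (simp add: comm)
  qed
  \<comment> \<open>An orbit element \<open>P\<close>-equivalent to an element of \<open>D\<close>
    lies in \<open>D\<close>: after a power of g saturation applies, and stability of the ideal
    removes the power.\<close>
  have dx: "act p x \<in> D" if p: "p \<in> P" "d \<in> D" "eqv P (act p x) d" for p d
  proof -
    obtain n :: nat where n: "eqv F (act (g [^] n) (act p x)) (act (g [^] n) d)"
      using eqv_power[OF g PX[OF p(1) x] DX[OF p(2)] p(3)] .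
    have "eqv F (act \<one> (act (g [^] n) (act p x))) (act (g [^] n) d)"
      using n PXS P_pow g PX p x by (simp add: act_one)
    then have "act (g [^] n) (act p x) \<in> D"
      by (rule Dsat[rotated 3])
        (use submonoid.one_closed[OF F(1)] PX P_pow g p x PD in auto)
    then show ?thesis using stD[of p n] p by (simp add: comm)
  qed
  \<comment> \<open>The saturation of the orbit of x under \<open>F\<close>-equivalence and division
    by \<open>F\<close>.\<close>
  define Y where "Y = {y \<in> X. \<exists>f\<in>F. \<exists>p\<in>P. eqv F (act f y) (act p x)}"
  have "admissible P X F (D \<union> Y)"
    unfolding admissible_def
  proof (intro conjI ballI impI)
    show "D \<union> Y \<subseteq> X" using DX unfolding Y_def by blast
    have "act u y \<in> Y" if uy: "u \<in> P" "y \<in> Y" for u y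
    proof -
      obtain f p where fp: "y \<in> X" "f \<in> F" "p \<in> P" "eqv F (act f y) (act p x)"
        using uy unfolding Y_def by blast
      have "eqv F (act u (act f y)) (act u (act p x))"
        using eqv_act_F[OF fp(4) that(1)] PX fp x FP by blast
      then have "eqv F (act f (act u y)) (act (u \<otimes> p) x)"
        using fp x that(1) FP by (simp add: PP P_comm[of u f])
      then show ?thesis unfolding Y_def using fp PX that P_mult by blast
    qed
    then show "stable P (D \<union> Y)" unfolding stable_def using PD by blast
  next
    fix f s d assume f: "f \<in> F" and s: "s \<in> X" and d: "d \<in> D \<union> Y" and e: "eqv F (act f s) d"
    show "s \<in> D \<union> Y"
    proof (cases "d \<in> D")
      case True
      then show ?thesis using Dsat f s e by blast
    next
      case False
      then obtain f' p where fp: "d \<in> X" "f' \<in> F" "p \<in> P" "eqv F (act f' d) (act p x)"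
        using d unfolding Y_def by blast
      have "eqv F (act f' (act f s)) (act f' d)" using eqv_act_F[OF e] f fp FP PX s by blast
      then have "eqv F (act (f' \<otimes> f) s) (act p x)"
        using eqv_trans_F[OF _ fp(4)] fp f s x PX FP by (simp add: PP)
      then show ?thesis unfolding Y_def using s fp f F_mult by blast
    qed
  next
    \<comment> \<open>Mixed pairs reduce to \<open>D\<close>: by \<open>dx\<close> the orbit element
      attached to s lies in \<open>D\<close>, and saturation then brings s into \<open>D\<close> as
      well.\<close>
    have DY: "eqv F s t" if sty: "s \<in> Y" "t \<in> D" "eqv P s t" for s t
    proof -
      obtain f p where fp: "s \<in> X" "f \<in> F" "p \<in> P" "eqv F (act f s) (act p x)"
        using sty unfolding Y_def by blast
      have "eqv P (act f s) (act f t)" using eqv_act_P that FP fp DX by blast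
      then have "eqv P (act p x) (act f t)"
        using eqv_trans_P[OF eqv_sym[OF eqvF_P[OF fp(4)]]] PX fp that FP DX x by blast
      then have "act p x \<in> D" using dx PD FP that fp by blast
      then have "s \<in> D" using Dsat fp by blast
      then show ?thesis using Deq that by blast
    qed
    fix s t assume s: "s \<in> D \<union> Y" and t: "t \<in> D \<union> Y" and e: "eqv P s t"
    show "eqv F s t"
    proof (cases "s \<in> D \<or> t \<in> D")
      case True
      then show ?thesis using s t e DY eqv_sym Deq by blast
    next
      case False
      then obtain f p f' q where fp: "s \<in> X" "f \<in> F" "p \<in> P" "eqv F (act f s) (act p x)"
        and fq: "t \<in> X" "f' \<in> F" "q \<in> P" "eqv F (act f' t) (act q x)"
        using s t unfolding Y_def by blast
      \<comment> \<open>The common multiplier f'f moves both elements into the orbit of x up to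
        \<open>F\<close>-equivalence, where \<open>px\<close> applies; afterwards f'f is
        cancelled.\<close>
      have 1: "eqv F (act (f' \<otimes> f) s) (act (f' \<otimes> p) x)"
        using eqv_act_F[OF fp(4), of f'] fp fq x PX FP by (simp add: PP)
      have 2: "eqv F (act (f' \<otimes> f) t) (act (f \<otimes> q) x)"
        using eqv_act_F[OF fq(4), of f] fp fq x PX FP by (simp add: PP P_comm[of f' f])
      have in1: "f' \<otimes> f \<in> P" "f' \<otimes> p \<in> P" "f \<otimes> q \<in> P" using fp fq FP P_mult by blast+
      have "eqv P (act (f' \<otimes> f) s) (act (f' \<otimes> f) t)" using eqv_act_P[OF e in1(1)] fp fq by blast
      then have "eqv P (act (f' \<otimes> p) x) (act (f \<otimes> q) x)"
        using eqv_trans_P[OF eqv_sym[OF eqvF_P[OF 1]]] eqv_trans_P[OF _ eqvF_P[OF 2]]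
          PX in1 fp(1) fq(1) x by meson
      then have "eqv F (act (f' \<otimes> p) x) (act (f \<otimes> q) x)" using px in1 by blast
      then have "eqv F (act (f' \<otimes> f) s) (act (f' \<otimes> f) t)"
        using eqv_trans_F[OF 1] eqv_trans_F[OF _ eqv_sym[OF 2]] PX in1 fp(1) fq(1) x by meson
      then show ?thesis using eqv_cancel[OF F(1)] F_mult fp fq XS by blast
    qed
  qed
  then have "D \<union> Y = D" by (rule adm_max) blast
  moreover have "x \<in> Y"
    unfolding Y_def using x submonoid.one_closed[OF F(1)] submonoid.one_closed[OF P]
      eqv_refl[OF F(1)] PXS by blast
  ultimately show ?thesis unfolding x_def by blast
qed

end

section \<open>The order on the children and their finiteness\<close>

context splitting
begin

text \<open>The multipliers \<open>f\<close> and \<open>g\<close> are independent, so an element and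
  its \<open>F\<close>-multiples lie below each other; this puts \<open>F\<close> into every
  stabiliser. The equivalence clause confines comparisons to pairs that the parent does not yet
  separate.\<close>

definition below :: "'s \<Rightarrow> 's \<Rightarrow> bool" where
  "below s t \<longleftrightarrow> (\<exists>f\<in>F. \<exists>g\<in>F. (act f s, act g t) \<in> R \<and> eqv P (act f s) (act g t))"

text \<open>The relation \<open>below\<close> with \<open>D\<close> collapsed to one point: the
  second alternative passes from s to t through \<open>D\<close>.\<close>

definition child_leq :: "'s \<Rightarrow> 's \<Rightarrow> bool" where
  "child_leq s t \<longleftrightarrow> below s t \<or> (\<exists>d\<in>D. below s d) \<and> (\<exists>d\<in>D. below d t)"

definition sim :: "'s \<Rightarrow> 's \<Rightarrow> bool" where
  "sim s t \<longleftrightarrow> child_leq s t \<and> child_leq t s"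

lemma F_one: "\<one> \<in> F"
  using F(1) by (rule submonoid.one_closed)

lemma below_R: "(s, t) \<in> R \<Longrightarrow> eqv P s t \<Longrightarrow> s \<in> X \<Longrightarrow> t \<in> X \<Longrightarrow> below s t"
  unfolding below_def using F_one XS by (intro bexI[of _ \<one>]) (auto simp: act_one)

lemma below_refl: "s \<in> X \<Longrightarrow> below s s"
  using below_R R_refl eqv_refl[OF P] XS by blast

lemma below_F:
  assumes "f \<in> F" "s \<in> X"
  shows "below (act f s) s" "below s (act f s)"
proof -
  have fs: "act f s \<in> X" "act f s \<in> S" using assms PX FP XS by auto
  have "(act \<one> (act f s), act f s) \<in> R" "(act f s, act \<one> (act f s)) \<in> R"
    "eqv P (act \<one> (act f s)) (act f s)" "eqv P (act f s) (act \<one> (act f s))"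
    using fs R_refl eqv_refl[OF P] by (simp_all add: act_one)
  then show "below (act f s) s" "below s (act f s)" unfolding below_def using F_one assms by blast+
qed

lemma below_act:
  assumes "below s t" "u \<in> P" "s \<in> X" "t \<in> X"
  shows "below (act u s) (act u t)"
proof -
  obtain f g where fg: "f \<in> F" "g \<in> F" "(act f s, act g t) \<in> R" "eqv P (act f s) (act g t)"
    using assms(1) unfolding below_def by blast
  have "(act f (act u s), act g (act u t)) \<in> R"
    using R_act[OF fg(3) Pc[OF assms(2)]] assms fg FP by (simp add: P_comm[of u])
  moreover have "eqv P (act f (act u s)) (act g (act u t))"
    using eqv_act_P[OF fg(4) assms(2)] assms fg FP PX by (simp add: P_comm[of u])
  ultimately show ?thesis unfolding below_def using fg by blast
qed

lemma below_trans:
  assumes "below s t" "below t x" "s \<in> X" "t \<in> X" "x \<in> X"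
  shows "below s x"
proof -
  obtain f g where fg: "f \<in> F" "g \<in> F" "(act f s, act g t) \<in> R" "eqv P (act f s) (act g t)"
    using assms(1) unfolding below_def by blast
  obtain f' g' where fg': "f' \<in> F" "g' \<in> F" "(act f' t, act g' x) \<in> R" "eqv P (act f' t) (act g' x)"
    using assms(2) unfolding below_def by blast
  note p = fg(1,2)[THEN FP] fg'(1,2)[THEN FP]
  have "(act (f' \<otimes> f) s, act (f' \<otimes> g) t) \<in> R"
    using R_act[OF fg(3) Pc[OF p(3)]] assms p by (simp add: PP)
  moreover have "(act (f' \<otimes> g) t, act (g \<otimes> g') x) \<in> R"
    using R_act[OF fg'(3) Pc[OF p(2)]] assms p by (simp add: PP P_comm[of g f'])
  ultimately have 1: "(act (f' \<otimes> f) s, act (g \<otimes> g') x) \<in> R" by (rule R_trans)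
  have "eqv P (act (f' \<otimes> f) s) (act (f' \<otimes> g) t)"
    using eqv_act_P[OF fg(4) p(3)] assms p PX by (simp add: PP)
  moreover have "eqv P (act (f' \<otimes> g) t) (act (g \<otimes> g') x)"
    using eqv_act_P[OF fg'(4) p(2)] assms p PX by (simp add: PP P_comm[of g f'])
  ultimately have "eqv P (act (f' \<otimes> f) s) (act (g \<otimes> g') x)"
    by (rule eqv_trans_P) (use assms p PX P_mult in auto)
  with 1 show ?thesis unfolding below_def using fg fg' F_mult by blast
qed

text \<open>\<open>D\<close> is convex: on \<open>D\<close> the localised equivalences of \<open>P\<close> and \<open>F\<close> agree, and an element
  between two \<open>F\<close>-equivalent ones is \<open>F\<close>-equivalent to both.\<close>

lemma below_convex:
  assumes "below s d" "below d' s" "d \<in> D" "d' \<in> D" "s \<in> X"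
  shows "s \<in> D"
proof -
  obtain f g where fg: "f \<in> F" "g \<in> F" "(act f s, act g d) \<in> R" "eqv P (act f s) (act g d)"
    using assms(1) unfolding below_def by blast
  obtain f' g' where fg': "f' \<in> F" "g' \<in> F" "(act f' d', act g' s) \<in> R" "eqv P (act f' d') (act g' s)"
    using assms(2) unfolding below_def by blast
  note p = fg(1,2)[THEN FP] fg'(1,2)[THEN FP]
  have dd: "d \<in> X" "d' \<in> X" using DX assms by auto
  define a b c where "a = act (f \<otimes> f') d'" and "b = act (f \<otimes> g') s" and "c = act (g' \<otimes> g) d"
  have X: "a \<in> X" "b \<in> X" "c \<in> X" unfolding a_def b_def c_def using assms dd p P_mult PX by auto
  have D: "a \<in> D" "c \<in> D" unfolding a_def c_def using assms p P_mult PD by auto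
  have ab: "(a, b) \<in> R" "eqv P a b"
    unfolding a_def b_def using R_act[OF fg'(3) Pc[OF p(1)]] eqv_act_P[OF fg'(4) p(1)] assms dd p PX
    by (simp_all add: PP)
  have bc: "(b, c) \<in> R" "eqv P b c"
    unfolding b_def c_def using R_act[OF fg(3) Pc[OF p(4)]] eqv_act_P[OF fg(4) p(4)] assms dd p PX
    by (simp_all add: PP P_comm[of f g'])
  have "eqv P a c" using eqv_trans_P ab bc X by blast
  then have "eqv F a c" using Deq D by blast
  then have "loc F c a" unfolding eqv_def by blast
  then have "loc F b a" using loc_trans[OF F(1)] R_loc[OF F(1) bc(1)] X XS by blast
  then have "eqv F b a" unfolding eqv_def using R_loc[OF F(1) ab(1)] by blast
  then show ?thesis unfolding b_def using Dsat F_mult fg fg' assms D by blast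
qed

lemma child_leq_refl: "s \<in> X \<Longrightarrow> child_leq s s"
  unfolding child_leq_def using below_refl by blast

lemma child_leq_trans:
  assumes "child_leq s t" "child_leq t x" "s \<in> X" "t \<in> X" "x \<in> X"
  shows "child_leq s x"
proof -
  consider "below s t" "below t x" | d where "below s t" "d \<in> D" "below t d" "\<exists>d\<in>D. below d x"
    | d where "\<exists>d\<in>D. below s d" "d \<in> D" "below d t" "below t x"
    | "\<exists>d\<in>D. below s d" "\<exists>d\<in>D. below d x"
    using assms(1,2) unfolding child_leq_def by blast
  then show ?thesis
  proof cases
    case 1
    then show ?thesis unfolding child_leq_def using below_trans assms by blast
  next
    case 2
    then have "below s d" using below_trans assms DX by blast
    then show ?thesis unfolding child_leq_def using 2 by blast
  next
    case 3
    then have "below d x" using below_trans assms DX by blast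
    then show ?thesis unfolding child_leq_def using 3 by blast
  next
    case 4
    then show ?thesis unfolding child_leq_def by blast
  qed
qed

lemma child_leq_act:
  assumes "child_leq s t" "u \<in> P" "s \<in> X" "t \<in> X"
  shows "child_leq (act u s) (act u t)"
proof (cases "below s t")
  case True
  then show ?thesis unfolding child_leq_def using below_act assms by blast
next
  case False
  then obtain d d' where d: "d \<in> D" "below s d" "d' \<in> D" "below d' t"
    using assms(1) unfolding child_leq_def by blast
  then have "below (act u s) (act u d)" "below (act u d') (act u t)"
    using below_act assms DX by blast+
  then show ?thesis unfolding child_leq_def using PD assms(2) d by blast
qed

lemma sim_refl: "s \<in> X \<Longrightarrow> sim s s"
  unfolding sim_def using child_leq_refl by blast

lemma sim_sym: "sim s t \<Longrightarrow> sim t s"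
  unfolding sim_def by blast

lemma sim_trans: "sim s t \<Longrightarrow> sim t x \<Longrightarrow> s \<in> X \<Longrightarrow> t \<in> X \<Longrightarrow> x \<in> X \<Longrightarrow> sim s x"
  unfolding sim_def using child_leq_trans by blast

lemma sim_act: "sim s t \<Longrightarrow> u \<in> P \<Longrightarrow> s \<in> X \<Longrightarrow> t \<in> X \<Longrightarrow> sim (act u s) (act u t)"
  unfolding sim_def using child_leq_act by blast

lemma sim_F: "f \<in> F \<Longrightarrow> s \<in> X \<Longrightarrow> sim (act f s) s"
  unfolding sim_def child_leq_def using below_F by blast

lemma sim_D: "s \<in> D \<Longrightarrow> t \<in> D \<Longrightarrow> sim s t"
  unfolding sim_def child_leq_def using below_refl DX by blast

lemma sim_in_D:
  assumes "sim s d" "d \<in> D" "s \<in> X"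
  shows "s \<in> D"
proof -
  have "\<exists>d\<in>D. below s d" "\<exists>d\<in>D. below d s"
    using assms unfolding sim_def child_leq_def by blast+
  then show ?thesis using below_convex assms(3) by blast
qed

text \<open>If \<open>u\<close> were outside \<open>F\<close>, some power of it would carry
  \<open>s\<close> into \<open>D\<close>; but that power preserves the class of \<open>s\<close>,
  and \<open>D\<close> is a full class.\<close>

lemma sim_stabiliser:
  assumes "u \<in> P" "s \<in> X" "sim (act u s) s" "s \<notin> D"
  shows "u \<in> F"
proof (rule ccontr)
  assume "u \<notin> F"
  then obtain k :: nat where k: "act (u [^] k) s \<in> D" using power_into_D assms by blast
  have "sim (act (u [^] n) s) s" for n :: nat
  proof (induction n)
    case 0
    then show ?case using sim_refl assms XS by (simp add: act_one)
  next
    case (Suc n)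
    have X: "act (u [^] n) (act u s) \<in> X" "act (u [^] n) s \<in> X" using PX P_pow assms by auto
    have "sim (act (u [^] n) (act u s)) (act (u [^] n) s)"
      using sim_act[OF assms(3)] P_pow PX assms by blast
    then have "sim (act (u [^] n) (act u s)) s" using sim_trans Suc X assms by blast
    then show ?case using assms P_pow by (simp add: PP)
  qed
  then have "sim s (act (u [^] k) s)" using sim_sym by blast
  then show False using sim_in_D k assms by blast
qed

lemma child_leq_comparable: "eqv P s t \<Longrightarrow> s \<in> X \<Longrightarrow> t \<in> X \<Longrightarrow> child_leq s t \<or> child_leq t s"
  unfolding child_leq_def using R_total[of s t] below_R[of s t] below_R[of t s] eqv_sym[of P s t] XS
  by auto

text \<open>If \<open>child_leq s t\<close> held without \<open>R\<close>, totality would give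
  \<open>R\<close> from t to s, hence both directions of \<open>child_leq\<close> and a common
  class. This is why the order of the children reproduces \<open>R\<close>.\<close>

lemma child_leq_iff_R:
  assumes "eqv P s t" "s \<in> X" "t \<in> X" "\<not> sim s t"
  shows "child_leq s t \<longleftrightarrow> (s, t) \<in> R"
proof
  show "(s, t) \<in> R \<Longrightarrow> child_leq s t" unfolding child_leq_def using below_R assms by blast
  assume "child_leq s t"
  moreover have "child_leq t s" if "(t, s) \<in> R"
    unfolding child_leq_def using below_R[OF that] eqv_sym assms by blast
  ultimately show "(s, t) \<in> R" using assms R_total XS unfolding sim_def by blast
qed

text \<open>Up to factors from \<open>F\<close>, only generators outside \<open>F\<close> produce
  new elements, and by \<open>power_into_D\<close> only finitely many of their powers do so before
  \<open>D\<close> is reached. Finiteness of the tree and finite generation of the labels outside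
  \<open>D\<close> rest on this.\<close>

lemma finite_representatives:
  shows "\<exists>W. finite W \<and> W \<subseteq> X \<and> (\<forall>s\<in>X. s \<in> D \<or> (\<exists>w\<in>W. \<exists>f\<in>F. s = act f w))"
proof -
  obtain gs where gs: "set gs \<subseteq> P" "P = monomial gs ` {es. length es = length gs}"
    using fg_submonoidE[OF fgP] .
  obtain A where A: "X \<subseteq> S" "finite A" "A \<subseteq> X" "X = (\<Union>a\<in>A. (\<lambda>u. act u a) ` P)"
    using fg_setE[OF fgX] .
  \<comment> \<open>The induction covers the monomials in the generators treated so far; the
    exponent list is unrestricted so that \<open>tl\<close> can be passed on.\<close>
  define cov where "cov W gs \<longleftrightarrow> finite W \<and> W \<subseteq> X \<and> (\<forall>es. \<forall>a\<in>A. act (monomial gs es) a \<in> D \<or>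
    (\<exists>w\<in>W. \<exists>f\<in>F. act (monomial gs es) a = act f w))" for W gs
  have covD: "act (monomial gs es) a \<in> D \<or> (\<exists>w\<in>W. \<exists>f\<in>F. act (monomial gs es) a = act f w)"
    if "cov W gs" "a \<in> A" for W gs es a using that unfolding cov_def by simp
  have "\<exists>W. cov W gs"
    using gs(1)
  proof (induction gs)
    case Nil
    have "cov A []" unfolding cov_def using A(2,3) F_one by auto
    then show ?case ..
  next
    case (Cons g gs)
    then have g: "g \<in> P" and gsP: "set gs \<subseteq> P" by auto
    then obtain W where cW: "cov W gs" using Cons.IH by blast
    then have W: "finite W" "W \<subseteq> X" unfolding cov_def by simp_all
    note WF = covD[OF cW]
    have split: "act (monomial (g # gs) es) a = act (g [^] hd es) (act (monomial gs (tl es)) a)"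
      if "a \<in> A" for es a
      using that A(3) P_pow[OF g] monomial_in[OF P gsP] by (simp add: PP subsetD)
    show ?case
    proof (cases "g \<in> F")
      case True
      have "act (monomial (g # gs) es) a \<in> D \<or> (\<exists>w\<in>W. \<exists>f\<in>F. act (monomial (g # gs) es) a = act f w)"
        if a: "a \<in> A" for es a
      proof -
        \<comment> \<open>A generator in \<open>F\<close> is absorbed into the factor from
          \<open>F\<close>, so the old representatives suffice.\<close>
        have gF: "g [^] hd es \<in> F" by (rule submonoid_pow_closed[OF F(1) True])
        consider "act (monomial gs (tl es)) a \<in> D"
          | w f where "w \<in> W" "f \<in> F" "act (monomial gs (tl es)) a = act f w" using WF[OF a] by blast
        then show ?thesis
        proof cases
          case 1
          then show ?thesis using PD P_pow[OF g] split[OF a] by simp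
        next
          case 2
          then have "act (monomial (g # gs) es) a = act (g [^] hd es \<otimes> f) w"
            using split[OF a] W FP P_pow[OF g] by (simp add: PP subsetD)
          then show ?thesis using 2 F_mult gF by blast
        qed
      qed
      then have "cov W (g # gs)" unfolding cov_def using W by simp
      then show ?thesis ..
    next
      case False
      have "\<forall>w\<in>W. \<exists>k::nat. act (g [^] k) w \<in> D" using power_into_D[OF g False] W(2) by blast
      then obtain k :: "'s \<Rightarrow> nat" where k: "\<And>w. w \<in> W \<Longrightarrow> act (g [^] k w) w \<in> D" by metis
      \<comment> \<open>For a generator outside \<open>F\<close> only the powers below
        \<open>k w\<close> give new representatives; from \<open>k w\<close> on the result stays in
        \<open>D\<close>.\<close>
      define W' where "W' = (\<Union>w\<in>W. (\<lambda>j. act (g [^] j) w) ` {..<k w})"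
      have "act (monomial (g # gs) es) a \<in> D \<or> (\<exists>w\<in>W'. \<exists>f\<in>F. act (monomial (g # gs) es) a = act f w)"
        if a: "a \<in> A" for es a
      proof -
        consider "act (monomial gs (tl es)) a \<in> D"
          | w f where "w \<in> W" "f \<in> F" "act (monomial gs (tl es)) a = act f w" using WF[OF a] by blast
        then show ?thesis
        proof cases
          case 1
          then show ?thesis using PD P_pow[OF g] split[OF a] by simp
        next
          case 2
          then have eq: "act (monomial (g # gs) es) a = act f (act (g [^] hd es) w)"
            using split[OF a] W FP P_pow[OF g] P_comm by (simp add: subsetD)
          show ?thesis
          proof (cases "hd es < k w")
            case True
            then have "act (g [^] hd es) w \<in> W'" unfolding W'_def using 2 by blast
            then show ?thesis using eq 2 by blast
          next
            case False
            then have "act (g [^] hd es) w = act (g [^] (hd es - k w)) (act (g [^] k w) w)"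
              using 2 W P_pow[OF g] Pc[OF g] by (simp add: PP[symmetric] nat_pow_mult subsetD)
            then have "act (g [^] hd es) w \<in> D" using k[OF 2(1)] PD P_pow[OF g] by simp
            then show ?thesis using eq PD FP 2 by simp
          qed
        qed
      qed
      moreover have "finite W'" "W' \<subseteq> X" unfolding W'_def using W PX P_pow[OF g] by auto
      ultimately have "cov W' (g # gs)" unfolding cov_def by simp
      then show ?thesis ..
    qed
  qed
  then obtain W where cW: "cov W gs" ..
  then have W: "finite W" "W \<subseteq> X" unfolding cov_def by simp_all
  have "s \<in> D \<or> (\<exists>w\<in>W. \<exists>f\<in>F. s = act f w)" if s: "s \<in> X" for s
  proof -
    obtain a u where "a \<in> A" "u \<in> P" "s = act u a" using s A(4) by auto
    then show ?thesis using covD[OF cW] gs(2) by auto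
  qed
  then show ?thesis using W by blast
qed

end

section \<open>Splitting data and the decrease of nodes\<close>

lemma (in comm_monoid) submonoid_comm_monoid:
  assumes "submonoid H G"
  shows "comm_monoid (G\<lparr>carrier := H\<rparr>)"
proof -
  have "H \<subseteq> carrier G" using assms by (rule submonoid.subset)
  moreover have "monoid (G\<lparr>carrier := H\<rparr>)"
    using assms monoid_axioms by (rule submonoid.submonoid_is_monoid)
  ultimately show ?thesis
    by (intro monoid.monoid_comm_monoidI) (auto intro: m_comm)
qed

context preordered_monoid_set
begin

lemma sub_monoid_set:
  assumes "submonoid P M" "X \<subseteq> S" "stable P X"
  shows "monoid_set (M\<lparr>carrier := P\<rparr>) act X"
proof (intro monoid_set.intro monoid_set_axioms.intro submonoid_comm_monoid assms(1))
  show "act (u \<otimes>\<^bsub>M\<lparr>carrier := P\<rparr>\<^esub> v) s = act u (act v s)"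
    if "u \<in> carrier (M\<lparr>carrier := P\<rparr>)" "v \<in> carrier (M\<lparr>carrier := P\<rparr>)" "s \<in> X" for u v s
    using that in_carrier[OF assms(1)] assms(2) act_mult by (simp add: subsetD)
qed (use assms act_one in \<open>auto simp: stable_def subsetD\<close>)

lemma fg_set_fg_monoid_set:
  assumes "submonoid P M" "fg_set P X"
  shows "fg_monoid_set (M\<lparr>carrier := P\<rparr>) act X"
proof (intro fg_monoid_set.intro fg_monoid_set_axioms.intro)
  obtain A where A: "X \<subseteq> S" "finite A" "A \<subseteq> X" "X = (\<Union>a\<in>A. (\<lambda>u. act u a) ` P)"
    using fg_setE[OF assms(2)] .
  then show "monoid_set (M\<lparr>carrier := P\<rparr>) act X"
    using sub_monoid_set fg_set_stable assms by blast
  have orb: "orbit (M\<lparr>carrier := P\<rparr>) act a = (\<lambda>u. act u a) ` P" for a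
    unfolding orbit_def by auto
  show "\<exists>A. finite A \<and> A \<subseteq> X \<and> X = (\<Union>s\<in>A. orbit (M\<lparr>carrier := P\<rparr>) act s)"
    unfolding orb using A(2-4) by (intro exI conjI)
qed

text \<open>Nodes are pairs of a submonoid \<open>P\<close> and a \<open>P\<close>-stable set \<open>X\<close>. Passing to a child makes the
  monoid smaller, or keeps it and cures a bad face.\<close>

definition smaller_node :: "(('m set \<times> 's set) \<times> ('m set \<times> 's set)) set" where
  "smaller_node = measures [\<lambda>(P, X). card {F. face F P}, \<lambda>(P, X). card {F. bad_face P X F}]"

text \<open>Everything a vertex asks of its \<open>n\<close> children: monoids \<open>Ps\<close>,
  labels \<open>Xs\<close>, their order \<open>ord\<close> and the action \<open>a\<close> on
  indices. The clause linking \<open>ord\<close> with \<open>R\<close> makes the tree determine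
  \<open>R\<close>; the one on \<open>smaller_node\<close> makes it finite.\<close>

definition is_split :: "'m set \<Rightarrow> 's set \<Rightarrow> nat \<Rightarrow> (nat \<Rightarrow> 'm set) \<Rightarrow> (nat \<Rightarrow> 's set) \<Rightarrow> nat rel
    \<Rightarrow> ('m \<Rightarrow> nat \<Rightarrow> nat) \<Rightarrow> bool" where
  "is_split P X n Ps Xs ord a \<longleftrightarrow>
     0 < n \<and> X = (\<Union>i<n. Xs i) \<and> disjoint_family_on Xs {..<n} \<and> partial_order_on {..<n} ord \<and>
     (\<forall>i<n. \<forall>j<n. \<forall>s\<in>Xs i. \<forall>t\<in>Xs j. eqv P s t \<longrightarrow> (i, j) \<in> ord \<or> (j, i) \<in> ord) \<and>
     (\<forall>i<n. \<forall>j<n. \<forall>s\<in>Xs i. \<forall>t\<in>Xs j. eqv P s t \<longrightarrow> i \<noteq> j \<longrightarrow> (i, j) \<in> ord \<longleftrightarrow> (s, t) \<in> R) \<and>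
     good_action (M\<lparr>carrier := P\<rparr>) a {..<n} \<and>
     (\<forall>i<n. stabilizer (M\<lparr>carrier := P\<rparr>) a i = Ps i \<and> fg_submonoid (Ps i) M \<and> fg_set (Ps i) (Xs i) \<and>
       Ps i \<subseteq> P \<and> ((Ps i, Xs i), (P, X)) \<in> smaller_node) \<and>
     (\<forall>i<n. \<forall>u\<in>P. act u ` Xs i \<subseteq> Xs (a u i)) \<and>
     (\<forall>i j. \<forall>u\<in>P. (i, j) \<in> ord \<longrightarrow> (a u i, a u j) \<in> ord)"

end

context splitting
begin

text \<open>\<open>D\<close> is one class, and every other class contains one of the finitely many
  representatives.\<close>

lemma ex_class_index:
  shows "\<exists>n (idx :: 's \<Rightarrow> nat). idx ` X = {..<n} \<and> (\<forall>s\<in>X. \<forall>t\<in>X. idx s = idx t \<longleftrightarrow> sim s t)"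
proof -
  define C where "C s = {t \<in> X. sim s t}" for s
  have C_eq: "C s = C t \<longleftrightarrow> sim s t" if "s \<in> X" "t \<in> X" for s t
  proof
    show "C s = C t \<Longrightarrow> sim s t" using that sim_refl sim_sym unfolding C_def by blast
    show "sim s t \<Longrightarrow> C s = C t" using that sim_trans sim_sym unfolding C_def by blast
  qed
  obtain W where W: "finite W" "W \<subseteq> X" "\<And>s. s \<in> X \<Longrightarrow> s \<in> D \<or> (\<exists>w\<in>W. \<exists>f\<in>F. s = act f w)"
    using finite_representatives by blast
  have "C s \<in> insert D (C ` W)" if s: "s \<in> X" for s
  proof (cases "s \<in> D")
    case True
    have "C s = D"
      unfolding C_def using True sim_D DX sim_in_D sim_sym by blast
    then show ?thesis by simp
  next
    case False
    then obtain w f where w: "w \<in> W" "f \<in> F" "s = act f w" using W(3) s by blast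
    then have "C s = C w" using C_eq sim_F W(2) s by blast
    then show ?thesis using w by simp
  qed
  then have fin: "finite (C ` X)" using W(1) by (meson finite.insertI finite_imageI finite_subset image_subsetI)
  then obtain h where h: "bij_betw h (C ` X) {0..<card (C ` X)}" using ex_bij_betw_finite_nat by blast
  have "(\<lambda>s. h (C s)) ` X = {..<card (C ` X)}"
    using h unfolding bij_betw_def by (simp add: image_image lessThan_atLeast0)
  moreover have "h (C s) = h (C t) \<longleftrightarrow> sim s t" if "s \<in> X" "t \<in> X" for s t
    using that C_eq h unfolding bij_betw_def by (metis imageI inj_onD)
  ultimately show ?thesis by blast
qed

text \<open>The children are the classes of \<open>sim\<close>, ordered by \<open>child_leq\<close>.
  The class \<open>D\<close> keeps the monoid \<open>P\<close>; every other class has stabiliser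
  \<open>F\<close>, a proper face because it is bad.\<close>

lemma ex_split:
  assumes ne: "X \<noteq> {}" and bad: "bad_face P X F"
  shows "\<exists>n Ps Xs ord a. is_split P X n Ps Xs ord a"
proof -
  obtain n and idx :: "'s \<Rightarrow> nat" where idx: "idx ` X = {..<n}"
    and "\<forall>s\<in>X. \<forall>t\<in>X. idx s = idx t \<longleftrightarrow> sim s t"
    using ex_class_index by (elim exE conjE)
  then have idx_eq: "\<And>s t. s \<in> X \<Longrightarrow> t \<in> X \<Longrightarrow> idx s = idx t \<longleftrightarrow> sim s t" by blast
  have idx_less: "s \<in> X \<Longrightarrow> idx s < n" for s using idx by blast
  define r where "r i = (SOME s. s \<in> X \<and> idx s = i)" for i
  have r: "r i \<in> X" "idx (r i) = i" if "i < n" for i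
  proof -
    have "\<exists>s. s \<in> X \<and> idx s = i" using idx that by (metis imageE lessThan_iff)
    then show "r i \<in> X" "idx (r i) = i" unfolding r_def by (metis (mono_tags, lifting) someI_ex)+
  qed
  have r_sim: "sim s (r (idx s))" if "s \<in> X" for s
    using that r idx_eq idx_less by metis
  have FneP: "F \<noteq> P" using bad unfolding bad_face_def by blast
  define Xs where "Xs i = {s \<in> X. idx s = i}" for i
  define Ps where "Ps i = (if r i \<in> D then P else F)" for i
  define ord where "ord = {(i, j). i < n \<and> j < n \<and> child_leq (r i) (r j)}"
  define a where "a u i = idx (act u (r i))" for u i
  have Xs_sim: "sim s (r i)" if "s \<in> Xs i" for s i using that r_sim unfolding Xs_def by blast
  have XsX: "s \<in> X" if "s \<in> Xs i" for s i using that unfolding Xs_def by blast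
  have XsD: "Xs i = D" if i: "i < n" "r i \<in> D" for i
  proof
    show "Xs i \<subseteq> D" using Xs_sim sim_in_D XsX i by blast
    show "D \<subseteq> Xs i"
    proof
      fix s assume s: "s \<in> D"
      then have "idx s = idx (r i)" using idx_eq[OF DX r(1)] sim_D i by simp
      then show "s \<in> Xs i" unfolding Xs_def using DX s r i by simp
    qed
  qed
  \<comment> \<open>Since \<open>sim\<close> is the symmetric part of \<open>child_leq\<close>, the
    order does not depend on the representatives \<open>r\<close>.\<close>
  have ord_iff: "(idx s, idx t) \<in> ord \<longleftrightarrow> child_leq s t" if st: "s \<in> X" "t \<in> X" for s t
  proof -
    have R: "r (idx s) \<in> X" "r (idx t) \<in> X" using r idx_less st by auto
    have "child_leq (r (idx s)) (r (idx t)) \<longleftrightarrow> child_leq s t"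
      using child_leq_trans[of "r (idx s)" s t] child_leq_trans[of "r (idx s)" t "r (idx t)"]
        child_leq_trans[of s "r (idx s)" "r (idx t)"] child_leq_trans[of s "r (idx t)" t]
        r_sim[OF st(1)] r_sim[OF st(2)] R st unfolding sim_def by blast
    then show ?thesis unfolding ord_def using idx_less st by simp
  qed
  have a_idx: "a u (idx s) = idx (act u s)" if "u \<in> P" "s \<in> X" for u s
    unfolding a_def using sim_act[OF r_sim[OF that(2)] that(1)] that idx_eq PX r idx_less by metis
  have idxE: "\<exists>s\<in>X. i = idx s" if "i < n" for i using that r by metis
  have a_mem: "a u i < n" if "u \<in> P" "i < n" for u i
    unfolding a_def using that r PX idx_less by blast
  have a_one: "a \<one> i = i" if "i < n" for i unfolding a_def using that r XS by (simp add: act_one)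
  have a_mult: "a (u \<otimes> v) i = a u (a v i)" if "u \<in> P" "v \<in> P" "i < n" for u v i
    using idxE[OF that(3)] that a_idx P_mult PX PP by auto
  have stab: "a u i = i \<longleftrightarrow> u \<in> Ps i" if u: "u \<in> P" "i < n" for u i
  proof -
    have "a u i = i \<longleftrightarrow> sim (act u (r i)) (r i)"
      using a_idx[OF u(1), of "r i"] r[OF u(2)] idx_eq PX u by metis
    also have "\<dots> \<longleftrightarrow> u \<in> Ps i"
    proof (cases "r i \<in> D")
      case True
      then show ?thesis unfolding Ps_def using sim_D PD u by simp
    next
      case False
      then show ?thesis unfolding Ps_def using sim_stabiliser[OF u(1) r(1)[OF u(2)]] sim_F r(1)[OF u(2)] by auto
    qed
    finally show ?thesis .
  qed
  have "good_action (M\<lparr>carrier := P\<rparr>) a {..<n}"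
  proof (intro good_action.intro monoid_set.intro monoid_set_axioms.intro good_action_axioms.intro
      submonoid_comm_monoid P)
    fix u v i assume u: "u \<in> carrier (M\<lparr>carrier := P\<rparr>)" "v \<in> carrier (M\<lparr>carrier := P\<rparr>)" and i: "i \<in> {..<n}"
      and "a (u \<otimes>\<^bsub>M\<lparr>carrier := P\<rparr>\<^esub> v) i = i"
    then have "u \<otimes> v \<in> Ps i" using stab P_mult by simp
    \<comment> \<open>Both possible stabilisers, \<open>P\<close> and \<open>F\<close>, are faces of
      \<open>P\<close>; this is the goodness of the action.\<close>
    then have "u \<in> Ps i \<and> v \<in> Ps i" using face u unfolding Ps_def face_def by (simp split: if_splits)
    then show "a u i = i \<and> a v i = i" using stab u i by simp
  qed (use a_mem a_one a_mult in auto)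
  moreover have "X = (\<Union>i<n. Xs i)" unfolding Xs_def using idx_less by auto
  moreover have "disjoint_family_on Xs {..<n}" unfolding disjoint_family_on_def Xs_def by auto
  moreover have "0 < n" using ne idx_less by (metis ex_in_conv gr_zeroI less_nat_zero_code)
  moreover have "partial_order_on {..<n} ord"
    unfolding partial_order_on_def preorder_on_def
  proof (intro conjI)
    show "ord \<subseteq> {..<n} \<times> {..<n}" unfolding ord_def by auto
    show "refl_on {..<n} ord" unfolding ord_def using child_leq_refl r by (auto intro!: refl_onI)
    show "trans ord" unfolding ord_def using child_leq_trans r by (auto intro!: transI)
    show "antisym ord"
    proof (rule antisymI)
      fix i j assume "(i, j) \<in> ord" "(j, i) \<in> ord"
      then have ij: "i < n" "j < n" "sim (r i) (r j)" unfolding ord_def sim_def by auto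
      then show "i = j" using idx_eq r by metis
    qed
  qed
  moreover have "(i, j) \<in> ord \<or> (j, i) \<in> ord"
    if "s \<in> Xs i" "t \<in> Xs j" "eqv P s t" for i j s t
    using that child_leq_comparable ord_iff unfolding Xs_def by blast
  moreover have "(i, j) \<in> ord \<longleftrightarrow> (s, t) \<in> R"
    if "s \<in> Xs i" "t \<in> Xs j" "eqv P s t" "i \<noteq> j" for i j s t
    using that child_leq_iff_R[of s t] ord_iff[of s t] idx_eq[of s t] unfolding Xs_def by auto
  moreover have "stabilizer (M\<lparr>carrier := P\<rparr>) a i = Ps i" if "i < n" for i
    unfolding stabilizer_def using stab that FP unfolding Ps_def by (auto split: if_splits)
  moreover have "fg_submonoid (Ps i) M" "Ps i \<subseteq> P" for i
    unfolding Ps_def using fgP fg_submonoid_face[OF fgP face] F by auto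
  moreover have "fg_set (Ps i) (Xs i)" if i: "i < n" for i
  proof (cases "r i \<in> D")
    case True
    have "fg_set P D"
      by (rule fg_set_stable_subset[OF fgP fgX]) (use DX PD in \<open>auto simp: stable_def\<close>)
    then show ?thesis using True XsD i unfolding Ps_def by simp
  next
    case False
    obtain W where W: "finite W" "W \<subseteq> X" "\<And>s. s \<in> X \<Longrightarrow> s \<in> D \<or> (\<exists>w\<in>W. \<exists>f\<in>F. s = act f w)"
      using finite_representatives by blast
    have in1: "act f s \<in> Xs i" if "f \<in> F" "s \<in> Xs i" for f s
      using that sim_F idx_eq PX FP unfolding Xs_def by (metis (no_types, lifting) mem_Collect_eq)
    have "\<exists>w\<in>W \<inter> Xs i. \<exists>f\<in>F. s = act f w" if s: "s \<in> Xs i" for s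
    proof -
      have "s \<notin> D" using sim_in_D[OF sim_sym[OF Xs_sim[OF s]]] r i False by blast
      then obtain w f where w: "w \<in> W" "f \<in> F" "s = act f w" using W(3) XsX s by blast
      then have "idx w = idx s" using sim_F idx_eq W(2) XsX s by (metis subsetD)
      then have "w \<in> Xs i" using w s W(2) unfolding Xs_def by auto
      then show ?thesis using w by blast
    qed
    then have "Xs i = (\<Union>w\<in>W \<inter> Xs i. (\<lambda>f. act f w) ` F)" using in1 by blast
    then show ?thesis
      unfolding fg_set_def Ps_def using False W(1) XsX XS by (auto intro!: exI[of _ "W \<inter> Xs i"])
  qed
  moreover have "((Ps i, Xs i), (P, X)) \<in> smaller_node" if i: "i < n" for i
  proof (cases "r i \<in> D")
    case True
    \<comment> \<open>The child \<open>D\<close> keeps the monoid and so the number of faces, but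
      \<open>F\<close> is no longer bad on it.\<close>
    have "{G. bad_face P D G} \<subset> {G. bad_face P X G}"
    proof
      show "{G. bad_face P D G} \<subseteq> {G. bad_face P X G}" using bad_face_subset DX by blast
      have "\<not> bad_face P D F" unfolding bad_face_def using Deq by blast
      then show "{G. bad_face P D G} \<noteq> {G. bad_face P X G}" using bad by blast
    qed
    moreover have "finite {G. bad_face P X G}"
      using finite_faces[OF fgP] by (rule finite_subset[rotated]) (auto simp: bad_face_def)
    ultimately have "card {G. bad_face P D G} < card {G. bad_face P X G}" by (simp add: psubset_card_mono)
    then show ?thesis using True XsD i unfolding Ps_def smaller_node_def by simp
  next
    case False
    \<comment> \<open>Faces of \<open>F\<close> are faces of \<open>P\<close>, and the face
      \<open>P\<close> itself is lost.\<close>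
    have "{G. face G F} \<subset> {G. face G P}"
    proof
      show "{G. face G F} \<subseteq> {G. face G P}" using face_trans[OF face] by blast
      have "\<not> face P F" using F FneP unfolding face_def by blast
      then show "{G. face G F} \<noteq> {G. face G P}" using face_self[OF P] by blast
    qed
    then have "card {G. face G F} < card {G. face G P}"
      using finite_faces[OF fgP] by (simp add: psubset_card_mono)
    then show ?thesis using False unfolding Ps_def smaller_node_def by simp
  qed
  moreover have "act u ` Xs i \<subseteq> Xs (a u i)" if "u \<in> P" for u i
    unfolding Xs_def using a_idx that PX by auto
  moreover have "(a u i, a u j) \<in> ord" if "u \<in> P" "(i, j) \<in> ord" for u i j
  proof -
    have "i < n" "j < n" "child_leq (r i) (r j)" using that(2) unfolding ord_def by auto
    then have "child_leq (act u (r i)) (act u (r j))" using child_leq_act that(1) r by simp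
    then show ?thesis
      unfolding a_def using ord_iff[OF PX PX] that(1) r(1)[OF \<open>i < n\<close>] r(1)[OF \<open>j < n\<close>] by simp
  qed
  ultimately have "is_split P X n Ps Xs ord a" unfolding is_split_def by simp
  then show ?thesis by blast
qed

end

text \<open>A pair violating the leaf condition yields a bad face, and as the faces are finite in
  number there is a maximal bad one to split along.\<close>

lemma (in preordered_monoid_set) node_split:
  assumes fgP: "fg_submonoid P M" and fgX: "fg_set P X"
    and st: "s \<in> X" "t \<in> X" "eqv P s t" "(s, t) \<notin> R"
  shows "\<exists>n Ps Xs ord a. is_split P X n Ps Xs ord a"
proof -
  have P: "submonoid P M" using fgP unfolding fg_submonoid_def by blast
  have XS: "X \<subseteq> S" using fgX unfolding fg_set_def by blast
  have fin: "finite {F. bad_face P X F}"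
    using finite_faces[OF fgP] by (rule finite_subset[rotated]) (auto simp: bad_face_def)
  moreover have "{F. bad_face P X F} \<noteq> {}" using ex_bad_face[OF P XS st] by blast
  ultimately obtain F where bad: "F \<in> {F. bad_face P X F}"
    and max: "\<And>G. G \<in> {F. bad_face P X F} \<Longrightarrow> F \<subseteq> G \<Longrightarrow> G = F"
    using finite_has_maximal by metis
  obtain D where D: "admissible P X F D" "\<And>E. admissible P X F E \<Longrightarrow> D \<subseteq> E \<Longrightarrow> E = D"
    using ex_maximal_admissible[OF fgP fgX] by blast
  interpret splitting M act S R P X F D
  proof
    show "face F P" using bad unfolding bad_face_def by blast
    show "\<not> bad_face P X G" if "face G P" "F \<subset> G" for G using max[of G] that by blast
  qed (use fgP fgX D in auto)
  show ?thesis using ex_split bad st(1) by blast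
qed

section \<open>Finite trees on the natural numbers from a terminating branching rule\<close>

section \<open>Unfolding a splitting function into a tree\<close>

text \<open>Vertices are numbers: 0 is the root, and every other number encodes exactly one parent
  together with a child index. Uniqueness of parents is thus built in.\<close>

definition child_node :: "nat \<Rightarrow> nat \<Rightarrow> nat" where
  "child_node x i = Suc (prod_encode (i, x))"

definition child_index :: "nat \<Rightarrow> nat" where
  "child_index y = fst (prod_decode (y - 1))"

lemma child_index_child_node [simp]: "child_index (child_node x i) = i"
  unfolding child_index_def child_node_def by simp

lemma child_node_eq_iff [simp]: "child_node x i = child_node y j \<longleftrightarrow> x = y \<and> i = j"
  unfolding child_node_def by auto

lemma child_node_nonzero [simp]: "child_node x i \<noteq> 0" "0 \<noteq> child_node x i"
  unfolding child_node_def by auto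

function node_state :: "(nat \<Rightarrow> 'a \<Rightarrow> 'a) \<Rightarrow> 'a \<Rightarrow> nat \<Rightarrow> 'a" where
  "node_state c r 0 = r"
| "node_state c r (Suc k) = c (fst (prod_decode k)) (node_state c r (snd (prod_decode k)))"
  by pat_completeness auto
termination
proof (relation "measure (\<lambda>(c, r, k). k)")
  show "((c, r, snd (prod_decode k)), (c, r, Suc k)) \<in> measure (\<lambda>(c, r, k). k)" for c r k
    \<comment> \<open>A parent has a smaller number than its child, thanks to the \<open>Suc\<close>
      in \<open>child_node\<close>.\<close>
    using le_prod_encode_2[of "snd (prod_decode k)" "fst (prod_decode k)"] by simp
qed simp

lemma node_state_child [simp]: "node_state c r (child_node x i) = c i (node_state c r x)"
  unfolding child_node_def by simp

definition unfold_edges :: "('a \<Rightarrow> nat) \<Rightarrow> (nat \<Rightarrow> 'a \<Rightarrow> 'a) \<Rightarrow> 'a \<Rightarrow> nat rel" where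
  "unfold_edges w c r = {(x, child_node x i) |x i. i < w (node_state c r x)}"

definition unfold_verts :: "('a \<Rightarrow> nat) \<Rightarrow> (nat \<Rightarrow> 'a \<Rightarrow> 'a) \<Rightarrow> 'a \<Rightarrow> nat set" where
  "unfold_verts w c r = (unfold_edges w c r)\<^sup>* `` {0}"

lemma unfold_good:
  assumes good: "Q r" "\<And>s i. Q s \<Longrightarrow> i < w s \<Longrightarrow> Q (c i s)" and x: "x \<in> unfold_verts w c r"
  shows "Q (node_state c r x)"
proof -
  have "(0, x) \<in> (unfold_edges w c r)\<^sup>*" using x unfolding unfold_verts_def by simp
  then show ?thesis
  proof (induction rule: rtrancl_induct)
    case base
    show ?case using good by simp
  next
    case (step y z)
    then show ?case using good unfolding unfold_edges_def by auto
  qed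
qed

lemma unfold_child:
  "x \<in> unfold_verts w c r \<Longrightarrow> i < w (node_state c r x) \<Longrightarrow> child_node x i \<in> unfold_verts w c r"
  unfolding unfold_verts_def unfold_edges_def by (auto intro: rtrancl_into_rtrancl)

text \<open>Each vertex has finitely many children and states decrease along edges, so well-founded
  induction on the state shows that finitely many vertices lie below each one.\<close>

lemma unfold_rooted_tree:
  assumes wf: "wf rel" and good: "Q r" "\<And>s i. Q s \<Longrightarrow> i < w s \<Longrightarrow> Q (c i s)"
    and dec: "\<And>s i. Q s \<Longrightarrow> i < w s \<Longrightarrow> (c i s, s) \<in> rel"
  shows "rooted_tree (unfold_verts w c r) {(x, y) \<in> unfold_edges w c r. x \<in> unfold_verts w c r} 0"
    (is "rooted_tree ?V ?E 0")
proof
  let ?U = "unfold_edges w c r"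
  have fin: "finite (?U\<^sup>* `` {x})" if "Q s" "s = node_state c r x" for s x
    using wf that
  proof (induction s arbitrary: x rule: wf_induct_rule)
    case (less s)
    have "?U\<^sup>* `` {x} = insert x (\<Union>i<w s. ?U\<^sup>* `` {child_node x i})"
    proof
      have "y = x \<or> (\<exists>i<w s. (child_node x i, y) \<in> ?U\<^sup>*)" if "(x, y) \<in> ?U\<^sup>*" for y
        using that by (rule converse_rtranclE) (auto simp: unfold_edges_def less)
      then show "?U\<^sup>* `` {x} \<subseteq> insert x (\<Union>i<w s. ?U\<^sup>* `` {child_node x i})" by auto
      have "(x, child_node x i) \<in> ?U" if "i < w s" for i
        using that less.prems unfolding unfold_edges_def by blast
      then show "insert x (\<Union>i<w s. ?U\<^sup>* `` {child_node x i}) \<subseteq> ?U\<^sup>* `` {x}"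
        by (auto intro: converse_rtrancl_into_rtrancl)
    qed
    moreover have "finite (?U\<^sup>* `` {child_node x i})" if "i < w s" for i
      using less.IH[OF dec good(2)] less.prems that by simp
    ultimately show ?case by simp
  qed
  show "finite ?V" unfolding unfold_verts_def using fin[OF good(1)] by simp
  show "0 \<in> ?V" unfolding unfold_verts_def by simp
  show "?E \<subseteq> ?V \<times> ?V" using unfold_child unfolding unfold_edges_def by fast
  show "(x, 0) \<notin> ?E" for x unfolding unfold_edges_def by auto
  have reach: "(0, x) \<in> ?E\<^sup>*" if "x \<in> ?V" for x
  proof -
    have "(0, x) \<in> ?U\<^sup>*" using that unfolding unfold_verts_def by simp
    then show ?thesis
    proof (induction rule: rtrancl_induct)
      case (step y z)
      then have "(y, z) \<in> ?E" unfolding unfold_verts_def by auto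
      with step(3) show ?case by (rule rtrancl_into_rtrancl)
    qed simp
  qed
  show "x \<in> ?V \<Longrightarrow> (0, x) \<in> ?E\<^sup>*" for x by (rule reach)
  show "\<exists>!p. (p, x) \<in> ?E" if x0: "x \<in> ?V - {0}" for x
  proof -
    have "(0, x) \<in> ?E\<^sup>*" using reach x0 by blast
    then obtain p where "(p, x) \<in> ?E" using x0 by (auto elim: rtranclE)
    moreover have "q = p" if "(p, x) \<in> ?E" "(q, x) \<in> ?E" for p q
      using that unfolding unfold_edges_def by auto
    ultimately show ?thesis by blast
  qed
qed

lemma partial_order_on_image:
  assumes "partial_order_on A r" "inj f"
  shows "partial_order_on (f ` A) {(f i, f j) |i j. (i, j) \<in> r}"
proof -
  have r: "r \<subseteq> A \<times> A" "refl_on A r" "trans r" "antisym r"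
    using assms(1) unfolding partial_order_on_def preorder_on_def by auto
  show ?thesis
    unfolding partial_order_on_def preorder_on_def
  proof (intro conjI)
    show "{(f i, f j) |i j. (i, j) \<in> r} \<subseteq> f ` A \<times> f ` A" using r(1) by auto
    show "refl_on (f ` A) {(f i, f j) |i j. (i, j) \<in> r}" using r(2) unfolding refl_on_def by blast
    show "trans {(f i, f j) |i j. (i, j) \<in> r}"
      by (rule transI) (use r(3) assms(2) in \<open>auto dest: transD injD\<close>)
    show "antisym {(f i, f j) |i j. (i, j) \<in> r}"
      by (rule antisymI) (use r(4) assms(2) in \<open>auto dest: antisymD injD\<close>)
  qed
qed

lemma good_action_image:
  assumes "good_action N a A" "\<And>i. g (f i) = i"
  shows "good_action N (\<lambda>u y. f (a u (g y))) (f ` A)"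
proof -
  interpret good_action N a A by (rule assms(1))
  show ?thesis
  proof (intro good_action.intro monoid_set.intro monoid_set_axioms.intro good_action_axioms.intro)
    show "comm_monoid N" by (rule comm_monoid_axioms)
    fix x assume "x \<in> f ` A"
    then obtain i where i: "i \<in> A" "x = f i" by blast
    show "f (a \<one>\<^bsub>N\<^esub> (g x)) = x" using i act_one assms(2) by simp
    fix u assume u: "u \<in> carrier N"
    show "f (a u (g x)) \<in> f ` A" using i u act_closed assms(2) by simp
    fix v assume v: "v \<in> carrier N"
    show "f (a (u \<otimes>\<^bsub>N\<^esub> v) (g x)) = f (a u (g (f (a v (g x)))))" using i u v act_mult assms(2) by simp
    assume "f (a (u \<otimes>\<^bsub>N\<^esub> v) (g x)) = x"
    then have "g (f (a (u \<otimes>\<^bsub>N\<^esub> v) i)) = g (f i)" using i assms(2) by simp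
    then have "a (u \<otimes>\<^bsub>N\<^esub> v) i = i" using assms(2) by simp
    then show "f (a u (g x)) = x \<and> f (a v (g x)) = x" using good[OF u v i(1)] i assms(2) by simp
  qed
qed

section \<open>The vertices and their localised preorders\<close>

section \<open>The partree of a preorder\<close>

lemma (in preordered_monoid_set) is_splitD:
  assumes "is_split P X n Ps Xs ord a"
  shows "0 < n" "X = (\<Union>i<n. Xs i)" "disjoint_family_on Xs {..<n}" "partial_order_on {..<n} ord"
    and "good_action (M\<lparr>carrier := P\<rparr>) a {..<n}"
    and "\<And>i j s t. \<lbrakk>i < n; j < n; s \<in> Xs i; t \<in> Xs j; eqv P s t\<rbrakk> \<Longrightarrow> (i, j) \<in> ord \<or> (j, i) \<in> ord"
    and "\<And>i j s t. \<lbrakk>i < n; j < n; s \<in> Xs i; t \<in> Xs j; eqv P s t; i \<noteq> j\<rbrakk> \<Longrightarrow> (i, j) \<in> ord \<longleftrightarrow> (s, t) \<in> R"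
    and "\<And>i. i < n \<Longrightarrow> stabilizer (M\<lparr>carrier := P\<rparr>) a i = Ps i"
    and "\<And>i. i < n \<Longrightarrow> fg_submonoid (Ps i) M" "\<And>i. i < n \<Longrightarrow> fg_set (Ps i) (Xs i)"
    and "\<And>i. i < n \<Longrightarrow> Ps i \<subseteq> P" "\<And>i. i < n \<Longrightarrow> ((Ps i, Xs i), (P, X)) \<in> smaller_node"
    and "\<And>i u. \<lbrakk>i < n; u \<in> P\<rbrakk> \<Longrightarrow> act u ` Xs i \<subseteq> Xs (a u i)"
    and "\<And>i j u. \<lbrakk>(i, j) \<in> ord; u \<in> P\<rbrakk> \<Longrightarrow> (a u i, a u j) \<in> ord"
proof -
  note * = assms[unfolded is_split_def]
  show "0 < n" using * by (elim conjE)
  show "X = (\<Union>i<n. Xs i)" using * by (elim conjE)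
  show "disjoint_family_on Xs {..<n}" using * by (elim conjE)
  show "partial_order_on {..<n} ord" using * by (elim conjE)
  show "good_action (M\<lparr>carrier := P\<rparr>) a {..<n}" using * by (elim conjE)
  have c1: "\<forall>i<n. \<forall>j<n. \<forall>s\<in>Xs i. \<forall>t\<in>Xs j. eqv P s t \<longrightarrow> (i, j) \<in> ord \<or> (j, i) \<in> ord"
    using * by (elim conjE)
  have c2: "\<forall>i<n. \<forall>j<n. \<forall>s\<in>Xs i. \<forall>t\<in>Xs j. eqv P s t \<longrightarrow> i \<noteq> j \<longrightarrow> (i, j) \<in> ord \<longleftrightarrow> (s, t) \<in> R"
    using * by (elim conjE)
  have c3: "\<forall>i<n. stabilizer (M\<lparr>carrier := P\<rparr>) a i = Ps i \<and> fg_submonoid (Ps i) M \<and> fg_set (Ps i) (Xs i) \<and>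
      Ps i \<subseteq> P \<and> ((Ps i, Xs i), (P, X)) \<in> smaller_node"
    using * by (elim conjE)
  have c4: "\<forall>i<n. \<forall>u\<in>P. act u ` Xs i \<subseteq> Xs (a u i)"
    using * by (elim conjE)
  show "(i, j) \<in> ord \<or> (j, i) \<in> ord"
    if "i < n" "j < n" "s \<in> Xs i" "t \<in> Xs j" "eqv P s t" for i j s t using c1 that by blast
  show "(i, j) \<in> ord \<longleftrightarrow> (s, t) \<in> R"
    if "i < n" "j < n" "s \<in> Xs i" "t \<in> Xs j" "eqv P s t" "i \<noteq> j" for i j s t using c2 that by blast
  fix i assume i: "i < n"
  show "stabilizer (M\<lparr>carrier := P\<rparr>) a i = Ps i" "fg_submonoid (Ps i) M" "fg_set (Ps i) (Xs i)"
    "Ps i \<subseteq> P" "((Ps i, Xs i), (P, X)) \<in> smaller_node" using c3 i by blast+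
  show "act u ` Xs i \<subseteq> Xs (a u i)" if "u \<in> P" for u using c4 i that by blast
next
  have "\<forall>i j. \<forall>u\<in>P. (i, j) \<in> ord \<longrightarrow> (a u i, a u j) \<in> ord"
    using assms unfolding is_split_def by (elim conjE)
  then show "(a u i, a u j) \<in> ord" if "(i, j) \<in> ord" "u \<in> P" for i j u using that by blast
qed

text \<open>A splitting is fixed for every conceivable node before the tree is unfolded; arity 0
  marks a leaf.\<close>

locale split_tree = preordered_monoid_set M act S R
  for M :: "('m, 'b) monoid_scheme" (structure) and act :: "'m \<Rightarrow> 's \<Rightarrow> 's" and S :: "'s set"
    and R :: "'s rel" +
  fixes arity :: "'m set \<times> 's set \<Rightarrow> nat" and branch :: "nat \<Rightarrow> 'm set \<times> 's set \<Rightarrow> 'm set \<times> 's set"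
    and ord :: "'m set \<times> 's set \<Rightarrow> nat rel" and index_act :: "'m set \<times> 's set \<Rightarrow> 'm \<Rightarrow> nat \<Rightarrow> nat"
  assumes fgM: "fg_submonoid (carrier M) M" and fgS: "fg_set (carrier M) S"
    and leaf: "\<And>\<sigma>. \<lbrakk>fg_submonoid (fst \<sigma>) M; fg_set (fst \<sigma>) (snd \<sigma>); arity \<sigma> = 0\<rbrakk>
      \<Longrightarrow> ord \<sigma> = {} \<and> (\<forall>s\<in>snd \<sigma>. \<forall>t\<in>snd \<sigma>. eqv (fst \<sigma>) s t \<longrightarrow> (s, t) \<in> R)"
    and split: "\<And>\<sigma>. \<lbrakk>fg_submonoid (fst \<sigma>) M; fg_set (fst \<sigma>) (snd \<sigma>); arity \<sigma> \<noteq> 0\<rbrakk>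
      \<Longrightarrow> is_split (fst \<sigma>) (snd \<sigma>) (arity \<sigma>) (\<lambda>i. fst (branch i \<sigma>)) (\<lambda>i. snd (branch i \<sigma>)) (ord \<sigma>) (index_act \<sigma>)"
begin

definition node :: "nat \<Rightarrow> 'm set \<times> 's set" where
  "node = node_state branch (carrier M, S)"

text \<open>The preorder at a vertex is \<open>R\<close> localised at the monoid of that vertex, so
  it becomes finer towards the leaves.\<close>

definition tree :: "(nat, 's, 'm) monoid_partree" where
  "tree = \<lparr>verts = unfold_verts arity branch (carrier M, S),
     edges = {(x, y) \<in> unfold_edges arity branch (carrier M, S). x \<in> unfold_verts arity branch (carrier M, S)},
     root = 0, lab = (\<lambda>x. snd (node x)),
     child_le = (\<lambda>x. {(child_node x i, child_node x j) |i j. (i, j) \<in> ord (node x)}),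
     le_at = (\<lambda>x. {(s, t). s \<in> snd (node x) \<and> t \<in> snd (node x) \<and> loc (fst (node x)) s t}),
     mon = (\<lambda>x. fst (node x)),
     child_act = (\<lambda>x u y. child_node x (index_act (node x) u (child_index y)))\<rparr>"

lemma tree_simps [simp]:
  "root tree = 0" "lab tree x = snd (node x)" "mon tree x = fst (node x)"
  "child_le tree x = {(child_node x i, child_node x j) |i j. (i, j) \<in> ord (node x)}"
  "le_at tree x = {(s, t). s \<in> snd (node x) \<and> t \<in> snd (node x) \<and> loc (fst (node x)) s t}"
  "child_act tree x u y = child_node x (index_act (node x) u (child_index y))"
  unfolding tree_def by simp_all

lemma node_0 [simp]: "node 0 = (carrier M, S)"
  unfolding node_def by simp

lemma node_child [simp]: "node (child_node x i) = branch i (node x)"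
  unfolding node_def by simp

lemma children_tree: "x \<in> verts tree \<Longrightarrow> children tree x = child_node x ` {..<arity (node x)}"
  unfolding children_def tree_def unfold_edges_def node_def by auto

lemma is_leaf_tree: "x \<in> verts tree \<Longrightarrow> is_leaf tree x \<longleftrightarrow> arity (node x) = 0"
  unfolding is_leaf_def using children_tree by auto

definition good_node :: "'m set \<times> 's set \<Rightarrow> bool" where
  "good_node \<sigma> \<longleftrightarrow> fg_submonoid (fst \<sigma>) M \<and> fg_set (fst \<sigma>) (snd \<sigma>)"

lemma good_root: "good_node (carrier M, S)"
  unfolding good_node_def using fgM fgS by simp

lemma good_branch:
  assumes "good_node \<sigma>" "i < arity \<sigma>"
  shows "good_node (branch i \<sigma>)" "(branch i \<sigma>, \<sigma>) \<in> smaller_node"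
proof -
  have sp: "is_split (fst \<sigma>) (snd \<sigma>) (arity \<sigma>) (\<lambda>i. fst (branch i \<sigma>)) (\<lambda>i. snd (branch i \<sigma>)) (ord \<sigma>) (index_act \<sigma>)"
    by (rule split) (use assms in \<open>simp_all add: good_node_def\<close>)
  show "good_node (branch i \<sigma>)"
    unfolding good_node_def using is_splitD(9)[OF sp assms(2)] is_splitD(10)[OF sp assms(2)] by simp
  show "(branch i \<sigma>, \<sigma>) \<in> smaller_node" using is_splitD(12)[OF sp assms(2)] by simp
qed

lemma good_vertex: "x \<in> verts tree \<Longrightarrow> good_node (node x)"
  using unfold_good[of good_node "(carrier M, S)" arity branch x] good_root good_branch(1)
  unfolding tree_def node_def by simp

lemma wf_smaller_node: "wf smaller_node"
  unfolding smaller_node_def by simp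

lemma rooted_tree_tree: "rooted_tree (verts tree) (edges tree) (root tree)"
  unfolding tree_def
  using unfold_rooted_tree[of smaller_node good_node "(carrier M, S)" arity branch]
    wf_smaller_node good_root good_branch by simp

context
  fixes x assumes x: "x \<in> verts tree"
begin

lemma vertex_fg: "fg_submonoid (fst (node x)) M" "fg_set (fst (node x)) (snd (node x))"
  using good_vertex[OF x] unfolding good_node_def by auto

lemma vertex_submonoid: "submonoid (fst (node x)) M"
  using vertex_fg(1) unfolding fg_submonoid_def by blast

lemma vertex_subset: "s \<in> snd (node x) \<Longrightarrow> s \<in> S"
  using vertex_fg(2) unfolding fg_set_def by blast

lemma vertex_stable: "u \<in> fst (node x) \<Longrightarrow> s \<in> snd (node x) \<Longrightarrow> act u s \<in> snd (node x)"
  using fg_set_stable[OF vertex_submonoid vertex_fg(2)] unfolding stable_def by blast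

lemma vertex_split:
  assumes "arity (node x) \<noteq> 0"
  shows "is_split (fst (node x)) (snd (node x)) (arity (node x)) (\<lambda>i. fst (branch i (node x)))
    (\<lambda>i. snd (branch i (node x))) (ord (node x)) (index_act (node x))"
  using split vertex_fg assms by blast

lemma vertex_preorder:
  "monoid_set_preorder (M\<lparr>carrier := fst (node x)\<rparr>) act (snd (node x)) (le_at tree x)"
  unfolding monoid_set_preorder_def total_preorder_on_def preorder_on_def
proof (intro conjI ballI allI impI)
  show "le_at tree x \<subseteq> snd (node x) \<times> snd (node x)" by auto
  show "refl_on (snd (node x)) (le_at tree x)"
    using loc_refl[OF vertex_submonoid] vertex_subset by (auto intro!: refl_onI)
  show "trans (le_at tree x)"
    by (rule transI) (use loc_trans[OF vertex_submonoid] vertex_subset in auto)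
  show "total_on (snd (node x)) (le_at tree x)"
    by (rule total_onI) (use loc_total[OF vertex_submonoid] vertex_subset in auto)
  show "(act u s, act u t) \<in> le_at tree x"
    if "u \<in> carrier (M\<lparr>carrier := fst (node x)\<rparr>)" "(s, t) \<in> le_at tree x" for u s t
    using that loc_act[OF vertex_submonoid] vertex_subset vertex_stable in_carrier[OF vertex_submonoid]
    by auto
qed

lemma po_equiv_tree:
  "po_equiv (le_at tree x) s t \<longleftrightarrow> s \<in> snd (node x) \<and> t \<in> snd (node x) \<and> eqv (fst (node x)) s t"
  unfolding po_equiv_def eqv_def by auto

end

lemma partree_on_tree: "partree_on S tree"
proof (intro partree_on.intro)
  show "rooted_tree (verts tree) (edges tree) (root tree)" by (rule rooted_tree_tree)
  show "lab tree (root tree) = S" by simp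
  fix x assume x: "x \<in> verts tree"
  show "lab tree x \<subseteq> S" using vertex_subset[OF x] by auto
  show "total_preorder_on (lab tree x) (le_at tree x)"
    using vertex_preorder[OF x] unfolding monoid_set_preorder_def by simp
  show "partial_order_on (children tree x) (child_le tree x)"
  proof (cases "arity (node x) = 0")
    case True
    then show ?thesis using leaf vertex_fg[OF x] children_tree[OF x] by simp
  next
    case False
    have "partial_order_on {..<arity (node x)} (ord (node x))"
      by (rule is_splitD(4)[OF vertex_split[OF x False]])
    moreover have "inj (child_node x)" by (rule injI) simp
    ultimately show ?thesis
      unfolding children_tree[OF x] tree_simps(4) by (rule partial_order_on_image)
  qed
  show "disjoint_family_on (lab tree) (children tree x)"
  proof (cases "arity (node x) = 0")
    case True
    then show ?thesis using children_tree[OF x] by (simp add: disjoint_family_on_def)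
  next
    case False
    have "disjoint_family_on (\<lambda>i. snd (branch i (node x))) {..<arity (node x)}"
      by (rule is_splitD(3)[OF vertex_split[OF x False]])
    then show ?thesis unfolding children_tree[OF x] disjoint_family_on_def by auto
  qed
  show "lab tree x = (\<Union>y\<in>children tree x. lab tree y)" if "\<not> is_leaf tree x"
  proof -
    have "arity (node x) \<noteq> 0" using that is_leaf_tree[OF x] by simp
    from is_splitD(2)[OF vertex_split[OF x this]] show ?thesis unfolding children_tree[OF x] by simp
  qed
  fix s t y z
  assume *: "s \<in> lab tree x" "t \<in> lab tree x" "po_equiv (le_at tree x) s t"
    "y \<in> children tree x" "z \<in> children tree x" "s \<in> lab tree y" "t \<in> lab tree z"
  then obtain i j where ij: "i < arity (node x)" "j < arity (node x)" "y = child_node x i" "z = child_node x j"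
    using children_tree[OF x] by auto
  then have ne: "arity (node x) \<noteq> 0" by simp
  have "eqv (fst (node x)) s t" using *(3) po_equiv_tree[OF x] by blast
  then have "(i, j) \<in> ord (node x) \<or> (j, i) \<in> ord (node x)"
    using is_splitD(6)[OF vertex_split[OF x ne] ij(1,2)] *(6,7) ij(3,4) by simp
  then show "(y, z) \<in> child_le tree x \<or> (z, y) \<in> child_le tree x" using ij by auto
qed

lemma monoid_partree_on_tree: "monoid_partree_on M act S tree"
proof (intro monoid_partree_on.intro monoid_partree_on_axioms.intro partree_on_tree)
  show "mon tree (root tree) = carrier M" by simp
  fix x assume x: "x \<in> verts tree"
  let ?P = "fst (node x)" and ?X = "snd (node x)"
  show "fg_submonoid (mon tree x) M" using vertex_fg[OF x] by simp
  show "fg_monoid_set (M\<lparr>carrier := mon tree x\<rparr>) act (lab tree x)"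
    using fg_set_fg_monoid_set[OF vertex_submonoid[OF x] vertex_fg(2)[OF x]] by simp
  show "good_action (M\<lparr>carrier := mon tree x\<rparr>) (child_act tree x) (children tree x)"
  proof (cases "arity (node x) = 0")
    case True
    then show ?thesis
      using children_tree[OF x] submonoid_comm_monoid[OF vertex_submonoid[OF x]]
      by (auto intro!: good_action.intro monoid_set.intro monoid_set_axioms.intro good_action_axioms.intro)
  next
    case False
    have "good_action (M\<lparr>carrier := ?P\<rparr>) (index_act (node x)) {..<arity (node x)}"
      by (rule is_splitD(5)[OF vertex_split[OF x False]])
    from good_action_image[OF this, of child_index "child_node x"]
    have "good_action (M\<lparr>carrier := ?P\<rparr>)
        (\<lambda>u y. child_node x (index_act (node x) u (child_index y))) (children tree x)"
      unfolding children_tree[OF x] by simp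
    moreover have "child_act tree x = (\<lambda>u y. child_node x (index_act (node x) u (child_index y)))"
      by (intro ext) simp
    ultimately show ?thesis by simp
  qed
  have stb: "stable ?P ?X" by (rule fg_set_stable[OF vertex_submonoid[OF x] vertex_fg(2)[OF x]])
  have "monoid_set (M\<lparr>carrier := ?P\<rparr>) act ?X"
    by (rule sub_monoid_set[OF vertex_submonoid[OF x] _ stb]) (use vertex_subset[OF x] in blast)
  then have "\<exists>q. monoid_set_preorder (gr_monoid (M\<lparr>carrier := ?P\<rparr>))
      (gr_act (M\<lparr>carrier := ?P\<rparr>) act ?X) (gr_set (M\<lparr>carrier := ?P\<rparr>) act ?X) q \<and>
    le_at tree x = pullback_rel ?X (gr_map (M\<lparr>carrier := ?P\<rparr>) act ?X) q"
    using vertex_preorder[OF x]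
  proof (rule monoid_set.cancellative_preorder_pullback)
    fix u s t assume "u \<in> carrier (M\<lparr>carrier := ?P\<rparr>)" "s \<in> ?X" "t \<in> ?X" "(act u s, act u t) \<in> le_at tree x"
    then show "(s, t) \<in> le_at tree x"
      using loc_cancel[OF vertex_submonoid[OF x], of u s t] vertex_subset[OF x] by simp
  qed
  then show "\<exists>q. monoid_set_preorder (gr_monoid (M\<lparr>carrier := mon tree x\<rparr>))
      (gr_act (M\<lparr>carrier := mon tree x\<rparr>) act (lab tree x)) (gr_set (M\<lparr>carrier := mon tree x\<rparr>) act (lab tree x)) q \<and>
    le_at tree x = pullback_rel (lab tree x) (gr_map (M\<lparr>carrier := mon tree x\<rparr>) act (lab tree x)) q"
    unfolding tree_simps(2,3) .
  show "(child_act tree x u y, child_act tree x u z) \<in> child_le tree x"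
    if yz: "(y, z) \<in> child_le tree x" and u: "u \<in> mon tree x" for y z u
  proof -
    obtain i j where ij: "(i, j) \<in> ord (node x)" "y = child_node x i" "z = child_node x j" using yz by auto
    then have "arity (node x) \<noteq> 0" using leaf vertex_fg[OF x] by fastforce
    then have "(index_act (node x) u i, index_act (node x) u j) \<in> ord (node x)"
      using is_splitD(14)[OF vertex_split[OF x]] u ij by simp
    then show ?thesis using ij by auto
  qed
  fix y assume "y \<in> children tree x"
  then obtain i where i: "i < arity (node x)" "y = child_node x i" using children_tree[OF x] by auto
  then have sp: "is_split ?P ?X (arity (node x)) (\<lambda>i. fst (branch i (node x)))
    (\<lambda>i. snd (branch i (node x))) (ord (node x)) (index_act (node x))" using vertex_split[OF x] by simp
  have "stabilizer (M\<lparr>carrier := ?P\<rparr>) (index_act (node x)) i = fst (branch i (node x))"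
    by (rule is_splitD(8)[OF sp i(1)])
  then show "stabilizer (M\<lparr>carrier := mon tree x\<rparr>) (child_act tree x) y = mon tree y"
    unfolding stabilizer_def using i(2) by simp
  show "act u ` lab tree y \<subseteq> lab tree (child_act tree x u y)" if "u \<in> mon tree x" for u
    using is_splitD(13)[OF sp i(1), of u] i(2) that by simp
  \<comment> \<open>The smaller monoid of a child offers fewer multipliers, so its
    \<open>loc\<close> is contained in that of the parent.\<close>
  have "fst (branch i (node x)) \<subseteq> ?P" "snd (branch i (node x)) \<subseteq> ?X"
    using is_splitD(11)[OF sp i(1)] is_splitD(2)[OF sp] i(1) by auto
  then show "(s, t) \<in> le_at tree x" if "(s, t) \<in> le_at tree y" for s t
    using that i(2) loc_mono by auto
qed

section \<open>Root paths and the relation determined by the tree\<close>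

lemma edge_in: "(x, y) \<in> edges tree \<Longrightarrow> x \<in> verts tree \<and> y \<in> verts tree"
  using rooted_tree.edges_in[OF rooted_tree_tree] by blast

lemma edge_iff: "x \<in> verts tree \<Longrightarrow> (x, y) \<in> edges tree \<longleftrightarrow> (\<exists>i<arity (node x). y = child_node x i)"
  using children_tree[of x] unfolding children_def by blast

lemma edge_subset:
  assumes e: "(x, y) \<in> edges tree"
  shows "snd (node y) \<subseteq> snd (node x)"
proof -
  have x: "x \<in> verts tree" using edge_in[OF e] by blast
  then obtain i where i: "i < arity (node x)" "y = child_node x i" using e edge_iff by blast
  then have "snd (node x) = (\<Union>i<arity (node x). snd (branch i (node x)))"
    using is_splitD(2)[OF vertex_split[OF x]] by simp
  then show ?thesis using i by auto
qed

lemma root_path_nth: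
  assumes "root_path tree xs" "i < length xs"
  shows "xs ! i \<in> verts tree"
proof (cases i)
  case 0
  have "0 \<in> verts tree" using rooted_tree.root_in[OF rooted_tree_tree] by simp
  moreover have "xs ! 0 = 0" using assms(1) hd_conv_nth[of xs] unfolding root_path_def by simp
  ultimately show ?thesis using 0 by simp
next
  case (Suc j)
  then show ?thesis using assms edge_in unfolding root_path_def by blast
qed

lemma root_path_mono:
  assumes "root_path tree xs" "i \<le> j" "j < length xs"
  shows "snd (node (xs ! j)) \<subseteq> snd (node (xs ! i))"
  using assms(2,3)
proof (induction j rule: dec_induct)
  case (step j)
  then show ?case using edge_subset assms(1) unfolding root_path_def by fastforce
qed simp

lemma root_path_last: "root_path tree xs \<Longrightarrow> i < length xs \<Longrightarrow> snd (node (last xs)) \<subseteq> snd (node (xs ! i))"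
  using root_path_mono[of xs i "length xs - 1"] last_conv_nth[of xs] by (cases xs) auto

lemma root_path_snoc:
  assumes rp: "root_path tree xs" and y: "(last xs, y) \<in> edges tree"
  shows "root_path tree (xs @ [y])"
  unfolding root_path_def
proof (intro conjI allI impI)
  have xs: "xs \<noteq> []" using rp unfolding root_path_def by simp
  then show "xs @ [y] \<noteq> []" "hd (xs @ [y]) = root tree" using rp unfolding root_path_def by auto
  fix i assume i: "Suc i < length (xs @ [y])"
  show "((xs @ [y]) ! i, (xs @ [y]) ! Suc i) \<in> edges tree"
  proof (cases "Suc i < length xs")
    case True
    then show ?thesis using rp unfolding root_path_def by (simp add: nth_append)
  next
    case False
    then have "i = length xs - 1" "Suc i = length xs" using i by auto
    then show ?thesis using y xs by (simp add: nth_append last_conv_nth)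
  qed
qed

text \<open>Nodes decrease along edges, so a path can be prolonged only finitely often while both
  elements stay in the label.\<close>

lemma ex_max_path_extending:
  assumes "root_path tree xs" "s \<in> snd (node (last xs))" "t \<in> snd (node (last xs))"
  shows "\<exists>ys. max_path tree s t ys"
  using wf_smaller_node assms
proof (induction "node (last xs)" arbitrary: xs rule: wf_induct_rule)
  case less
  have xs: "xs \<noteq> []" using less.prems(1) unfolding root_path_def by simp
  then have v: "last xs \<in> verts tree"
    using root_path_nth[OF less.prems(1), of "length xs - 1"] by (simp add: last_conv_nth)
  show ?case
  proof (cases "\<exists>y. (last xs, y) \<in> edges tree \<and> s \<in> snd (node y) \<and> t \<in> snd (node y)")
    case True
    then obtain y where y: "(last xs, y) \<in> edges tree" "s \<in> snd (node y)" "t \<in> snd (node y)" by blast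
    then obtain i where "i < arity (node (last xs))" "y = child_node (last xs) i" using edge_iff[OF v] by blast
    then have "(node y, node (last xs)) \<in> smaller_node" using good_branch good_vertex[OF v] by simp
    then show ?thesis
      using less.hyps[of "xs @ [y]"] root_path_snoc[OF less.prems(1) y(1)] y by simp
  next
    case False
    \<comment> \<open>Labels shrink along a path, so the first vertex of a proper extension would
      already be a child containing both elements.\<close>
    have mx: "ys = []" if ys: "root_path tree (xs @ ys)" "s \<in> lab tree (last (xs @ ys))" "t \<in> lab tree (last (xs @ ys))" for ys
    proof (rule ccontr)
      assume "ys \<noteq> []"
      then obtain y zs where ys': "ys = y # zs" by (cases ys) auto
      have "((xs @ ys) ! (length xs - 1), (xs @ ys) ! Suc (length xs - 1)) \<in> edges tree"
      proof -
        have "Suc (length xs - 1) < length (xs @ ys)" using xs ys' by simp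
        then show ?thesis using ys(1) unfolding root_path_def by blast
      qed
      then have "(last xs, y) \<in> edges tree" using xs by (simp add: ys' nth_append last_conv_nth)
      moreover have "snd (node (last (xs @ ys))) \<subseteq> snd (node y)"
        using root_path_last[OF ys(1), of "length xs"] by (simp add: ys')
      ultimately show False using False ys(2,3) by auto
    qed
    have "max_path tree s t xs"
      unfolding max_path_def
    proof (intro conjI allI impI)
      show "root_path tree xs" by (rule less.prems)
      show "s \<in> lab tree (last xs)" "t \<in> lab tree (last xs)" using less.prems(2,3) by simp_all
    qed (elim conjE, rule mx)
    then show ?thesis ..
  qed
qed

text \<open>Every preorder on the path is total and contains \<open>R\<close>, so a strict
  comparison there goes the way of \<open>R\<close>. If all of them regard the pair as equivalent,
  then either the path ends at a leaf, where equivalence implies \<open>R\<close>, or the elements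
  lie in different children, whose order is \<open>R\<close>.\<close>

lemma determined_rel_tree: "determined_rel S tree = R"
proof (intro equalityI subrelI)
  fix s t assume "(s, t) \<in> determined_rel S tree"
  then obtain xs where st: "s \<in> S" "t \<in> S" and mp: "max_path tree s t xs"
    and cases: "((\<forall>i<length xs. po_equiv (le_at tree (xs ! i)) s t) \<and>
        (is_leaf tree (last xs) \<or>
         (\<exists>y\<in>children tree (last xs). \<exists>z\<in>children tree (last xs).
            s \<in> lab tree y \<and> t \<in> lab tree z \<and> (y, z) \<in> child_le tree (last xs) \<and> y \<noteq> z)))
      \<or> (\<exists>i<length xs. po_less (le_at tree (xs ! i)) s t)"
    unfolding determined_rel_def by blast
  have rp: "root_path tree xs" and last: "s \<in> snd (node (last xs))" "t \<in> snd (node (last xs))"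
    using mp unfolding max_path_def tree_simps(2) by blast+
  have xs: "xs \<noteq> []" using rp unfolding root_path_def by simp
  then have v: "last xs \<in> verts tree"
    using root_path_nth[OF rp, of "length xs - 1"] by (simp add: last_conv_nth)
  from cases consider
      i where "i < length xs" "po_less (le_at tree (xs ! i)) s t"
    | "po_equiv (le_at tree (last xs)) s t" "is_leaf tree (last xs)"
    | y z where "po_equiv (le_at tree (last xs)) s t" "y \<in> children tree (last xs)" "z \<in> children tree (last xs)"
        "s \<in> lab tree y" "t \<in> lab tree z" "(y, z) \<in> child_le tree (last xs)" "y \<noteq> z"
    using xs by (metis last_conv_nth diff_less length_greater_0_conv zero_less_one)
  then show "(s, t) \<in> R"
  proof cases
    case (1 i)
    have "\<not> loc (fst (node (xs ! i))) t s"
      using 1 root_path_last[OF rp] last unfolding po_less_def by auto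
    then have "(t, s) \<notin> R" using R_loc[OF vertex_submonoid[OF root_path_nth[OF rp]]] 1 by blast
    then show ?thesis using R_total st by blast
  next
    case 2
    then show ?thesis
      using leaf vertex_fg[OF v] is_leaf_tree[OF v] po_equiv_tree[OF v] by blast
  next
    case (3 y z)
    then obtain i j where ij: "i < arity (node (last xs))" "j < arity (node (last xs))"
      "y = child_node (last xs) i" "z = child_node (last xs) j" using children_tree[OF v] by auto
    have "is_split (fst (node (last xs))) (snd (node (last xs))) (arity (node (last xs)))
      (\<lambda>i. fst (branch i (node (last xs)))) (\<lambda>i. snd (branch i (node (last xs)))) (ord (node (last xs)))
      (index_act (node (last xs)))" using vertex_split[OF v] ij by simp
    moreover have "eqv (fst (node (last xs))) s t" using 3 po_equiv_tree[OF v] by simp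
    ultimately have "(i, j) \<in> ord (node (last xs)) \<longleftrightarrow> (s, t) \<in> R"
      using is_splitD(7)[of _ _ _ _ _ _ _ i j s t] 3 ij by simp
    then show ?thesis using 3 ij by auto
  qed
next
  fix s t assume R: "(s, t) \<in> R"
  then have st: "s \<in> S" "t \<in> S" using R_sub by blast+
  have "root_path tree [0]" unfolding root_path_def by simp
  then obtain xs where mp: "max_path tree s t xs" using ex_max_path_extending[of "[0]" s t] st by auto
  have rp: "root_path tree xs" and last: "s \<in> snd (node (last xs))" "t \<in> snd (node (last xs))"
    and mx: "\<And>ys. root_path tree (xs @ ys) \<Longrightarrow> s \<in> snd (node (last (xs @ ys))) \<Longrightarrow>
      t \<in> snd (node (last (xs @ ys))) \<Longrightarrow> ys = []"
    using mp unfolding max_path_def tree_simps(2) by blast+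
  have xs: "xs \<noteq> []" using rp unfolding root_path_def by simp
  then have v: "last xs \<in> verts tree"
    using root_path_nth[OF rp, of "length xs - 1"] by (simp add: last_conv_nth)
  have in_i: "s \<in> snd (node (xs ! i))" "t \<in> snd (node (xs ! i))" if "i < length xs" for i
    using root_path_last[OF rp that] last by auto
  have loc_i: "(s, t) \<in> le_at tree (xs ! i)" if "i < length xs" for i
    using R_loc[OF vertex_submonoid[OF root_path_nth[OF rp that]] R] in_i[OF that] by simp
  show "(s, t) \<in> determined_rel S tree"
  proof (cases "\<forall>i<length xs. po_equiv (le_at tree (xs ! i)) s t")
    case True
    have "is_leaf tree (last xs) \<or>
         (\<exists>y\<in>children tree (last xs). \<exists>z\<in>children tree (last xs).
            s \<in> lab tree y \<and> t \<in> lab tree z \<and> (y, z) \<in> child_le tree (last xs) \<and> y \<noteq> z)"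
    proof (cases "arity (node (last xs)) = 0")
      case True
      then show ?thesis using is_leaf_tree[OF v] by simp
    next
      case False
      note sp = vertex_split[OF v False]
      then have "snd (node (last xs)) = (\<Union>i<arity (node (last xs)). snd (branch i (node (last xs))))"
        by (rule is_splitD(2))
      then obtain i j where ij: "i < arity (node (last xs))" "j < arity (node (last xs))"
        "s \<in> snd (branch i (node (last xs)))" "t \<in> snd (branch j (node (last xs)))" using last by auto
      \<comment> \<open>A common child would prolong the maximal path.\<close>
      have "i \<noteq> j"
      proof
        assume [simp]: "i = j"
        have "(last xs, child_node (last xs) i) \<in> edges tree" using edge_iff[OF v] ij by blast
        then have "root_path tree (xs @ [child_node (last xs) i])" by (rule root_path_snoc[OF rp])
        then show False using mx[of "[child_node (last xs) i]"] ij by simp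
      qed
      moreover have "eqv (fst (node (last xs))) s t"
      proof -
        have "po_equiv (le_at tree (xs ! (length xs - 1))) s t" using True xs by simp
        then have "po_equiv (le_at tree (last xs)) s t" unfolding last_conv_nth[OF xs] .
        then show ?thesis using po_equiv_tree[OF v] by blast
      qed
      ultimately have "(i, j) \<in> ord (node (last xs))" using is_splitD(7)[OF sp ij] R by blast
      then show ?thesis
        using ij \<open>i \<noteq> j\<close> children_tree[OF v]
        by (intro disjI2 bexI[of _ "child_node (last xs) i"] bexI[of _ "child_node (last xs) j"]) auto
    qed
    then show ?thesis unfolding determined_rel_def using st mp True by blast
  next
    case False
    \<comment> \<open>At the first vertex where equivalence fails, \<open>loc_i\<close> still gives
      one direction, so the comparison is strict there.\<close>
    define i where "i = (LEAST i. i < length xs \<and> \<not> po_equiv (le_at tree (xs ! i)) s t)"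
    have i: "i < length xs \<and> \<not> po_equiv (le_at tree (xs ! i)) s t"
      unfolding i_def by (rule LeastI_ex) (use False in blast)
    have "po_equiv (le_at tree (xs ! j)) s t" if "j < i" for j
      using not_less_Least[OF that[unfolded i_def]] that i by auto
    moreover have "po_less (le_at tree (xs ! i)) s t"
      using i loc_i unfolding po_less_def po_equiv_def by blast
    ultimately show ?thesis unfolding determined_rel_def using st mp i by blast
  qed
qed

end

theorem theorem6p11:
  fixes M :: "('m, 'b) monoid_scheme" and act :: "'m \<Rightarrow> 's \<Rightarrow> 's"
    and S :: "'s set" and R :: "'s rel"
  assumes "comm_monoid M"
    and "fg_submonoid (carrier M) M"
    and "fg_monoid_set M act S"
    and "monoid_set_preorder M act S R"
  shows "\<exists>\<mu> :: (nat, 's, 'm) monoid_partree.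
           monoid_partree_on M act S \<mu> \<and> R = determined_rel S \<mu>"
proof -
  interpret fg_monoid_set M act S by (rule assms(3))
  interpret preordered_monoid_set M act S R by unfold_locales (rule assms(4))
  have "orbit M act a = (\<lambda>u. act u a) ` carrier M" for a unfolding orbit_def by auto
  then have fgS: "fg_set (carrier M) S" using fin_gen unfolding fg_set_def by simp
  define leaf where "leaf \<sigma> \<longleftrightarrow> (\<forall>s\<in>snd \<sigma>. \<forall>t\<in>snd \<sigma>. eqv (fst \<sigma>) s t \<longrightarrow> (s, t) \<in> R)" for \<sigma> :: "'m set \<times> 's set"
  \<comment> \<open>The conditions stand under the existential quantifiers so that the splitting can
    be chosen as functions on all nodes, with arbitrary values where no splitting is
    required.\<close>
  have "\<exists>n Ps Xs ord a. fg_submonoid (fst \<sigma>) M \<longrightarrow> fg_set (fst \<sigma>) (snd \<sigma>) \<longrightarrow> \<not> leaf \<sigma> \<longrightarrow>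
    is_split (fst \<sigma>) (snd \<sigma>) n Ps Xs ord a" for \<sigma>
    using node_split unfolding leaf_def by meson
  then obtain n Ps Xs ord a where sp: "\<And>\<sigma>. fg_submonoid (fst \<sigma>) M \<Longrightarrow> fg_set (fst \<sigma>) (snd \<sigma>) \<Longrightarrow>
    \<not> leaf \<sigma> \<Longrightarrow> is_split (fst \<sigma>) (snd \<sigma>) (n \<sigma>) (Ps \<sigma>) (Xs \<sigma>) (ord \<sigma>) (a \<sigma>)" by metis
  interpret T: split_tree M act S R "\<lambda>\<sigma>. if leaf \<sigma> then 0 else n \<sigma>" "\<lambda>i \<sigma>. (Ps \<sigma> i, Xs \<sigma> i)"
    "\<lambda>\<sigma>. if leaf \<sigma> then {} else ord \<sigma>" a
  proof
    show "fg_submonoid (carrier M) M" by (rule assms(2))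
    show "fg_set (carrier M) S" by (rule fgS)
    fix \<sigma> assume \<sigma>: "fg_submonoid (fst \<sigma>) M" "fg_set (fst \<sigma>) (snd \<sigma>)"
    show "(if leaf \<sigma> then {} else ord \<sigma>) = {} \<and> (\<forall>s\<in>snd \<sigma>. \<forall>t\<in>snd \<sigma>. eqv (fst \<sigma>) s t \<longrightarrow> (s, t) \<in> R)"
      if "(if leaf \<sigma> then 0 else n \<sigma>) = 0"
    proof (cases "leaf \<sigma>")
      case True
      then show ?thesis unfolding leaf_def by simp
    next
      case False
      then show ?thesis using is_splitD(1)[OF sp[OF \<sigma> False]] that by simp
    qed
    show "is_split (fst \<sigma>) (snd \<sigma>) (if leaf \<sigma> then 0 else n \<sigma>) (\<lambda>i. fst (Ps \<sigma> i, Xs \<sigma> i))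
      (\<lambda>i. snd (Ps \<sigma> i, Xs \<sigma> i)) (if leaf \<sigma> then {} else ord \<sigma>) (a \<sigma>)"
      if "(if leaf \<sigma> then 0 else n \<sigma>) \<noteq> 0"
      using sp[OF \<sigma>] that by (simp split: if_splits)
  qed
  show ?thesis using T.monoid_partree_on_tree T.determined_rel_tree by blast
qed

end
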